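(* Let $S$ be a monoid defined by a presentation $\langle A\mid\mathfrak{R}\rangle$, let $H$ be an $\mathscr{H}$-class of $S$, and let $\mathcal{G}$ be the Schützenberger group of $H$. With the notation of the context, $\mathcal{G}$ is defined by the presentation $\langle B\mid\mathfrak{U}\rangle$. Furthermore, if $X$ is a homotopy base for $\langle A\mid\mathfrak{R}\rangle$ then $Y_1\cup Y_2\cup Y_3$ is a homotopy base for $\langle B\mid\mathfrak{U}\rangle$, where $$Y_1=\{\phi(\lambda\cdot\kappa(\alpha,\iota\mathbb{P}\beta*j),\kappa(\mathbb{P},\beta*j)) : \mathbb{P}\in X,\ \alpha,\beta\in A^*,\ j\in J,\ \lambda\in\Lambda,\ \alpha\iota\mathbb{P}\beta*j\neq0,\ H_\lambda\subseteq Sr_{\alpha\iota\mathbb{P}\beta*j}\},$$ $$Y_2=\{(\mathbb{D}_y^{-1}\cdot y)\circ(y\cdot\mathbb{D}_y^* ) : y\in W\},$$ and $Y_3$ is the set of all closed paths $$\Lambda_{u_\epsilon}'^{-1}\circ\mathbb{A}^{\epsilon}_{u=v}\circ\Lambda'_{u_{-\epsilon}}\circ(\phi_\omega(\pi(u_{-\epsilon}))\cdot\mathbb{D}_y^{-1})\circ\mathbb{Q}_{u,v,\epsilon,w_2}^{-1}\circ(\phi_\omega(\pi(u_\epsilon))\cdot\mathbb{D}_y)$$ where $w_2\in B^*$, $(u=v)\in\mathfrak{U}$, $\epsilon=\pm1$, $u_{+1}\equiv u$, $u_{-1}\equiv v$, $y\equiv\phi(1,\kappa(h,\psi(w_2)*\eta))$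 and $$\mathbb{Q}_{u,v,\epsilon,w_2}=\phi(1,\kappa(\mathbb{P}[u,v]^\epsilon,\psi(w_2)*\eta))\cdot\hat{y}.$$ In particular, if $A$, $\mathfrak{R}$, $J$, $\Lambda$ and $X$ are all finite then both the presentation $\langle B\mid\mathfrak{U}\rangle$ and the homotopy base $Y_1\cup Y_2\cup Y_3$ are finite.
   Context: Let $S$ be a monoid defined by a monoid presentation $\mathcal{P}=\langle A\mid\mathfrak{R}\rangle$, where $\mathfrak{R}\subseteq A^*\times A^*$ and a rule $(u,v)$ is written $u=v$. For words, $\equiv$ means identical as words and $=$ means representing the same element of the monoid; words of $A^*$ also denote the elements of $S$ they represent; $1$ also denotes the empty word. $\mathscr{R},\mathscr{L},\mathscr{H}=\mathscr{R}\cap\mathscr{L}$ are Green's relations. $H$ is a fixed $\mathscr{H}$-class of $S$ and $R$ the $\mathscr{R}$-class containing it. $\mathrm{Stab}(H)=\{s\in S:Hs=H\}$; $(s,t)\in\sigma$ iff $xs=xt$ for all $x\in H$; $\mathcal{G}=\mathrm{Stab}(H)/\sigma$ is the (right) Schützenberger group of $H$. Fix a word $h\in A^*$ representing an element of $H$. Let $\{H_\lambda:\lambda\in\Lambda\}$ be the set of all $\mathscr{H}$-classes in $R$, with a distinguished $1\in\Lambda$, $H_1=H$. Fix words $p_\lambda,p'_\lambda\in A^*$ with $Hp_\lambda=H_\lambda$, $h_1p_\lambda p'_\lambda=h_1$, $h_2p'_\lambda p_\lambda=h_2$ for all $h_1\in H$, $h_2\in H_\lambda$, and $p_1\equiv p_1'\equiv1$.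 $S$ acts on the right of $\Lambda\cup\{0\}$: $\lambda\cdot s=\mu$ if $H_\lambda s=H_\mu$ with $\mu\in\Lambda$, and $\lambda\cdot s=0$ otherwise. Let $B=\{b[\lambda,a]:\lambda\in\Lambda,a\in A,\lambda\cdot a\neq0\}$ be an abstract set of letters, and $\psi:B^*\to A^*$ the homomorphism $b[\lambda,a]\mapsto p_\lambda ap'_{\lambda\cdot a}$; $b[\lambda,a]$ represents $\psi(b[\lambda,a])/\sigma\in\mathcal{G}$. For $\lambda\cdot w\neq0$ ($w\in A^*$) define $\phi(\lambda,w)\in B^*$ by $\phi(\lambda,1)=1$, $\phi(\lambda,aw)=b[\lambda,a]\,\phi(\lambda\cdot a,w)$. Let $\pi:B^*\to A^*$ be a homomorphism such that $\pi(b[\lambda,a])$ is a chosen word with $hp_\lambda ap'_{\lambda\cdot a}=\pi(b[\lambda,a])h$ in $S$. $S$ acts on the left of $S/\mathscr{R}$ by $s*R'=R''$ iff $sR'\subseteq R''$. Let $\{R_i:i\in I\}$ be the inverse orbit $\{R':\exists s\in S,\ s*R'=R\}$; $S$ acts on $I\cup\{0\}$ by $s*i=j$ if $j\in I$ and $s*R_i=R_j$, and $s*i=0$ otherwise. Let $e\in A^*$ be a fixed word with $xe=x$ in $S$ for all $x\in H$. Let $\omega,\eta\in I$ be the indices with $R_\omega=R$ and $e\in R_\eta$. For each $i\in I$ fix a word $r_i$ representing an element of $R_i$; the choices are assumed to satisfy $r_\omega\equiv h$, $r_\eta\equiv e$, and $r_{i}\equiv1$ for the index $i$ of the $\mathscr{R}$-class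 of $1_S$. For $a\in A$, $i\in I$ with $a*i\neq0$ fix a word $\kappa(a,i)\in A^*$ with $ar_i=r_{a*i}\kappa(a,i)$ in $S$, and for $w*i\ne0$ define $\kappa(w,i)$ by $\kappa(1,i)=1$, $\kappa(wa,i)=\kappa(w,a*i)\kappa(a,i)$. Let $J$ be the set of $j\in I$ with $R_j=s*R_\eta$ for some $s\in S$. Write $\phi_\omega(\pi(w))=\phi(1,\kappa(\pi(w),\omega))$ for $w\in B^*$. $\mathcal{Q}=\langle B\mid\mathfrak{U}\rangle$ has as relations: (R1) $\phi(\lambda,u)=\phi(\lambda,v)$ for $\lambda\in\Lambda$, $(u=v)\in\mathfrak{R}$, $\lambda\cdot u\neq0$; (R2) $\phi(\lambda,\kappa(u,j))=\phi(\lambda,\kappa(v,j))$ for $\lambda\in\Lambda$, $j\in J$, $(u=v)\in\mathfrak{R}$, $u*j\neq0$, $H_\lambda\subseteq Sr_{u*j}$; (R3) $b[\lambda,a]=\phi(1,\kappa(\pi(b[\lambda,a]),\omega))$ for $b[\lambda,a]\in B$; (R4) $1=\phi(1,\kappa(h,\eta))$. Derivation graphs and homotopy. For a presentation $\langle A\mid\mathfrak{R}\rangle$ the derivation graph $\Gamma$ has vertex set $A^*$ and edges $\mathbb{E}=(\alpha,r,\epsilon,\beta)$ ($\alpha,\beta\in A^*$, $r=(r_{+1},r_{-1})\in\mathfrak{R}$, $\epsilon=\pm1$), $\iota\mathbb{E}=\alpha r_\epsilon\beta$, $\tau\mathbb{E}=\alpha r_{-\epsilon}\beta$, $\mathbb{E}^{-1}=(\alpha,r,-\epsilon,\beta)$;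 $\mathbb{A}_r^\epsilon=(1,r,\epsilon,1)$ are the elementary edges. Paths are composed with $\circ$ (empty paths allowed); $A^*$ acts by $\gamma\cdot\mathbb{E}\cdot\delta=(\gamma\alpha,r,\epsilon,\beta\delta)$, extended to paths. The Squier complex has 1-skeleton $\Gamma$ and defining closed paths $[\mathbb{E}_1,\mathbb{E}_2]=(\mathbb{E}_1\cdot\iota\mathbb{E}_2)\circ(\tau\mathbb{E}_1\cdot\mathbb{E}_2)\circ(\mathbb{E}_1^{-1}\cdot\tau\mathbb{E}_2)\circ(\iota\mathbb{E}_1\cdot\mathbb{E}_2^{-1})$ for all edges $\mathbb{E}_1,\mathbb{E}_2$. Homotopy of paths is generated by inserting/deleting $e\circ e^{-1}$ and replacing a subpath $p$ by $q$ when $p\circ q^{-1}$ is a cyclic permutation of a defining path or of the inverse of one. A set $X$ of closed paths is a homotopy base if, after adjoining all $\alpha\cdot\mathbb{P}\cdot\beta$ ($\alpha,\beta\in A^*$, $\mathbb{P}\in X$) as defining paths, every closed path is homotopic to an empty path. $\phi$ on paths. For an edge $\mathbb{F}=\alpha\cdot\mathbb{A}_r^\epsilon\cdot\beta$ of $\Gamma(\mathcal{P})$, $\lambda\in\Lambda$, $j\in J$ with $\iota\mathbb{F}*j\neq0$, $\lambda\cdot\kappa(\iota\mathbb{F},j)\ne0$ and $H_\lambda\subseteq Sr_{\iota\mathbb{F}*j}$, write $\mathbb{A}=\mathbb{A}_r^\epsilon$. If $\alpha\equiv\beta\equiv1$ and $r=(u,v)$ then $\phi(\lambda,\kappa(\mathbb{A},j))$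 is the elementary edge $\mathbb{A}^\epsilon_\rho$ of $\Gamma(\mathcal{Q})$ with $\rho$ the relation $\phi(\lambda,\kappa(u,j))=\phi(\lambda,\kappa(v,j))$ of type (R2); otherwise $\phi(\lambda,\kappa(\mathbb{F},j))=\phi(\lambda,\kappa(\alpha,\iota\mathbb{A}\beta*j))\cdot\phi(\lambda\cdot\kappa(\alpha,\iota\mathbb{A}\beta*j),\kappa(\mathbb{A},\beta*j))\cdot\phi(\lambda\cdot\kappa(\alpha\iota\mathbb{A},\beta*j),\kappa(\beta,j))$. For a path $\mathbb{P}=\mathbb{F}_1\circ\cdots\circ\mathbb{F}_m$ whose initial vertex satisfies the same three conditions, $\phi(\lambda,\kappa(\mathbb{P},j))=\phi(\lambda,\kappa(\mathbb{F}_1,j))\circ\cdots\circ\phi(\lambda,\kappa(\mathbb{F}_m,j))$ (empty paths go to empty paths). Further choices. For each $(u=v)\in\mathfrak{U}$, $\mathbb{P}[u,v]$ is a fixed path in $\Gamma(\mathcal{P})$ from $\pi(u)h$ to $\pi(v)h$. $W=\{\phi(1,\kappa(h,j)):j\in J,\ h*j\neq0\}\subseteq B^*$; for each $y\in W$, $\hat{y}\in B^*$ is a fixed word representing the inverse of $y$ in $\mathcal{G}$, and $\mathbb{D}_y$, $\mathbb{D}_y^*$ are fixed paths in $\Gamma(\mathcal{Q})$ from $y\hat{y}$, respectively $\hat{y}y$, to the empty word. For paths $\mathbb{P},\mathbb{Q}$ put $\mathbb{P}\downarrow\mathbb{Q}=(\mathbb{P}\cdot\iota\mathbb{Q})\circ(\tau\mathbb{P}\cdot\mathbb{Q})$.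 For $b\in B$ let $\mathbb{B}_b$ be the positive elementary edge of $\Gamma(\mathcal{Q})$ for the relation $b=\phi(1,\kappa(\pi(b),\omega))$ of type (R3). For $w\equiv b_1\cdots b_k\in B^+$ let $\Lambda'_w=\mathbb{B}_{b_1}\downarrow\cdots\downarrow\mathbb{B}_{b_k}$, a path from $w$ to $\phi_\omega(\pi(w))$, and let $\Lambda'_1$ be the empty path at the empty word. *)

theory Defs
  imports "HOL-Algebra.Coset"
begin

section \<open>Monoid presentations\<close>

text \<open>Words over an alphabet \<open>A\<close> are the elements of \<^term>\<open>lists A\<close>, the empty word is \<^term>\<open>[]\<close>.\<close>

definition word_val :: "('s, 'm) monoid_scheme \<Rightarrow> ('a \<Rightarrow> 's) \<Rightarrow> 'a list \<Rightarrow> 's" where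
  "word_val M g w = foldr (\<lambda>a x. g a \<otimes>\<^bsub>M\<^esub> x) w \<one>\<^bsub>M\<^esub>"

inductive_set pres_cong :: "'a set \<Rightarrow> ('a list \<times> 'a list) set \<Rightarrow> ('a list \<times> 'a list) set"
  for A :: "'a set" and R :: "('a list \<times> 'a list) set" where
  base: "(u, v) \<in> R \<Longrightarrow> (u, v) \<in> pres_cong A R"
| refl: "w \<in> lists A \<Longrightarrow> (w, w) \<in> pres_cong A R"
| sym: "(u, v) \<in> pres_cong A R \<Longrightarrow> (v, u) \<in> pres_cong A R"
| trans: "(u, v) \<in> pres_cong A R \<Longrightarrow> (v, w) \<in> pres_cong A R \<Longrightarrow> (u, w) \<in> pres_cong A R"
| mult: "(u, v) \<in> pres_cong A R \<Longrightarrow> (x, y) \<in> pres_cong A R \<Longrightarrow> (u @ x, v @ y) \<in> pres_cong A R"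

text \<open>\<open>M\<close> is defined by the presentation with generators \<open>A\<close> and relations \<open>R\<close>, the
  generator \<open>a\<close> representing \<open>g a\<close>: the induced homomorphism from the free monoid onto \<open>M\<close> is
  surjective with kernel the congruence generated by \<open>R\<close>.\<close>

definition defined_by_pres ::
  "('s, 'm) monoid_scheme \<Rightarrow> ('a \<Rightarrow> 's) \<Rightarrow> 'a set \<Rightarrow> ('a list \<times> 'a list) set \<Rightarrow> bool" where
  "defined_by_pres M g A R \<longleftrightarrow>
     monoid M \<and> R \<subseteq> lists A \<times> lists A \<and> g \<in> A \<rightarrow> carrier M \<and>
     word_val M g ` lists A = carrier M \<and>
     (\<forall>u\<in>lists A. \<forall>v\<in>lists A. word_val M g u = word_val M g v \<longleftrightarrow> (u, v) \<in> pres_cong A R)"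


section \<open>Green's relations and the right Schuetzenberger group\<close>

definition green_R :: "('s, 'm) monoid_scheme \<Rightarrow> ('s \<times> 's) set" where
  "green_R S = {(s, t). s \<in> carrier S \<and> t \<in> carrier S \<and> s <#\<^bsub>S\<^esub> carrier S = t <#\<^bsub>S\<^esub> carrier S}"

definition green_L :: "('s, 'm) monoid_scheme \<Rightarrow> ('s \<times> 's) set" where
  "green_L S = {(s, t). s \<in> carrier S \<and> t \<in> carrier S \<and> carrier S #>\<^bsub>S\<^esub> s = carrier S #>\<^bsub>S\<^esub> t}"

definition green_H :: "('s, 'm) monoid_scheme \<Rightarrow> ('s \<times> 's) set" where
  "green_H S = green_R S \<inter> green_L S"

definition schutz_stab :: "('s, 'm) monoid_scheme \<Rightarrow> 's set \<Rightarrow> 's set" where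
  "schutz_stab S H = {s \<in> carrier S. H #>\<^bsub>S\<^esub> s = H}"

definition schutz_sigma :: "('s, 'm) monoid_scheme \<Rightarrow> 's set \<Rightarrow> ('s \<times> 's) set" where
  "schutz_sigma S H = {(s, t). s \<in> schutz_stab S H \<and> t \<in> schutz_stab S H \<and>
     (\<forall>x\<in>H. x \<otimes>\<^bsub>S\<^esub> s = x \<otimes>\<^bsub>S\<^esub> t)}"

definition schutz_group :: "('s, 'm) monoid_scheme \<Rightarrow> 's set \<Rightarrow> 's set monoid" where
  "schutz_group S H =
     \<lparr>carrier = schutz_stab S H // schutz_sigma S H,
      mult = (\<lambda>X Y. \<Union>s\<in>X. \<Union>t\<in>Y. schutz_sigma S H `` {s \<otimes>\<^bsub>S\<^esub> t}),
      one = schutz_sigma S H `` {\<one>\<^bsub>S\<^esub>}\<rparr>"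


section \<open>Derivation graphs and homotopy\<close>

text \<open>\<open>Edge \<alpha> r \<epsilon> \<beta>\<close> is the edge $(\alpha, r, \epsilon, \beta)$; the sign is a Boolean, with
  \<^term>\<open>True\<close> for $+1$ and \<^term>\<open>False\<close> for $-1$.\<close>

datatype 'a edge = Edge "'a list" "'a list \<times> 'a list" bool "'a list"

definition rel_side :: "'a list \<times> 'a list \<Rightarrow> bool \<Rightarrow> 'a list" where
  "rel_side r \<epsilon> = (if \<epsilon> then fst r else snd r)"

fun edge_init :: "'a edge \<Rightarrow> 'a list" where
  "edge_init (Edge \<alpha> r \<epsilon> \<beta>) = \<alpha> @ rel_side r \<epsilon> @ \<beta>"

fun edge_term :: "'a edge \<Rightarrow> 'a list" where
  "edge_term (Edge \<alpha> r \<epsilon> \<beta>) = \<alpha> @ rel_side r (\<not> \<epsilon>) @ \<beta>"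

fun edge_inv :: "'a edge \<Rightarrow> 'a edge" where
  "edge_inv (Edge \<alpha> r \<epsilon> \<beta>) = Edge \<alpha> r (\<not> \<epsilon>) \<beta>"

fun edge_act :: "'a list \<Rightarrow> 'a edge \<Rightarrow> 'a list \<Rightarrow> 'a edge" where
  "edge_act \<gamma> (Edge \<alpha> r \<epsilon> \<beta>) \<delta> = Edge (\<gamma> @ \<alpha>) r \<epsilon> (\<beta> @ \<delta>)"

definition elem_edge :: "'a list \<times> 'a list \<Rightarrow> bool \<Rightarrow> 'a edge" where
  "elem_edge r \<epsilon> = Edge [] r \<epsilon> []"

definition graph_edges :: "'a set \<Rightarrow> ('a list \<times> 'a list) set \<Rightarrow> 'a edge set" where
  "graph_edges A R = {Edge \<alpha> r \<epsilon> \<beta> | \<alpha> r \<epsilon> \<beta>. \<alpha> \<in> lists A \<and> \<beta> \<in> lists A \<and> r \<in> R}"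

text \<open>A path is its initial vertex together with its list of edges, so that there is an empty
  path at every vertex.\<close>

type_synonym 'a dpath = "'a list \<times> 'a edge list"

primrec edge_chain :: "'a list \<Rightarrow> 'a edge list \<Rightarrow> bool" where
  "edge_chain u [] \<longleftrightarrow> True"
| "edge_chain u (E # Es) \<longleftrightarrow> edge_init E = u \<and> edge_chain (edge_term E) Es"

definition is_dpath :: "'a set \<Rightarrow> ('a list \<times> 'a list) set \<Rightarrow> 'a dpath \<Rightarrow> bool" where
  "is_dpath A R P \<longleftrightarrow>
     fst P \<in> lists A \<and> set (snd P) \<subseteq> graph_edges A R \<and> edge_chain (fst P) (snd P)"

abbreviation path_init :: "'a dpath \<Rightarrow> 'a list" where
  "path_init P \<equiv> fst P"

definition path_term :: "'a dpath \<Rightarrow> 'a list" where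
  "path_term P = (if snd P = [] then fst P else edge_term (last (snd P)))"

definition path_from_to ::
  "'a set \<Rightarrow> ('a list \<times> 'a list) set \<Rightarrow> 'a dpath \<Rightarrow> 'a list \<Rightarrow> 'a list \<Rightarrow> bool" where
  "path_from_to A R P u v \<longleftrightarrow> is_dpath A R P \<and> path_init P = u \<and> path_term P = v"

definition closed_path :: "'a set \<Rightarrow> ('a list \<times> 'a list) set \<Rightarrow> 'a dpath \<Rightarrow> bool" where
  "closed_path A R P \<longleftrightarrow> is_dpath A R P \<and> path_term P = path_init P"

definition edge_path :: "'a edge \<Rightarrow> 'a dpath" where
  "edge_path E = (edge_init E, [E])"

text \<open>Composition is only meaningful if the first path ends where the second one starts.\<close>

definition path_comp :: "'a dpath \<Rightarrow> 'a dpath \<Rightarrow> 'a dpath" (infixr \<open>\<circ>\<^sub>p\<close> 65) where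
  "P \<circ>\<^sub>p Q = (fst P, snd P @ snd Q)"

definition path_inv :: "'a dpath \<Rightarrow> 'a dpath" where
  "path_inv P = (path_term P, rev (map edge_inv (snd P)))"

definition path_act :: "'a list \<Rightarrow> 'a dpath \<Rightarrow> 'a list \<Rightarrow> 'a dpath" where
  "path_act \<gamma> P \<delta> = (\<gamma> @ fst P @ \<delta>, map (\<lambda>E. edge_act \<gamma> E \<delta>) (snd P))"

definition path_pow :: "'a dpath \<Rightarrow> bool \<Rightarrow> 'a dpath" where
  "path_pow P \<epsilon> = (if \<epsilon> then P else path_inv P)"

definition path_down :: "'a dpath \<Rightarrow> 'a dpath \<Rightarrow> 'a dpath" where
  "path_down P Q = path_act [] P (path_init Q) \<circ>\<^sub>p path_act (path_term P) Q []"

definition squier_path :: "'a edge \<Rightarrow> 'a edge \<Rightarrow> 'a dpath" where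
  "squier_path E1 E2 =
     path_act [] (edge_path E1) (edge_init E2) \<circ>\<^sub>p
     path_act (edge_term E1) (edge_path E2) [] \<circ>\<^sub>p
     path_act [] (edge_path (edge_inv E1)) (edge_term E2) \<circ>\<^sub>p
     path_act (edge_init E1) (edge_path (edge_inv E2)) []"

definition squier_paths :: "'a set \<Rightarrow> ('a list \<times> 'a list) set \<Rightarrow> 'a dpath set" where
  "squier_paths A R =
     {squier_path E1 E2 | E1 E2. E1 \<in> graph_edges A R \<and> E2 \<in> graph_edges A R}"

definition cyclic_perms :: "'a dpath \<Rightarrow> 'a dpath set" where
  "cyclic_perms P = {(path_term (fst P, xs), ys @ xs) | xs ys. snd P = xs @ ys}"

inductive_set homotopy ::
  "'a set \<Rightarrow> ('a list \<times> 'a list) set \<Rightarrow> 'a dpath set \<Rightarrow> ('a dpath \<times> 'a dpath) set"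
  for A :: "'a set" and R :: "('a list \<times> 'a list) set" and C :: "'a dpath set" where
  refl: "is_dpath A R P \<Longrightarrow> (P, P) \<in> homotopy A R C"
| sym: "(P, Q) \<in> homotopy A R C \<Longrightarrow> (Q, P) \<in> homotopy A R C"
| trans: "(P, Q) \<in> homotopy A R C \<Longrightarrow> (Q, T) \<in> homotopy A R C \<Longrightarrow> (P, T) \<in> homotopy A R C"
| cancel: "is_dpath A R (w, xs @ [E, edge_inv E] @ ys) \<Longrightarrow>
    ((w, xs @ [E, edge_inv E] @ ys), (w, xs @ ys)) \<in> homotopy A R C"
| replace: "is_dpath A R (w, xs @ ps @ ys) \<Longrightarrow> is_dpath A R (w, xs @ qs @ ys) \<Longrightarrow>
    z = path_term (w, xs) \<Longrightarrow> path_term (z, ps) = path_term (z, qs) \<Longrightarrow> K \<in> C \<Longrightarrow>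
    (z, ps) \<circ>\<^sub>p path_inv (z, qs) \<in> cyclic_perms K \<union> cyclic_perms (path_inv K) \<Longrightarrow>
    ((w, xs @ ps @ ys), (w, xs @ qs @ ys)) \<in> homotopy A R C"

definition homotopy_base :: "'a set \<Rightarrow> ('a list \<times> 'a list) set \<Rightarrow> 'a dpath set \<Rightarrow> bool" where
  "homotopy_base A R X \<longleftrightarrow>
     (\<forall>P\<in>X. closed_path A R P) \<and>
     (\<forall>P. closed_path A R P \<longrightarrow>
        (P, (path_init P, []))
          \<in> homotopy A R (squier_paths A R \<union>
              {path_act \<alpha> P \<beta> | \<alpha> P \<beta>. \<alpha> \<in> lists A \<and> \<beta> \<in> lists A \<and> P \<in> X}))"


section \<open>The setting\<close>

text \<open>
  The presented monoid together with all choices that enter the definition of the presentation of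
  the Schuetzenberger group:
  \<^item> \<open>mon\<close>, \<open>gen\<close>, \<open>alph\<close>, \<open>rels\<close>: $S$, the interpretation of the letters in $S$, $A$ and
    $\mathfrak{R}$;
  \<^item> \<open>hcl\<close>, \<open>hword\<close>: $H$ and $h$;
  \<^item> \<open>Lam\<close>, \<open>lone\<close>, \<open>hcls\<close>, \<open>pw\<close>, \<open>pw'\<close>: $\Lambda$, $1 \in \Lambda$, $H_\lambda$, $p_\lambda$, $p'_\lambda$;
  \<^item> \<open>pigen\<close>: $\pi$ on letters;
  \<^item> \<open>Idx\<close>, \<open>rcls\<close>, \<open>eword\<close>, \<open>om\<close>, \<open>et\<close>, \<open>rword\<close>: $I$, $R_i$, $e$, $\omega$, $\eta$, $r_i$;
  \<^item> \<open>kap\<close>: $\kappa(a,i)$ for letters $a$.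
  The letter $b[\lambda,a]$ is the pair \<open>(\<lambda>, a)\<close>.
\<close>

record ('s, 'a, 'l, 'i) schutz_data =
  mon :: "'s monoid"
  gen :: "'a \<Rightarrow> 's"
  alph :: "'a set"
  rels :: "('a list \<times> 'a list) set"
  hcl :: "'s set"
  hword :: "'a list"
  Lam :: "'l set"
  lone :: "'l"
  hcls :: "'l \<Rightarrow> 's set"
  pw :: "'l \<Rightarrow> 'a list"
  pw' :: "'l \<Rightarrow> 'a list"
  pigen :: "'l \<times> 'a \<Rightarrow> 'a list"
  Idx :: "'i set"
  rcls :: "'i \<Rightarrow> 's set"
  eword :: "'a list"
  om :: "'i"
  et :: "'i"
  rword :: "'i \<Rightarrow> 'a list"
  kap :: "'a \<Rightarrow> 'i \<Rightarrow> 'a list"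

context
  fixes D :: "('s, 'a, 'l, 'i) schutz_data"
begin

definition val :: "'a list \<Rightarrow> 's" where
  "val w = word_val (mon D) (gen D) w"

text \<open>The \<open>\<R>\<close>-class $R$ containing $H$ (all elements of $H$ are \<open>\<R>\<close>-related).\<close>

definition rcl :: "'s set" where
  "rcl = green_R (mon D) `` hcl D"

text \<open>The two actions, restricted to words acting on nonzero points; \<^term>\<open>None\<close> is the zero.
  Below, \<^term>\<open>the\<close> is applied to such a value only where it is nonzero.\<close>

definition ract :: "'l \<Rightarrow> 'a list \<Rightarrow> 'l option" where
  "ract l w =
     (if \<exists>m\<in>Lam D. hcls D l #>\<^bsub>mon D\<^esub> val w = hcls D m
      then Some (THE m. m \<in> Lam D \<and> hcls D l #>\<^bsub>mon D\<^esub> val w = hcls D m)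
      else None)"

definition lact :: "'a list \<Rightarrow> 'i \<Rightarrow> 'i option" where
  "lact w i =
     (if \<exists>j\<in>Idx D. val w <#\<^bsub>mon D\<^esub> rcls D i \<subseteq> rcls D j
      then Some (THE j. j \<in> Idx D \<and> val w <#\<^bsub>mon D\<^esub> rcls D i \<subseteq> rcls D j)
      else None)"

definition Bgens :: "('l \<times> 'a) set" where
  "Bgens = {(l, a). l \<in> Lam D \<and> a \<in> alph D \<and> ract l [a] \<noteq> None}"

definition psi :: "('l \<times> 'a) list \<Rightarrow> 'a list" where
  "psi w = concat (map (\<lambda>(l, a). pw D l @ [a] @ pw' D (the (ract l [a]))) w)"

definition pihom :: "('l \<times> 'a) list \<Rightarrow> 'a list" where
  "pihom w = concat (map (pigen D) w)"

definition Bval :: "'l \<times> 'a \<Rightarrow> 's set" where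
  "Bval b = schutz_sigma (mon D) (hcl D) `` {val (psi [b])}"

primrec phi :: "'l \<Rightarrow> 'a list \<Rightarrow> ('l \<times> 'a) list" where
  "phi l [] = []"
| "phi l (a # w) = (l, a) # phi (the (ract l [a])) w"


text \<open>$\kappa(w,i)$ is defined by recursion from the right end of $w$, hence the reversal.\<close>

primrec kappa_rev :: "'a list \<Rightarrow> 'i \<Rightarrow> 'a list" where
  "kappa_rev [] i = []"
| "kappa_rev (a # w) i = kappa_rev w (the (lact [a] i)) @ kap D a i"

definition kappa :: "'a list \<Rightarrow> 'i \<Rightarrow> 'a list" where
  "kappa w i = kappa_rev (rev w) i"

definition Jset :: "'i set" where
  "Jset = {j \<in> Idx D. \<exists>s\<in>carrier (mon D). s <#\<^bsub>mon D\<^esub> rcls D (et D) \<subseteq> rcls D j}"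

text \<open>$H_\lambda \subseteq S r_i$\<close>

definition under :: "'l \<Rightarrow> 'i \<Rightarrow> bool" where
  "under l i \<longleftrightarrow> hcls D l \<subseteq> carrier (mon D) #>\<^bsub>mon D\<^esub> val (rword D i)"

definition phi_om :: "'a list \<Rightarrow> ('l \<times> 'a) list" where
  "phi_om w = phi (lone D) (kappa w (om D))"

definition U1 :: "(('l \<times> 'a) list \<times> ('l \<times> 'a) list) set" where
  "U1 = {(phi l u, phi l v) | l u v. l \<in> Lam D \<and> (u, v) \<in> rels D \<and> ract l u \<noteq> None}"

definition U2 :: "(('l \<times> 'a) list \<times> ('l \<times> 'a) list) set" where
  "U2 = {(phi l (kappa u j), phi l (kappa v j)) | l u v j.
           l \<in> Lam D \<and> j \<in> Jset \<and> (u, v) \<in> rels D \<and> lact u j \<noteq> None \<and> under l (the (lact u j))}"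

definition U3 :: "(('l \<times> 'a) list \<times> ('l \<times> 'a) list) set" where
  "U3 = {([b], phi_om (pihom [b])) | b. b \<in> Bgens}"

definition U4 :: "(('l \<times> 'a) list \<times> ('l \<times> 'a) list) set" where
  "U4 = {([], phi (lone D) (kappa (hword D) (et D)))}"

definition Urels :: "(('l \<times> 'a) list \<times> ('l \<times> 'a) list) set" where
  "Urels = U1 \<union> U2 \<union> U3 \<union> U4"

definition phi_elem :: "'l \<Rightarrow> 'a list \<times> 'a list \<Rightarrow> bool \<Rightarrow> 'i \<Rightarrow> ('l \<times> 'a) edge" where
  "phi_elem l r \<epsilon> j = elem_edge (phi l (kappa (fst r) j), phi l (kappa (snd r) j)) \<epsilon>"

fun phi_edge :: "'l \<Rightarrow> 'a edge \<Rightarrow> 'i \<Rightarrow> ('l \<times> 'a) edge" where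
  "phi_edge l (Edge \<alpha> r \<epsilon> \<beta>) j =
     (if \<alpha> = [] \<and> \<beta> = [] then phi_elem l r \<epsilon> j
      else
       (let k = the (lact (rel_side r \<epsilon> @ \<beta>) j);
            j' = the (lact \<beta> j)
        in edge_act
             (phi l (kappa \<alpha> k))
             (phi_elem (the (ract l (kappa \<alpha> k))) r \<epsilon> j')
             (phi (the (ract l (kappa (\<alpha> @ rel_side r \<epsilon>) j'))) (kappa \<beta> j))))"

definition phi_path :: "'l \<Rightarrow> 'a dpath \<Rightarrow> 'i \<Rightarrow> ('l \<times> 'a) dpath" where
  "phi_path l P j = (phi l (kappa (fst P) j), map (\<lambda>F. phi_edge l F j) (snd P))"

definition Wset :: "('l \<times> 'a) list set" where
  "Wset = {phi (lone D) (kappa (hword D) j) | j. j \<in> Jset \<and> lact (hword D) j \<noteq> None}"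

definition B_edge :: "'l \<times> 'a \<Rightarrow> ('l \<times> 'a) edge" where
  "B_edge b = elem_edge ([b], phi_om (pihom [b])) True"

definition Lam_path :: "('l \<times> 'a) list \<Rightarrow> ('l \<times> 'a) dpath" where
  "Lam_path w = foldr (\<lambda>b P. path_down (edge_path (B_edge b)) P) w ([], [])"

end

locale schutz_setting =
  fixes D :: "('s, 'a, 'l, 'i) schutz_data"
  assumes pres: "defined_by_pres (mon D) (gen D) (alph D) (rels D)"
    and hcl_class: "hcl D \<in> carrier (mon D) // green_H (mon D)"
    and hword: "hword D \<in> lists (alph D)" "val D (hword D) \<in> hcl D"
    and hcls_bij: "bij_betw (hcls D) (Lam D)
          {K \<in> carrier (mon D) // green_H (mon D). K \<subseteq> rcl D}"
    and lone: "lone D \<in> Lam D" "hcls D (lone D) = hcl D"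
    and pw_words: "l \<in> Lam D \<Longrightarrow> pw D l \<in> lists (alph D)"
          "l \<in> Lam D \<Longrightarrow> pw' D l \<in> lists (alph D)"
    and pw_image: "l \<in> Lam D \<Longrightarrow> hcl D #>\<^bsub>mon D\<^esub> val D (pw D l) = hcls D l"
    and pw_pw': "l \<in> Lam D \<Longrightarrow> x \<in> hcl D \<Longrightarrow>
          x \<otimes>\<^bsub>mon D\<^esub> val D (pw D l) \<otimes>\<^bsub>mon D\<^esub> val D (pw' D l) = x"
    and pw'_pw: "l \<in> Lam D \<Longrightarrow> x \<in> hcls D l \<Longrightarrow>
          x \<otimes>\<^bsub>mon D\<^esub> val D (pw' D l) \<otimes>\<^bsub>mon D\<^esub> val D (pw D l) = x"
    and pw_lone: "pw D (lone D) = []" "pw' D (lone D) = []"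
    and pigen_word: "b \<in> Bgens D \<Longrightarrow> pigen D b \<in> lists (alph D)"
    and pigen_val: "(l, a) \<in> Bgens D \<Longrightarrow>
          val D (hword D @ pw D l @ [a] @ pw' D (the (ract D l [a])))
            = val D (pigen D (l, a) @ hword D)"
    and rcls_bij: "bij_betw (rcls D) (Idx D)
          {K \<in> carrier (mon D) // green_R (mon D).
             \<exists>s\<in>carrier (mon D). s <#\<^bsub>mon D\<^esub> K \<subseteq> rcl D}"
    and eword: "eword D \<in> lists (alph D)"
          "x \<in> hcl D \<Longrightarrow> x \<otimes>\<^bsub>mon D\<^esub> val D (eword D) = x"
    and om: "om D \<in> Idx D" "rcls D (om D) = rcl D"
    and et: "et D \<in> Idx D" "val D (eword D) \<in> rcls D (et D)"
    and rword: "i \<in> Idx D \<Longrightarrow> rword D i \<in> lists (alph D)"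
          "i \<in> Idx D \<Longrightarrow> val D (rword D i) \<in> rcls D i"
    and rword_om: "rword D (om D) = hword D"
    and rword_et: "rword D (et D) = eword D"
    and rword_one: "i \<in> Idx D \<Longrightarrow> \<one>\<^bsub>mon D\<^esub> \<in> rcls D i \<Longrightarrow> rword D i = []"
    and kap_word: "a \<in> alph D \<Longrightarrow> i \<in> Idx D \<Longrightarrow> lact D [a] i \<noteq> None \<Longrightarrow>
          kap D a i \<in> lists (alph D)"
    and kap_val: "a \<in> alph D \<Longrightarrow> i \<in> Idx D \<Longrightarrow> lact D [a] i = Some j \<Longrightarrow>
          val D (a # rword D i) = val D (rword D j @ kap D a i)"

text \<open>The further choices entering the homotopy base: \<open>Ppath u v\<close> is $\mathbb{P}[u,v]$,
  \<open>hat y\<close> is $\hat y$, \<open>Dpath y\<close> is $\mathbb{D}_y$ and \<open>Dpath' y\<close> is $\mathbb{D}_y^*$.\<close>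

record ('a, 'l) schutz_choice =
  Ppath :: "('l \<times> 'a) list \<Rightarrow> ('l \<times> 'a) list \<Rightarrow> 'a dpath"
  hat :: "('l \<times> 'a) list \<Rightarrow> ('l \<times> 'a) list"
  Dpath :: "('l \<times> 'a) list \<Rightarrow> ('l \<times> 'a) dpath"
  Dpath' :: "('l \<times> 'a) list \<Rightarrow> ('l \<times> 'a) dpath"

context
  fixes D :: "('s, 'a, 'l, 'i) schutz_data" and C :: "('a, 'l) schutz_choice"
begin

definition valid_choice :: bool where
  "valid_choice \<longleftrightarrow>
     (\<forall>(u, v) \<in> Urels D.
        path_from_to (alph D) (rels D) (Ppath C u v)
          (pihom D u @ hword D) (pihom D v @ hword D)) \<and>
     (\<forall>y \<in> Wset D.
        hat C y \<in> lists (Bgens D) \<and>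
        word_val (schutz_group (mon D) (hcl D)) (Bval D) (hat C y)
          = inv\<^bsub>schutz_group (mon D) (hcl D)\<^esub>
              (word_val (schutz_group (mon D) (hcl D)) (Bval D) y) \<and>
        path_from_to (Bgens D) (Urels D) (Dpath C y) (y @ hat C y) [] \<and>
        path_from_to (Bgens D) (Urels D) (Dpath' C y) (hat C y @ y) [])"

definition Y1 :: "'a dpath set \<Rightarrow> ('l \<times> 'a) dpath set" where
  "Y1 X =
     {phi_path D
        (the (ract D l (kappa D \<alpha> (the (lact D (path_init P @ \<beta>) j)))))
        P
        (the (lact D \<beta> j)) | P \<alpha> \<beta> j l.
      P \<in> X \<and> \<alpha> \<in> lists (alph D) \<and> \<beta> \<in> lists (alph D) \<and> j \<in> Jset D \<and> l \<in> Lam D \<and>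
      lact D (\<alpha> @ path_init P @ \<beta>) j \<noteq> None \<and>
      under D l (the (lact D (\<alpha> @ path_init P @ \<beta>) j))}"

definition Y2 :: "('l \<times> 'a) dpath set" where
  "Y2 = {path_act [] (path_inv (Dpath C y)) y \<circ>\<^sub>p path_act y (Dpath' C y) [] | y. y \<in> Wset D}"

definition Q_path ::
  "('l \<times> 'a) list \<Rightarrow> ('l \<times> 'a) list \<Rightarrow> bool \<Rightarrow> ('l \<times> 'a) list \<Rightarrow> ('l \<times> 'a) dpath" where
  "Q_path u v \<epsilon> w =
     (let k = the (lact D (psi D w) (et D));
          y = phi D (lone D) (kappa D (hword D) k)
      in path_act [] (phi_path D (lone D) (path_pow (Ppath C u v) \<epsilon>) k) (hat C y))"

definition Y3_path ::
  "('l \<times> 'a) list \<Rightarrow> ('l \<times> 'a) list \<Rightarrow> bool \<Rightarrow> ('l \<times> 'a) list \<Rightarrow> ('l \<times> 'a) dpath" where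
  "Y3_path u v \<epsilon> w =
     (let y = phi D (lone D) (kappa D (hword D) (the (lact D (psi D w) (et D))));
          u0 = rel_side (u, v) \<epsilon>;
          u1 = rel_side (u, v) (\<not> \<epsilon>)
      in path_inv (Lam_path D u0) \<circ>\<^sub>p
         edge_path (elem_edge (u, v) \<epsilon>) \<circ>\<^sub>p
         Lam_path D u1 \<circ>\<^sub>p
         path_act (phi_om D (pihom D u1)) (path_inv (Dpath C y)) [] \<circ>\<^sub>p
         path_inv (Q_path u v \<epsilon> w) \<circ>\<^sub>p
         path_act (phi_om D (pihom D u0)) (Dpath C y) [])"

definition Y3 :: "('l \<times> 'a) dpath set" where
  "Y3 = {Y3_path u v \<epsilon> w | u v \<epsilon> w. (u, v) \<in> Urels D \<and> w \<in> lists (Bgens D)}"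

end

end

theory Submission
  imports Defs
begin

text \<open>
  Write \<open>T(w) = \<phi>(1, \<kappa>(h \<psi>(w), \<eta>))\<close> for \<open>w \<in> B*\<close>. The relations of types (R2), (R3), (R4) give paths
  \<open>\<Theta>\<^sub>w\<close> from \<open>w\<close> to \<open>T(w)\<close> in the derivation graph of \<open>\<langle>B | U\<rangle>\<close>, by recursion on \<open>w\<close>:
  replace the first letter \<open>b\<close> of \<open>b w\<close> by \<open>\<phi>\<^sub>\<omega>(\<pi>(b))\<close>, apply \<open>\<Theta>\<^sub>w\<close>, and finally apply the \<open>\<phi>\<close>-image of a
  path from \<open>\<pi>(b) h \<psi>(w)\<close> to \<open>h \<psi>(b) \<psi>(w)\<close>. If \<open>u\<close> and \<open>v\<close> are equal in the
  Schuetzenberger group, then \<open>h \<psi>(u) = h \<psi>(v)\<close> in the monoid, and the \<open>\<phi>\<close>-image of a path joining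
  these words joins \<open>T(u)\<close> and \<open>T(v)\<close>; so the relations suffice.

  For homotopy, \<open>Y\<^sub>2\<close> and \<open>Y\<^sub>3\<close> are exactly what is needed to show that every path \<open>Z\<close> from \<open>w\<close> to
  \<open>w'\<close> is homotopic to \<open>\<Theta>\<^sub>w\<close>, followed by the \<open>\<phi>\<close>-image of a path from \<open>h \<psi>(w)\<close> to
  \<open>h \<psi>(w')\<close>, followed by the inverse of \<open>\<Theta>\<^sub>w'\<close>. For closed \<open>Z\<close> the path in the middle is the
  image of a closed path, which \<open>X\<close> contracts; the \<open>\<phi>\<close>-images of the cells used are squares and
  translates of \<open>Y\<^sub>1\<close>.
\<close>

section \<open>Paths in derivation graphs\<close>

text \<open>The obstacle: \<phi> turns derivations over A into derivations over B only between words
  of the form \<phi>(l, \<kappa>(x, j)), and an arbitrary word w over B need not have this form;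
  hence the passage through T(w). The index \<eta> is a suitable start because x e = x on H: so h
  \<psi>(w) carries R_\<eta> to R_\<omega>, where H is contained in S r_\<omega> = S h, and every
  index met on the way lies in J, so that (R2) supplies the edges. Words over B act by right
  translations, whereas \<kappa> processes left multiplications; the equation \<pi>(u) h = h
  \<psi>(u) changes sides, and (R3) is its counterpart for one letter. The price is the word
  \<open>hat y\<close>: Y_3 describes a path conjugated by D_y, and Y_2 recovers the path itself
  after multiplication by y.\<close>

declare in_listsI [rule del] in_listsD [rule del]

lemma edge_inv_simps [simp]:
  "edge_init (edge_inv E) = edge_term E" "edge_term (edge_inv E) = edge_init E"
  "edge_inv (edge_inv E) = E"
  by (cases E; simp)+

lemma edge_act_simps [simp]:
  "edge_init (edge_act a E b) = a @ edge_init E @ b"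
  "edge_term (edge_act a E b) = a @ edge_term E @ b"
  "edge_inv (edge_act a E b) = edge_act a (edge_inv E) b"
  "edge_act a (edge_act c E d) b = edge_act (a @ c) E (d @ b)"
  "edge_act [] E [] = E"
  by (cases E; simp)+

lemma elem_edge_simps [simp]:
  "edge_init (elem_edge r e) = rel_side r e" "edge_term (elem_edge r e) = rel_side r (\<not> e)"
  "edge_inv (elem_edge r e) = elem_edge r (\<not> e)"
  by (simp_all add: elem_edge_def)

lemma edge_inv_graph [simp]: "edge_inv E \<in> graph_edges A R \<longleftrightarrow> E \<in> graph_edges A R"
  by (cases E) (simp add: graph_edges_def)

lemma edge_act_graph [simp]:
  "edge_act a E b \<in> graph_edges A R \<longleftrightarrow> a \<in> lists A \<and> b \<in> lists A \<and> E \<in> graph_edges A R"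
  by (cases E) (auto simp: graph_edges_def)

lemma elem_edge_graph [simp]: "elem_edge r e \<in> graph_edges A R \<longleftrightarrow> r \<in> R"
  by (cases r) (simp add: graph_edges_def elem_edge_def)

lemma path_term_simps [simp]:
  "path_term (w, []) = w"
  "path_term (w, E # es) = path_term (edge_term E, es)"
  "path_term (w, xs @ ys) = path_term (path_term (w, xs), ys)"
  by (auto simp: path_term_def)

lemma edge_chain_append [simp]:
  "edge_chain w (xs @ ys) \<longleftrightarrow> edge_chain w xs \<and> edge_chain (path_term (w, xs)) ys"
  by (induction xs arbitrary: w) auto

lemma path_comp_simps [simp]:
  "fst (P \<circ>\<^sub>p Q) = fst P" "snd (P \<circ>\<^sub>p Q) = snd P @ snd Q"
  by (simp_all add: path_comp_def)

lemma path_comp_assoc: "(P \<circ>\<^sub>p Q) \<circ>\<^sub>p T = P \<circ>\<^sub>p Q \<circ>\<^sub>p T"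
  by (simp add: path_comp_def)

lemma path_term_comp [simp]: "path_term P = fst Q \<Longrightarrow> path_term (P \<circ>\<^sub>p Q) = path_term Q"
  by (cases P; cases Q) (simp add: path_comp_def)

lemma path_comp_empty_right [simp]: "P \<circ>\<^sub>p (w, []) = P"
  by (simp add: path_comp_def)

lemma path_comp_empty_left: "fst P = w \<Longrightarrow> (w, []) \<circ>\<^sub>p P = P"
  by (cases P) (simp add: path_comp_def)

lemma edge_path_simps [simp]:
  "fst (edge_path E) = edge_init E" "snd (edge_path E) = [E]"
  "path_term (edge_path E) = edge_term E"
  by (simp_all add: edge_path_def)

lemma path_act_simps [simp]:
  "fst (path_act a P b) = a @ fst P @ b"
  "snd (path_act a P b) = map (\<lambda>E. edge_act a E b) (snd P)"
  "path_term (path_act a P b) = a @ path_term P @ b"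
  by (auto simp: path_act_def path_term_def last_map)

lemma path_act_act [simp]: "path_act a (path_act c P d) b = path_act (a @ c) P (d @ b)"
  by (simp add: path_act_def)

lemma path_act_Nil [simp]: "path_act [] P [] = P"
  by (simp add: path_act_def)

lemma path_act_empty [simp]: "path_act a (w, []) b = (a @ w @ b, [])"
  by (simp add: path_act_def)

lemma path_act_comp: "path_act a (P \<circ>\<^sub>p Q) b = path_act a P b \<circ>\<^sub>p path_act a Q b"
  by (simp add: path_act_def path_comp_def)

lemma path_act_edge: "path_act a (edge_path E) b = edge_path (edge_act a E b)"
  by (simp add: path_act_def edge_path_def)

lemma path_act_inv: "path_act a (path_inv P) b = path_inv (path_act a P b)"
  by (simp add: path_inv_def path_act_def prod_eq_iff rev_map)
     (auto simp: path_term_def last_map)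

lemma path_term_inv_aux:
  "edge_chain w es \<Longrightarrow> path_term (path_term (w, es), rev (map edge_inv es)) = w"
  by (induction es arbitrary: w) auto

lemma edge_chain_inv_aux:
  "edge_chain w es \<Longrightarrow> edge_chain (path_term (w, es)) (rev (map edge_inv es))"
  by (induction es arbitrary: w) (auto simp: path_term_inv_aux)

lemma path_inv_fst [simp]: "fst (path_inv P) = path_term P"
  by (simp add: path_inv_def)

lemma path_inv_term_chain: "edge_chain (fst P) (snd P) \<Longrightarrow> path_term (path_inv P) = fst P"
  by (cases P) (simp add: path_inv_def path_term_inv_aux)

lemma path_inv_comp: "path_term P = fst Q \<Longrightarrow> path_inv (P \<circ>\<^sub>p Q) = path_inv Q \<circ>\<^sub>p path_inv P"
  by (cases P; cases Q) (simp add: path_inv_def path_comp_def)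

lemma is_dpath_empty [simp]: "is_dpath A R (w, []) \<longleftrightarrow> w \<in> lists A"
  by (simp add: is_dpath_def)

lemma is_dpath_act [intro]:
  "is_dpath A R P \<Longrightarrow> a \<in> lists A \<Longrightarrow> b \<in> lists A \<Longrightarrow> is_dpath A R (path_act a P b)"
proof -
  have "edge_chain w es \<Longrightarrow> edge_chain (a @ w @ b) (map (\<lambda>E. edge_act a E b) es)" for w es
    by (induction es arbitrary: w) auto
  then show "is_dpath A R P \<Longrightarrow> a \<in> lists A \<Longrightarrow> b \<in> lists A \<Longrightarrow> is_dpath A R (path_act a P b)"
    by (auto simp: is_dpath_def)
qed

lemma path_from_to_act:
  "path_from_to A R P u v \<Longrightarrow> a \<in> lists A \<Longrightarrow> b \<in> lists A \<Longrightarrow>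
    path_from_to A R (path_act a P b) (a @ u @ b) (a @ v @ b)"
  by (auto simp: path_from_to_def)

locale word_relations =
  fixes A :: "'a set" and R :: "('a list \<times> 'a list) set"
  assumes R_words: "R \<subseteq> lists A \<times> lists A"
begin

lemma rel_side_words: "r \<in> R \<Longrightarrow> rel_side r e \<in> lists A"
  using R_words by (auto simp: rel_side_def)

lemma edge_words:
  "E \<in> graph_edges A R \<Longrightarrow> edge_init E \<in> lists A"
  "E \<in> graph_edges A R \<Longrightarrow> edge_term E \<in> lists A"
  using rel_side_words by (auto simp: graph_edges_def)

lemma is_dpath_edge [simp]: "is_dpath A R (edge_path E) \<longleftrightarrow> E \<in> graph_edges A R"
  using edge_words by (auto simp: is_dpath_def edge_path_def)

lemma is_dpath_Cons [simp]:
  "is_dpath A R (w, E # es) \<longleftrightarrow>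
    w = edge_init E \<and> E \<in> graph_edges A R \<and> is_dpath A R (edge_term E, es)"
  using edge_words by (auto simp: is_dpath_def)

lemma is_dpath_append [simp]:
  "is_dpath A R (w, xs @ ys) \<longleftrightarrow> is_dpath A R (w, xs) \<and> is_dpath A R (path_term (w, xs), ys)"
proof (induction xs arbitrary: w)
  case Nil
  then show ?case by (auto simp: is_dpath_def)
next
  case (Cons E xs)
  then show ?case by simp
qed

lemma is_dpath_term: "is_dpath A R P \<Longrightarrow> path_term P \<in> lists A"
proof -
  have "is_dpath A R (w, es) \<Longrightarrow> path_term (w, es) \<in> lists A" for w es
    by (induction es arbitrary: w) auto
  from this[of "fst P" "snd P"] show "is_dpath A R P \<Longrightarrow> path_term P \<in> lists A"
    by simp
qed

lemma is_dpath_init: "is_dpath A R P \<Longrightarrow> fst P \<in> lists A"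
  by (simp add: is_dpath_def)

lemma is_dpath_comp [intro]:
  "is_dpath A R P \<Longrightarrow> is_dpath A R Q \<Longrightarrow> path_term P = fst Q \<Longrightarrow> is_dpath A R (P \<circ>\<^sub>p Q)"
  by (cases P; cases Q) (simp add: path_comp_def)

lemma path_inv_term [simp]: "is_dpath A R P \<Longrightarrow> path_term (path_inv P) = fst P"
  by (simp add: path_inv_term_chain is_dpath_def)

lemma path_inv_inv [simp]: "is_dpath A R P \<Longrightarrow> path_inv (path_inv P) = P"
  using path_inv_term[of P]
  by (cases P) (simp add: path_inv_def rev_map o_def)

lemma is_dpath_inv [intro]: "is_dpath A R P \<Longrightarrow> is_dpath A R (path_inv P)"
proof -
  assume P: "is_dpath A R P"
  then have "edge_chain (path_term P) (rev (map edge_inv (snd P)))"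
    using edge_chain_inv_aux[of "fst P" "snd P"] by (simp add: is_dpath_def)
  moreover have "edge_inv ` set (snd P) \<subseteq> graph_edges A R"
    using P by (auto simp: is_dpath_def)
  ultimately show ?thesis
    using is_dpath_term[OF P] by (simp add: is_dpath_def path_inv_def)
qed

lemma path_from_to_comp:
  "path_from_to A R P u v \<Longrightarrow> path_from_to A R Q v w \<Longrightarrow> path_from_to A R (P \<circ>\<^sub>p Q) u w"
  by (auto simp: path_from_to_def)

lemma path_from_to_inv: "path_from_to A R P u v \<Longrightarrow> path_from_to A R (path_inv P) v u"
  by (auto simp: path_from_to_def)

lemma path_from_to_edge:
  "E \<in> graph_edges A R \<Longrightarrow> path_from_to A R (edge_path E) (edge_init E) (edge_term E)"
  by (simp add: path_from_to_def)

lemma path_from_to_words: "path_from_to A R P u v \<Longrightarrow> u \<in> lists A \<and> v \<in> lists A"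
  by (auto simp: path_from_to_def is_dpath_term is_dpath_init)

lemma pres_cong_words: "(u, v) \<in> pres_cong A R \<Longrightarrow> u \<in> lists A \<and> v \<in> lists A"
proof (induction rule: pres_cong.induct)
  case (base u v)
  then show ?case using R_words by blast
qed auto

lemma edge_pres_cong: "E \<in> graph_edges A R \<Longrightarrow> (edge_init E, edge_term E) \<in> pres_cong A R"
proof (cases E)
  case (Edge a r e b)
  assume "E \<in> graph_edges A R"
  with Edge have *: "a \<in> lists A" "b \<in> lists A" "r \<in> R"
    by (auto simp: graph_edges_def)
  then have "(rel_side r e, rel_side r (\<not> e)) \<in> pres_cong A R"
    by (cases r) (auto simp: rel_side_def intro: pres_cong.base pres_cong.sym)
  with * Edge show ?thesis
    by (auto intro!: pres_cong.mult intro: pres_cong.refl)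
qed

text \<open>Edges are single applications of a relation inside a word. The one rule of the
  congruence that is neither concatenation nor reversal of paths is \<open>mult\<close>: there the
  left factor is rewritten in front of x, then the right factor behind v.\<close>

lemma pres_cong_iff_path: "(u, v) \<in> pres_cong A R \<longleftrightarrow> (\<exists>P. path_from_to A R P u v)"
proof
  show "(u, v) \<in> pres_cong A R \<Longrightarrow> \<exists>P. path_from_to A R P u v"
  proof (induction rule: pres_cong.induct)
    case (base u v)
    then have "path_from_to A R (edge_path (elem_edge (u, v) True)) u v"
      by (auto simp: path_from_to_def rel_side_def)
    then show ?case ..
  next
    case (refl w)
    then have "path_from_to A R (w, []) w w"
      by (simp add: path_from_to_def)
    then show ?case ..
  next
    case (sym u v)
    then show ?case
      using path_from_to_inv by blast
  next
    case (trans u v w)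
    then show ?case
      using path_from_to_comp by blast
  next
    case (mult u v x y)
    then obtain P Q where PQ: "path_from_to A R P u v" "path_from_to A R Q x y"
      by blast
    have w: "v \<in> lists A" "x \<in> lists A"
      using mult.hyps pres_cong_words by blast+
    have "path_from_to A R (path_act [] P x \<circ>\<^sub>p path_act v Q []) (u @ x) (v @ y)"
      using path_from_to_comp path_from_to_act[OF PQ(1), of "[]" x]
        path_from_to_act[OF PQ(2), of v "[]"] w
      by fastforce
    then show ?case ..
  qed
next
  have "is_dpath A R (u, es) \<Longrightarrow> (u, path_term (u, es)) \<in> pres_cong A R" for es
  proof (induction es arbitrary: u)
    case Nil
    then show ?case
      by (auto intro: pres_cong.refl)
  next
    case (Cons E es)
    then show ?case
      using edge_pres_cong pres_cong.trans by fastforce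
  qed
  from this[of "snd _"] show "\<exists>P. path_from_to A R P u v \<Longrightarrow> (u, v) \<in> pres_cong A R"
    by (auto simp: path_from_to_def)
qed

end

section \<open>Homotopy\<close>

text \<open>Predicate form of the inductive set, which can be written infix and chained with
  equations by \<open>also\<close>.\<close>

definition homotopic ::
  "'a set \<Rightarrow> ('a list \<times> 'a list) set \<Rightarrow> 'a dpath set \<Rightarrow> 'a dpath \<Rightarrow> 'a dpath \<Rightarrow> bool" where
  "homotopic A R C P Q \<longleftrightarrow> (P, Q) \<in> homotopy A R C"

lemma homotopic_trans [trans]:
  "homotopic A R C P Q \<Longrightarrow> homotopic A R C Q T \<Longrightarrow> homotopic A R C P T"
  unfolding homotopic_def by (rule homotopy.trans)

lemma eq_homotopic_trans [trans]:
  "P = Q \<Longrightarrow> homotopic A R C Q T \<Longrightarrow> homotopic A R C P T"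
  "homotopic A R C P Q \<Longrightarrow> Q = T \<Longrightarrow> homotopic A R C P T"
  by simp_all

text \<open>\<open>C\<close> stands for all defining paths at once, squares and translates included;
  the calculus below needs only that they are closed.\<close>

locale squier_complex = word_relations +
  fixes C :: "'a dpath set"
  assumes C_closed: "K \<in> C \<Longrightarrow> closed_path A R K"
begin

abbreviation hom (infix "\<approx>" 50) where
  "P \<approx> Q \<equiv> homotopic A R C P Q"

lemma hom_same:
  "P \<approx> Q \<Longrightarrow> is_dpath A R P \<and> is_dpath A R Q \<and> fst P = fst Q \<and> path_term P = path_term Q"
  unfolding homotopic_def
proof (induction rule: homotopy.induct)
  case (replace w xs ps ys qs z K)
  then show ?case by (metis fst_conv path_term_simps(3))
qed auto

lemma hom_ends: "P \<approx> Q \<Longrightarrow> fst P = fst Q" "P \<approx> Q \<Longrightarrow> path_term P = path_term Q"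
  using hom_same by blast+

lemmas hom_refl = homotopy.refl[of A R _ C, folded homotopic_def]
lemmas hom_sym = homotopy.sym[of _ _ A R C, folded homotopic_def]
lemmas hom_trans = homotopic_trans[of A R C]
lemmas hom_cancel = homotopy.cancel[of A R _ _ _ _ C, folded homotopic_def]
lemmas hom_replace = homotopy.replace[of A R _ _ _ _ _ _ _ C, folded homotopic_def]
lemmas hom_induct [consumes 1, case_names refl sym trans cancel replace] =
  homotopy.induct[of _ _ A R C, folded homotopic_def]

text \<open>Both generating moves carry a context of their own, which absorbs the additional edges
  \<open>xs\<close> and \<open>ys\<close>.\<close>

lemma hom_context:
  assumes "P \<approx> Q" "is_dpath A R (w, xs @ snd P @ ys)" "path_term (w, xs) = fst P"
  shows "(w, xs @ snd P @ ys) \<approx> (w, xs @ snd Q @ ys)"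
  using assms
proof (induction rule: hom_induct)
  case (refl P)
  then show ?case by (simp add: hom_refl)
next
  case (sym P Q)
  then have "is_dpath A R (w, xs @ snd P @ ys)" "path_term (w, xs) = fst P"
    using hom_same[OF sym.hyps] by (auto simp: is_dpath_append[of w xs])
      (metis prod.collapse)+
  then show ?case using sym.IH by (blast intro: hom_sym)
next
  case (trans P Q T)
  then have "is_dpath A R (w, xs @ snd Q @ ys)" "path_term (w, xs) = fst Q"
    using hom_same[OF trans.hyps(1)] by (auto simp: is_dpath_append[of w xs])
      (metis prod.collapse)+
  then show ?case using trans by (blast intro: hom_trans)
next
  case (cancel v as E bs)
  then show ?case using hom_cancel[of w "xs @ as" E "bs @ ys"] by simp
next
  case (replace v as ps bs qs z K)
  have "is_dpath A R (w, (xs @ as) @ qs @ (bs @ ys))"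
    using replace by auto
  then show ?case using hom_replace[of w "xs @ as" ps "bs @ ys" qs z K] replace
    by simp
qed

lemma hom_comp:
  assumes "P \<approx> P'" "Q \<approx> Q'" "path_term P = fst Q"
  shows "P \<circ>\<^sub>p Q \<approx> P' \<circ>\<^sub>p Q'"
proof -
  have "P \<circ>\<^sub>p Q \<approx> P' \<circ>\<^sub>p Q"
    using hom_context[OF assms(1), of "fst P" "[]" "snd Q"] hom_same[OF assms(1)]
      hom_same[OF assms(2)] assms(3)
    by (cases P; cases P'; cases Q) (simp add: path_comp_def)
  moreover have "P' \<circ>\<^sub>p Q \<approx> P' \<circ>\<^sub>p Q'"
    using hom_context[OF assms(2), of "fst P'" "snd P'" "[]"] hom_same[OF assms(1)]
      hom_same[OF assms(2)] assms(3)
    by (cases P'; cases Q; cases Q') (simp add: path_comp_def)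
  ultimately show ?thesis by (rule hom_trans)
qed

lemma hom_comp_left:
  "Q \<approx> Q' \<Longrightarrow> is_dpath A R P \<Longrightarrow> path_term P = fst Q \<Longrightarrow> P \<circ>\<^sub>p Q \<approx> P \<circ>\<^sub>p Q'"
  by (blast intro: hom_comp hom_refl)

lemma hom_comp_right:
  "P \<approx> P' \<Longrightarrow> is_dpath A R Q \<Longrightarrow> path_term P = fst Q \<Longrightarrow> P \<circ>\<^sub>p Q \<approx> P' \<circ>\<^sub>p Q"
  by (blast intro: hom_comp hom_refl)

lemma hom_inv_right: "is_dpath A R P \<Longrightarrow> P \<circ>\<^sub>p path_inv P \<approx> (fst P, [])"
proof -
  have "is_dpath A R (w, es) \<Longrightarrow> (w, es @ rev (map edge_inv es)) \<approx> (w, [])" for w es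
  proof (induction es rule: rev_induct)
    case Nil
    then show ?case by (simp add: hom_refl)
  next
    case (snoc E es)
    have "is_dpath A R ((w, es @ [E]) \<circ>\<^sub>p path_inv (w, es @ [E]))"
      using snoc.prems by (intro is_dpath_comp is_dpath_inv) auto
    then have "is_dpath A R (w, es @ [E, edge_inv E] @ rev (map edge_inv es))"
      by (simp only: path_comp_def path_inv_def) simp
    from hom_cancel[OF this] show ?case
      using snoc hom_trans by fastforce
  qed
  from this[of "fst P" "snd P"]
  show "is_dpath A R P \<Longrightarrow> P \<circ>\<^sub>p path_inv P \<approx> (fst P, [])"
    by (simp add: path_comp_def path_inv_def)
qed

lemma hom_inv_left: "is_dpath A R P \<Longrightarrow> path_inv P \<circ>\<^sub>p P \<approx> (path_term P, [])"
  using hom_inv_right[of "path_inv P"] by auto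

lemma hom_move_left:
  assumes "P \<circ>\<^sub>p Q \<approx> T" "is_dpath A R P" "is_dpath A R Q" "path_term P = fst Q"
  shows "Q \<approx> path_inv P \<circ>\<^sub>p T"
proof -
  have "(fst Q, []) \<circ>\<^sub>p Q \<approx> (path_inv P \<circ>\<^sub>p P) \<circ>\<^sub>p Q"
    using hom_inv_left[OF assms(2)] assms by (intro hom_comp_right) (auto intro: hom_sym)
  also have "\<dots> \<approx> path_inv P \<circ>\<^sub>p T"
    unfolding path_comp_assoc using assms by (intro hom_comp_left) auto
  finally show ?thesis by (simp add: path_comp_empty_left)
qed

lemma hom_move_right:
  assumes "P \<circ>\<^sub>p Q \<approx> T" "is_dpath A R P" "is_dpath A R Q" "path_term P = fst Q"
  shows "P \<approx> T \<circ>\<^sub>p path_inv Q"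
proof -
  have "P \<circ>\<^sub>p (path_term P, []) \<approx> P \<circ>\<^sub>p (Q \<circ>\<^sub>p path_inv Q)"
    using hom_inv_right[OF assms(3)] assms by (intro hom_comp_left) (auto intro: hom_sym)
  also have "\<dots> = (P \<circ>\<^sub>p Q) \<circ>\<^sub>p path_inv Q"
    by (simp add: path_comp_assoc)
  also have "\<dots> \<approx> T \<circ>\<^sub>p path_inv Q"
    using assms by (intro hom_comp_right) auto
  finally show ?thesis by simp
qed

lemma hom_inv:
  assumes "P \<approx> Q"
  shows "path_inv P \<approx> path_inv Q"
proof -
  note s = hom_same[OF assms]
  have "path_inv P \<circ>\<^sub>p Q \<approx> path_inv P \<circ>\<^sub>p P"
    using s assms by (intro hom_comp_left) (auto intro: hom_sym)
  also have "\<dots> \<approx> (path_term P, [])"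
    using s hom_inv_left by blast
  finally have "path_inv P \<approx> (path_term P, []) \<circ>\<^sub>p path_inv Q"
    using s by (intro hom_move_right) auto
  then show ?thesis using s by (simp add: path_comp_empty_left)
qed

text \<open>\<open>K\<close> is a cyclic permutation of itself, so the whole of it may be replaced
  by the empty path.\<close>

lemma C_null: "K \<in> C \<Longrightarrow> K \<approx> (fst K, [])"
proof -
  assume K: "K \<in> C"
  then have *: "is_dpath A R K" "path_term K = fst K"
    using C_closed by (auto simp: closed_path_def)
  have "K \<in> cyclic_perms K"
    unfolding cyclic_perms_def by (rule CollectI, rule exI[of _ "[]"], rule exI[of _ "snd K"]) simp
  then show ?thesis
    using hom_replace[of "fst K" "[]" "snd K" "[]" "[]" "fst K" K] K *
    by (simp add: path_inv_def is_dpath_def)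
qed

text \<open>If the loop \<open>xs\<close>, \<open>ys\<close> contracts, then \<open>ys\<close> is
  homotopic to the inverse of \<open>xs\<close>, and the rotated loop contracts as well. Together
  with \<open>hom_inv\<close> this disposes of the cyclic permutations and inverses in the rule
  \<open>replace\<close>.\<close>

lemma null_cyclic:
  assumes "(z, xs @ ys) \<approx> (z, [])"
  shows "(path_term (z, xs), ys @ xs) \<approx> (path_term (z, xs), [])"
proof -
  have d: "is_dpath A R (z, xs)" "is_dpath A R (path_term (z, xs), ys)"
    "path_term (path_term (z, xs), ys) = z"
    using hom_same[OF assms] by auto
  have "(path_term (z, xs), ys) \<approx> path_inv (z, xs) \<circ>\<^sub>p (z, [])"
    using d assms by (intro hom_move_left) (auto simp: path_comp_def)
  then have "(path_term (z, xs), ys) \<circ>\<^sub>p (z, xs) \<approx> path_inv (z, xs) \<circ>\<^sub>p (z, xs)"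
    using d by (intro hom_comp_right) auto
  also have "\<dots> \<approx> (path_term (z, xs), [])"
    using d by (intro hom_inv_left)
  finally show ?thesis by (simp add: path_comp_def)
qed

end

section \<open>Partial maps between derivation graphs and their effect on homotopy\<close>

locale derivation_graph_map =
  src: word_relations A R + tgt: word_relations B U
  for A :: "'a set" and R and B :: "'b set" and U +
  fixes Adm :: "'a list \<Rightarrow> bool" and fv :: "'a list \<Rightarrow> 'b list" and fe :: "'a edge \<Rightarrow> 'b edge"
  assumes fv_words: "w \<in> lists A \<Longrightarrow> Adm w \<Longrightarrow> fv w \<in> lists B"
    and fe: "\<And>E. E \<in> graph_edges A R \<Longrightarrow> Adm (edge_init E) \<Longrightarrow>
      Adm (edge_term E) \<and> fe E \<in> graph_edges B U \<and> edge_init (fe E) = fv (edge_init E) \<and>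
      edge_term (fe E) = fv (edge_term E) \<and> fe (edge_inv E) = edge_inv (fe E)"
begin

definition fp :: "'a dpath \<Rightarrow> 'b dpath" where
  "fp P = (fv (fst P), map fe (snd P))"

text \<open>\<open>Adm\<close> makes the map partial, as \<phi>(l, \<kappa>(w, j)) is only
  meaningful for some w. Edges pass admissibility from one end to the other, so it has to be known
  at the first vertex only.\<close>

lemma fp_path:
  "is_dpath A R P \<Longrightarrow> Adm (fst P) \<Longrightarrow>
    is_dpath B U (fp P) \<and> path_term (fp P) = fv (path_term P) \<and> Adm (path_term P)"
proof -
  have "is_dpath A R (w, es) \<Longrightarrow> Adm w \<Longrightarrow>
    is_dpath B U (fv w, map fe es) \<and> path_term (fv w, map fe es) = fv (path_term (w, es)) \<and>
    Adm (path_term (w, es))" for w es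
    by (induction es arbitrary: w) (auto simp: fv_words fe)
  from this[of "fst P" "snd P"] show "is_dpath A R P \<Longrightarrow> Adm (fst P) \<Longrightarrow>
    is_dpath B U (fp P) \<and> path_term (fp P) = fv (path_term P) \<and> Adm (path_term P)"
    by (simp add: fp_def)
qed

lemma fp_comp: "path_term P = fst Q \<Longrightarrow> fp (P \<circ>\<^sub>p Q) = fp P \<circ>\<^sub>p fp Q"
  by (simp add: fp_def path_comp_def)

lemma fp_inv:
  assumes "is_dpath A R P" "Adm (fst P)"
  shows "fp (path_inv P) = path_inv (fp P)"
proof -
  have "is_dpath A R (w, es) \<Longrightarrow> Adm w \<Longrightarrow> map fe (map edge_inv es) = map edge_inv (map fe es)"
    for w es
    by (induction es arbitrary: w) (auto simp: fe)
  from this[of "fst P" "snd P"] show ?thesis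
    using assms fp_path[OF assms] by (simp add: fp_def path_inv_def rev_map)
qed

end

locale squier_complex_map = derivation_graph_map A R B U Adm fv fe +
  src: squier_complex A R C + tgt: squier_complex B U C'
  for A :: "'a set" and R C and B :: "'b set" and U C' Adm fv fe +
  assumes null: "\<And>K. K \<in> C \<Longrightarrow> closed_path A R K \<Longrightarrow> Adm (fst K) \<Longrightarrow>
      tgt.hom (fv (fst K), map fe (snd K)) (fv (fst K), [])"
begin

lemma fp_cyclic:
  assumes "tgt.hom (fp K) (fv (fst K), [])" "is_dpath A R K" "Adm (fst K)" "T \<in> cyclic_perms K"
  shows "tgt.hom (fp T) (fv (fst T), [])"
proof -
  from assms(4) obtain xs ys where T: "T = (path_term (fst K, xs), ys @ xs)" "snd K = xs @ ys"
    by (auto simp: cyclic_perms_def)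
  then have "is_dpath A R (fst K, xs)"
    using assms(2) by (metis prod.collapse src.is_dpath_append)
  then have "path_term (fv (fst K), map fe xs) = fv (path_term (fst K, xs))"
    using fp_path[of "(fst K, xs)"] assms(3) by (simp add: fp_def)
  then show ?thesis
    using tgt.null_cyclic[of "fv (fst K)" "map fe xs" "map fe ys"] assms(1)
    by (simp add: fp_def T)
qed

text \<open>In the case \<open>replace\<close>, the loop made of \<open>ps\<close> and the inverse
  of \<open>qs\<close> is a rotation of a cell or of its inverse, so its image contracts. Hence
  \<open>ps\<close> and \<open>qs\<close> have homotopic images, which \<open>hom_context\<close>
  puts back into the surrounding path.\<close>

lemma fp_hom: "src.hom P Q \<Longrightarrow> Adm (fst P) \<Longrightarrow> tgt.hom (fp P) (fp Q)"
proof (induction rule: src.hom_induct)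
  case (refl P)
  then show ?case using fp_path by (blast intro: tgt.hom_refl)
next
  case (sym P Q)
  then show ?case using src.hom_ends by (metis tgt.hom_sym)
next
  case (trans P Q T)
  then show ?case using src.hom_ends by (metis tgt.hom_trans)
next
  case (cancel w xs E ys)
  then have "fe (edge_inv E) = edge_inv (fe E)"
    using fp_path[of "(w, xs)"] by (auto simp: fe)
  then show ?case
    using cancel fp_path[of "(w, xs @ [E, edge_inv E] @ ys)"]
      tgt.hom_cancel[of "fv w" "map fe xs" "fe E" "map fe ys"]
    by (simp add: fp_def)
next
  case (replace w xs ps ys qs z K)
  have dps: "is_dpath A R (z, ps)" and dqs: "is_dpath A R (z, qs)" and
    adm: "Adm z" and dxs: "is_dpath A R (w, xs)"
    using replace fp_path[of "(w, xs)"] by auto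
  have K: "closed_path A R K"
    using src.C_closed replace by blast
  have dT: "is_dpath A R ((z, ps) \<circ>\<^sub>p path_inv (z, qs))"
    using dps dqs replace.hyps by auto
  have nul: "tgt.hom (fp ((z, ps) \<circ>\<^sub>p path_inv (z, qs)))
      (fv (fst ((z, ps) \<circ>\<^sub>p path_inv (z, qs))), [])"
  proof -
    \<comment> \<open>Admissibility is known at z, where the rotated loop starts, but
      \<open>null\<close> asks for it where the cell starts; it is carried there along the remainder
      \<open>ys\<close> of the loop.\<close>
    have admK: "Adm (fst K')" if "(z, ps) \<circ>\<^sub>p path_inv (z, qs) \<in> cyclic_perms K'"
      "closed_path A R K'" for K'
    proof -
      from that(1) obtain xs ys where T: "z = path_term (fst K', xs)" "snd K' = xs @ ys"
        by (auto simp: cyclic_perms_def path_comp_def)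
      have "is_dpath A R (fst K', xs @ ys)" "path_term (fst K', xs @ ys) = fst K'"
        using that(2) T(2) by (metis closed_path_def prod.collapse)+
      with T(1) have "is_dpath A R (z, ys)" "path_term (z, ys) = fst K'"
        by auto
      with fp_path[of "(z, ys)"] adm show ?thesis
        by simp
    qed
    from replace.hyps(6) show ?thesis
    proof
      assume *: "(z, ps) \<circ>\<^sub>p path_inv (z, qs) \<in> cyclic_perms K"
      show ?thesis
        using null[OF replace.hyps(5) K admK[OF * K]] admK[OF * K] K
        by (intro fp_cyclic[OF _ _ _ *]) (auto simp: fp_def closed_path_def)
    next
      assume *: "(z, ps) \<circ>\<^sub>p path_inv (z, qs) \<in> cyclic_perms (path_inv K)"
      have K': "closed_path A R (path_inv K)" "fst (path_inv K) = fst K"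
        using K src.is_dpath_inv by (auto simp: closed_path_def)
      have a: "Adm (fst K)"
        using admK[OF * K'(1)] K' by simp
      have "tgt.hom (path_inv (fp K)) (path_inv (fv (fst K), []))"
        using null[OF replace.hyps(5) K a] by (auto intro: tgt.hom_inv simp: fp_def)
      then have "tgt.hom (fp (path_inv K)) (fv (fst K), [])"
        using fp_inv[of K] a K by (simp add: closed_path_def) (simp add: path_inv_def)
      then show ?thesis
        using K' a by (intro fp_cyclic[OF _ _ _ *]) (auto simp: closed_path_def)
    qed
  qed
  have "fp ((z, ps) \<circ>\<^sub>p path_inv (z, qs)) = fp (z, ps) \<circ>\<^sub>p path_inv (fp (z, qs))"
    using fp_comp[of "(z, ps)" "path_inv (z, qs)"] fp_inv[of "(z, qs)"] dqs adm replace.hyps(4)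
    by simp
  with nul have "tgt.hom (fp (z, ps) \<circ>\<^sub>p path_inv (fp (z, qs))) (fv z, [])"
    by simp
  then have "tgt.hom (fp (z, ps)) ((fv z, []) \<circ>\<^sub>p path_inv (path_inv (fp (z, qs))))"
    using fp_path[OF dps] fp_path[OF dqs] adm replace.hyps(4)
    by (intro tgt.hom_move_right) auto
  then have h: "tgt.hom (fp (z, ps)) (fp (z, qs))"
    using fp_path[OF dqs] adm by (simp add: path_comp_empty_left fp_def)
  have "is_dpath B U (fv w, map fe xs @ snd (fp (z, ps)) @ map fe ys)"
    using fp_path[OF replace.hyps(1)] replace.prems by (simp add: fp_def)
  from tgt.hom_context[OF h this] show ?case
    using fp_path[OF dxs] replace by (simp add: fp_def)
qed

end

text \<open>The complex in which a homotopy base has to kill all closed paths.\<close>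

definition base_cells :: "'a set \<Rightarrow> ('a list \<times> 'a list) set \<Rightarrow> 'a dpath set \<Rightarrow> 'a dpath set" where
  "base_cells A R X = squier_paths A R \<union>
     {path_act \<alpha> P \<beta> | \<alpha> P \<beta>. \<alpha> \<in> lists A \<and> \<beta> \<in> lists A \<and> P \<in> X}"

text \<open>In a square the first edge always stands to the left of the second, so it absorbs the
  prefix while the second edge absorbs the suffix.\<close>

lemma squier_path_act:
  "path_act a (squier_path E F) b = squier_path (edge_act a E []) (edge_act [] F b)"
  by (cases E; cases F) (simp add: squier_path_def path_act_def path_comp_def edge_path_def)

lemma (in word_relations) squier_path_closed:
  "E \<in> graph_edges A R \<Longrightarrow> F \<in> graph_edges A R \<Longrightarrow> closed_path A R (squier_path E F)"
  using edge_words[of E] edge_words[of F]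
  by (simp add: closed_path_def squier_path_def path_comp_def)

lemma path_act_closed:
  "closed_path A R P \<Longrightarrow> a \<in> lists A \<Longrightarrow> b \<in> lists A \<Longrightarrow> closed_path A R (path_act a P b)"
  using is_dpath_act[of A R P a b] by (simp add: closed_path_def)

section \<open>The complex of a homotopy base: translation and interchange of independent
  paths\<close>

locale homotopy_complex = word_relations +
  fixes X :: "'a dpath set"
  assumes X_closed: "K \<in> X \<Longrightarrow> closed_path A R K"
begin

sublocale squier_complex A R "base_cells A R X"
proof
  fix K assume "K \<in> base_cells A R X"
  then show "closed_path A R K"
    unfolding base_cells_def squier_paths_def
    using squier_path_closed path_act_closed X_closed by blast
qed

abbreviation base_hom (infix "\<approx>" 50) where
  "P \<approx> Q \<equiv> homotopic A R (base_cells A R X) P Q"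

lemma X_null: "K \<in> X \<Longrightarrow> a \<in> lists A \<Longrightarrow> b \<in> lists A \<Longrightarrow>
    path_act a K b \<approx> (a @ fst K @ b, [])"
  using C_null[of "path_act a K b"] unfolding base_cells_def path_act_simps by blast

lemma base_cells_act:
  assumes "K \<in> base_cells A R X" "a \<in> lists A" "b \<in> lists A"
  shows "path_act a K b \<in> base_cells A R X"
  using assms(1) unfolding base_cells_def
proof
  assume "K \<in> squier_paths A R"
  then obtain E F where "K = squier_path E F" "E \<in> graph_edges A R" "F \<in> graph_edges A R"
    by (auto simp: squier_paths_def)
  then have "path_act a K b \<in> squier_paths A R"
    unfolding squier_paths_def using assms(2,3) squier_path_act[of a E F b]
    by (intro CollectI exI[of _ "edge_act a E []"] exI[of _ "edge_act [] F b"]) auto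
  then show "path_act a K b \<in> squier_paths A R \<union>
     {path_act \<alpha> P \<beta> | \<alpha> P \<beta>. \<alpha> \<in> lists A \<and> \<beta> \<in> lists A \<and> P \<in> X}" by (rule UnI1)
next
  assume "K \<in> {path_act \<alpha> P \<beta> | \<alpha> P \<beta>. \<alpha> \<in> lists A \<and> \<beta> \<in> lists A \<and> P \<in> X}"
  then obtain c P d where "K = path_act c P d" "c \<in> lists A" "d \<in> lists A" "P \<in> X"
    by blast
  then have "path_act a K b = path_act (a @ c) P (d @ b)" "a @ c \<in> lists A" "d @ b \<in> lists A"
    using assms by auto
  with \<open>P \<in> X\<close> show "path_act a K b \<in> squier_paths A R \<union>
     {path_act \<alpha> P \<beta> | \<alpha> P \<beta>. \<alpha> \<in> lists A \<and> \<beta> \<in> lists A \<and> P \<in> X}"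
    by blast
qed

text \<open>Translation is a map of complexes, defined everywhere, and it sends cells to
  cells.\<close>

lemma hom_act:
  assumes "P \<approx> Q" "a \<in> lists A" "b \<in> lists A"
  shows "path_act a P b \<approx> path_act a Q b"
proof -
  interpret act: squier_complex_map A R "base_cells A R X" A R "base_cells A R X" "\<lambda>_. True"
    "\<lambda>w. a @ w @ b" "\<lambda>E. edge_act a E b"
  proof
    fix K assume "K \<in> base_cells A R X"
    then have "path_act a K b \<approx> (fst (path_act a K b), [])"
      using assms by (intro C_null base_cells_act)
    then show "(a @ fst K @ b, map (\<lambda>E. edge_act a E b) (snd K)) \<approx> (a @ fst K @ b, [])"
      by (simp add: path_act_def)
  qed (use assms in auto)
  show ?thesis
    using act.fp_hom[OF assms(1)] by (simp add: act.fp_def path_act_def)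
qed

text \<open>A square consists of the two ways from one corner to the opposite one, the second way
  traversed backwards.\<close>

lemma interchange_edges:
  assumes "E \<in> graph_edges A R" "F \<in> graph_edges A R"
  shows "edge_path (edge_act [] E (edge_init F)) \<circ>\<^sub>p edge_path (edge_act (edge_term E) F [])
    \<approx> edge_path (edge_act (edge_init E) F []) \<circ>\<^sub>p edge_path (edge_act [] E (edge_term F))"
    (is "?P \<approx> ?Q")
proof -
  have w: "edge_init E \<in> lists A" "edge_term E \<in> lists A" "edge_init F \<in> lists A"
    "edge_term F \<in> lists A"
    using assms edge_words by auto
  have "squier_path E F \<in> base_cells A R X"
    using assms by (auto simp: base_cells_def squier_paths_def)
  moreover have "squier_path E F = ?P \<circ>\<^sub>p path_inv ?Q"
    by (simp add: squier_path_def path_act_def path_comp_def edge_path_def path_inv_def)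
  ultimately have "?P \<circ>\<^sub>p path_inv ?Q \<approx> (fst ?P, [])"
    using C_null[of "squier_path E F"] by simp
  moreover have d: "is_dpath A R ?P" "is_dpath A R ?Q"
    using assms w by auto
  ultimately have "?P \<approx> (fst ?P, []) \<circ>\<^sub>p path_inv (path_inv ?Q)"
    using w by (intro hom_move_right) auto
  then show ?thesis
    using d by (simp add: path_comp_empty_left)
qed

lemma interchange_edge_path:
  assumes "E \<in> graph_edges A R" "is_dpath A R Q"
  shows "path_act [] (edge_path E) (fst Q) \<circ>\<^sub>p path_act (edge_term E) Q []
    \<approx> path_act (edge_init E) Q [] \<circ>\<^sub>p path_act [] (edge_path E) (path_term Q)"
proof -
  have w: "edge_init E \<in> lists A" "edge_term E \<in> lists A"
    using assms edge_words by auto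
  have "is_dpath A R (w, es) \<Longrightarrow>
    path_act [] (edge_path E) w \<circ>\<^sub>p path_act (edge_term E) (w, es) []
    \<approx> path_act (edge_init E) (w, es) [] \<circ>\<^sub>p path_act [] (edge_path E) (path_term (w, es))" for w es
  proof (induction es arbitrary: w)
    case Nil
    then show ?case
      using w assms by (simp add: path_act_edge path_comp_empty_left hom_refl)
  next
    case (Cons F es)
    let ?e = "edge_term F"
    have F: "F \<in> graph_edges A R" "w = edge_init F" "is_dpath A R (?e, es)"
      using Cons.prems by auto
    then have wF: "edge_init F \<in> lists A" "?e \<in> lists A" "path_term (?e, es) \<in> lists A"
      using edge_words is_dpath_term by auto
    have split: "path_act c (w, F # es) [] = edge_path (edge_act c F []) \<circ>\<^sub>p path_act c (?e, es) []"
      for c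
      by (simp add: path_act_def path_comp_def edge_path_def F)
    have "path_act [] (edge_path E) w \<circ>\<^sub>p path_act (edge_term E) (w, F # es) []
      = (edge_path (edge_act [] E (edge_init F)) \<circ>\<^sub>p edge_path (edge_act (edge_term E) F []))
        \<circ>\<^sub>p path_act (edge_term E) (?e, es) []"
      unfolding split by (simp add: path_comp_assoc path_act_edge F)
    also have "\<dots> \<approx> (edge_path (edge_act (edge_init E) F []) \<circ>\<^sub>p edge_path (edge_act [] E ?e))
        \<circ>\<^sub>p path_act (edge_term E) (?e, es) []"
      using interchange_edges[OF assms(1) F(1)] w F(3) by (intro hom_comp_right) auto
    also have "\<dots> = edge_path (edge_act (edge_init E) F []) \<circ>\<^sub>p
        (path_act [] (edge_path E) ?e \<circ>\<^sub>p path_act (edge_term E) (?e, es) [])"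
      by (simp add: path_comp_assoc path_act_edge)
    also have "\<dots> \<approx> edge_path (edge_act (edge_init E) F []) \<circ>\<^sub>p
        (path_act (edge_init E) (?e, es) [] \<circ>\<^sub>p path_act [] (edge_path E) (path_term (?e, es)))"
      using Cons.IH[OF F(3)] F(1) w by (intro hom_comp_left) auto
    also have "\<dots> = path_act (edge_init E) (w, F # es) [] \<circ>\<^sub>p
        path_act [] (edge_path E) (path_term (w, F # es))"
      unfolding split by (simp add: path_comp_assoc)
    finally show ?case .
  qed
  from this[of "fst Q" "snd Q"] show ?thesis using assms by simp
qed

text \<open>The rectangle spanned by \<open>P\<close> and \<open>Q\<close> is filled strip by strip;
  each strip, one edge of \<open>P\<close> against all of \<open>Q\<close>, is
  \<open>interchange_edge_path\<close>.\<close>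

lemma interchange:
  assumes "is_dpath A R P" "is_dpath A R Q"
  shows "path_act [] P (fst Q) \<circ>\<^sub>p path_act (path_term P) Q []
    \<approx> path_act (fst P) Q [] \<circ>\<^sub>p path_act [] P (path_term Q)"
proof -
  have wQ: "fst Q \<in> lists A" "path_term Q \<in> lists A"
    using assms(2) is_dpath_init is_dpath_term by auto
  have "is_dpath A R (w, es) \<Longrightarrow>
    path_act [] (w, es) (fst Q) \<circ>\<^sub>p path_act (path_term (w, es)) Q []
    \<approx> path_act w Q [] \<circ>\<^sub>p path_act [] (w, es) (path_term Q)" for w es
  proof (induction es arbitrary: w)
    case Nil
    then have "is_dpath A R (path_act w Q [])"
      using assms(2) by auto
    then show ?case
      by (simp add: path_comp_empty_left hom_refl)
  next
    case (Cons E es)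
    let ?e = "edge_term E"
    have E: "E \<in> graph_edges A R" "w = edge_init E" "is_dpath A R (?e, es)"
      using Cons.prems by auto
    then have wE: "edge_init E \<in> lists A" "?e \<in> lists A" "path_term (?e, es) \<in> lists A"
      using edge_words is_dpath_term by auto
    have split: "path_act [] (w, E # es) c = path_act [] (edge_path E) c \<circ>\<^sub>p path_act [] (?e, es) c"
      for c
      by (simp add: path_act_def path_comp_def edge_path_def E)
    have "path_act [] (w, E # es) (fst Q) \<circ>\<^sub>p path_act (path_term (w, E # es)) Q []
      = path_act [] (edge_path E) (fst Q) \<circ>\<^sub>p
        (path_act [] (?e, es) (fst Q) \<circ>\<^sub>p path_act (path_term (?e, es)) Q [])"
      unfolding split by (simp add: path_comp_assoc)
    also have "\<dots> \<approx> path_act [] (edge_path E) (fst Q) \<circ>\<^sub>p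
        (path_act ?e Q [] \<circ>\<^sub>p path_act [] (?e, es) (path_term Q))"
      using Cons.IH[OF E(3)] E(1) wQ by (intro hom_comp_left) auto
    also have "\<dots> = (path_act [] (edge_path E) (fst Q) \<circ>\<^sub>p path_act ?e Q [])
        \<circ>\<^sub>p path_act [] (?e, es) (path_term Q)"
      by (simp add: path_comp_assoc)
    also have "\<dots> \<approx> (path_act (edge_init E) Q [] \<circ>\<^sub>p path_act [] (edge_path E) (path_term Q))
        \<circ>\<^sub>p path_act [] (?e, es) (path_term Q)"
      using interchange_edge_path[OF E(1) assms(2)] E(3) wQ by (intro hom_comp_right) auto
    also have "\<dots> = path_act w Q [] \<circ>\<^sub>p path_act [] (w, E # es) (path_term Q)"
      unfolding split by (simp add: path_comp_assoc E)
    finally show ?case .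
  qed
  from this[of "fst P" "snd P"] show ?thesis using assms by simp
qed

text \<open>The two ways of cancelling \<open>y\<close> against its inverse \<open>y'\<close> agree, so that conjugation by
  \<open>D\<close> can be undone after multiplication by \<open>y\<close>.\<close>

lemma cancel_inverse_word:
  assumes D: "is_dpath A R D" "fst D = y @ y'" "path_term D = []"
    and D': "is_dpath A R D'" "fst D' = y' @ y" "path_term D' = []"
    and null: "path_act [] (path_inv D) y \<circ>\<^sub>p path_act y D' [] \<approx> (y, [])"
    and Q: "is_dpath A R Q" "fst Q = u @ y" "path_term Q = v @ y"
    and w: "u \<in> lists A" "v \<in> lists A" "y \<in> lists A" "y' \<in> lists A"
  shows "path_act [] (path_act u (path_inv D) [] \<circ>\<^sub>p path_act [] Q y' \<circ>\<^sub>p path_act v D []) y \<approx> Q"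
proof -
  have "path_act [] (path_inv D) y \<approx> (y, []) \<circ>\<^sub>p path_inv (path_act y D' [])"
    using null D D' w by (intro hom_move_right) auto
  from hom_inv[OF this] have D_eq: "path_act [] D y \<approx> path_act y D' []"
    using D D' w is_dpath_act[of A R D' y "[]"] is_dpath_act[of A R D "[]" y]
    by (simp add: path_comp_empty_left path_act_inv)
  have "path_act [] (path_act u (path_inv D) [] \<circ>\<^sub>p path_act [] Q y' \<circ>\<^sub>p path_act v D []) y
    = path_act u (path_inv D) y \<circ>\<^sub>p path_act [] Q (y' @ y) \<circ>\<^sub>p path_act v (path_act [] D y) []"
    by (simp add: path_act_comp)
  also have "\<dots> \<approx> path_act u (path_inv D) y \<circ>\<^sub>p path_act [] Q (y' @ y) \<circ>\<^sub>p
      path_act v (path_act y D' []) []"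
    using hom_act[OF D_eq, of v "[]"] D D' Q w by (intro hom_comp_left) auto
  also have "\<dots> = path_act u (path_inv D) y \<circ>\<^sub>p
      (path_act [] Q (fst D') \<circ>\<^sub>p path_act (path_term Q) D' [])"
    by (simp add: D' Q)
  \<comment> \<open>\<open>Q\<close> and \<open>D'\<close> act on disjoint factors, so
    \<open>D'\<close> can be moved in front of \<open>Q\<close>, next to the inverse of
    \<open>D\<close>, where \<open>null\<close> contracts the pair.\<close>
  also have "\<dots> \<approx> path_act u (path_inv D) y \<circ>\<^sub>p
      (path_act (fst Q) D' [] \<circ>\<^sub>p path_act [] Q (path_term D'))"
    using interchange[OF Q(1) D'(1)] D D' Q w by (intro hom_comp_left) auto
  also have "\<dots> = path_act u (path_act [] (path_inv D) y \<circ>\<^sub>p path_act y D' []) [] \<circ>\<^sub>p Q"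
    by (simp add: D' Q path_act_comp path_comp_assoc)
  also have "\<dots> \<approx> path_act u (y, []) [] \<circ>\<^sub>p Q"
    using hom_act[OF null, of u "[]"] D D' Q w by (intro hom_comp_right) auto
  also have "\<dots> = Q"
    by (simp add: path_comp_empty_left Q)
  finally show ?thesis .
qed

lemma base_iff:
  "homotopy_base A R X \<longleftrightarrow> (\<forall>P. closed_path A R P \<longrightarrow> P \<approx> (fst P, []))"
  using X_closed by (auto simp: homotopy_base_def base_cells_def homotopic_def)

end

section \<open>Green's relations\<close>

lemma quotient_mem_iff:
  assumes "equiv A r" "K \<in> A // r" "x \<in> K"
  shows "y \<in> K \<longleftrightarrow> (x, y) \<in> r"
proof -
  from assms(2) obtain a where a: "K = r `` {a}" "a \<in> A"
    by (rule quotientE)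
  then have "(a, x) \<in> r"
    using assms(3) by blast
  then show ?thesis
    unfolding a(1) Image_singleton_iff
    using assms(1) unfolding equiv_def by (blast dest: symD transD)
qed

context monoid
begin

lemma mem_l_coset: "x \<in> s <# K \<longleftrightarrow> (\<exists>y\<in>K. x = s \<otimes> y)"
  by (simp add: l_coset_def)

lemma mem_r_coset: "x \<in> K #> s \<longleftrightarrow> (\<exists>y\<in>K. x = y \<otimes> s)"
  by (simp add: r_coset_def)

lemma principal_right_ideal_subset_iff:
  assumes "s \<in> carrier G" "t \<in> carrier G"
  shows "s <# carrier G \<subseteq> t <# carrier G \<longleftrightarrow> (\<exists>x\<in>carrier G. s = t \<otimes> x)"
proof
  assume "s <# carrier G \<subseteq> t <# carrier G"
  moreover have "s \<in> s <# carrier G"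
    unfolding mem_l_coset using assms by (intro bexI[of _ \<one>]) simp_all
  ultimately show "\<exists>x\<in>carrier G. s = t \<otimes> x"
    using mem_l_coset by blast
next
  assume "\<exists>x\<in>carrier G. s = t \<otimes> x"
  then obtain x where "x \<in> carrier G" "s = t \<otimes> x" ..
  then have "s \<otimes> y = t \<otimes> (x \<otimes> y)" "x \<otimes> y \<in> carrier G" if "y \<in> carrier G" for y
    using assms that by (simp_all add: m_assoc)
  then show "s <# carrier G \<subseteq> t <# carrier G"
    unfolding subset_iff mem_l_coset by blast
qed

lemma principal_left_ideal_subset_iff:
  assumes "s \<in> carrier G" "t \<in> carrier G"
  shows "carrier G #> s \<subseteq> carrier G #> t \<longleftrightarrow> (\<exists>x\<in>carrier G. s = x \<otimes> t)"
proof
  assume "carrier G #> s \<subseteq> carrier G #> t"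
  moreover have "s \<in> carrier G #> s"
    unfolding mem_r_coset using assms by (intro bexI[of _ \<one>]) simp_all
  ultimately show "\<exists>x\<in>carrier G. s = x \<otimes> t"
    using mem_r_coset by blast
next
  assume "\<exists>x\<in>carrier G. s = x \<otimes> t"
  then obtain x where "x \<in> carrier G" "s = x \<otimes> t" ..
  then have "y \<otimes> s = (y \<otimes> x) \<otimes> t" "y \<otimes> x \<in> carrier G" if "y \<in> carrier G" for y
    using assms that by (simp_all add: m_assoc)
  then show "carrier G #> s \<subseteq> carrier G #> t"
    unfolding subset_iff mem_r_coset by blast
qed

lemma green_R_iff:
  "(s, t) \<in> green_R G \<longleftrightarrow> s \<in> carrier G \<and> t \<in> carrier G \<and>
    (\<exists>x\<in>carrier G. t = s \<otimes> x) \<and> (\<exists>x\<in>carrier G. s = t \<otimes> x)"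
  unfolding green_R_def set_eq_subset
  using principal_right_ideal_subset_iff[of s t] principal_right_ideal_subset_iff[of t s] by blast

lemma green_L_iff:
  "(s, t) \<in> green_L G \<longleftrightarrow> s \<in> carrier G \<and> t \<in> carrier G \<and>
    (\<exists>x\<in>carrier G. t = x \<otimes> s) \<and> (\<exists>x\<in>carrier G. s = x \<otimes> t)"
  unfolding green_L_def set_eq_subset
  using principal_left_ideal_subset_iff[of s t] principal_left_ideal_subset_iff[of t s] by blast

lemma equiv_green_R: "equiv (carrier G) (green_R G)"
  by (rule equivI) (auto simp: green_R_def refl_on_def sym_def trans_def)

lemma equiv_green_H: "equiv (carrier G) (green_H G)"
  by (rule equivI) (auto simp: green_H_def green_R_def green_L_def refl_on_def sym_def trans_def)

text \<open>This left compatibility is what makes the action of S on the R-classes well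
  defined.\<close>

lemma green_R_left:
  "(s, t) \<in> green_R G \<Longrightarrow> c \<in> carrier G \<Longrightarrow> (c \<otimes> s, c \<otimes> t) \<in> green_R G"
  unfolding green_R_iff by (metis m_assoc m_closed)

text \<open>Green's lemma: if \<open>x \<R> x w\<close> with \<open>x w t = x\<close>, then right translations by \<open>w\<close> and
  \<open>t\<close> are mutually inverse between the \<open>\<H>\<close>-classes of \<open>x\<close> and \<open>x w\<close>.\<close>

lemma green_H_translate:
  assumes "(x, y) \<in> green_H G" "w \<in> carrier G" "(x, x \<otimes> w) \<in> green_R G"
  shows "(x \<otimes> w, y \<otimes> w) \<in> green_H G"
proof -
  have xy: "x \<in> carrier G" "y \<in> carrier G"
    using assms by (auto simp: green_H_def green_R_def)
  from assms obtain t where t: "t \<in> carrier G" "x = x \<otimes> w \<otimes> t"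
    by (auto simp: green_R_iff)
  from assms obtain s s' where s: "s \<in> carrier G" "y = s \<otimes> x" "s' \<in> carrier G" "x = s' \<otimes> y"
    by (auto simp: green_H_def green_L_iff)
  \<comment> \<open>As \<open>y\<close> is a left multiple of \<open>x\<close>, the element
    \<open>t\<close> that undoes \<open>w\<close> at \<open>x\<close> undoes it at \<open>y\<close>
    too.\<close>
  have "y \<otimes> w \<otimes> t = s \<otimes> (x \<otimes> w \<otimes> t)"
    using s(1) t(1) xy(1) assms(2) by (subst s(2)) (simp add: m_assoc)
  then have "y = y \<otimes> w \<otimes> t"
    by (metis s(2) t(2))
  then have "(y, y \<otimes> w) \<in> green_R G"
    unfolding green_R_iff using xy assms(2) t(1) by blast
  moreover have "(x, y) \<in> green_R G"
    using assms by (auto simp: green_H_def)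
  ultimately have "(x \<otimes> w, y \<otimes> w) \<in> green_R G"
    using assms(3) by (auto simp: green_R_def)
  moreover have "y \<otimes> w = s \<otimes> (x \<otimes> w)" "x \<otimes> w = s' \<otimes> (y \<otimes> w)"
    using s(1,3) xy assms(2) m_assoc s(2,4) by metis+
  then have "(x \<otimes> w, y \<otimes> w) \<in> green_L G"
    unfolding green_L_iff using s(1,3) xy assms(2) by blast
  ultimately show ?thesis
    by (simp add: green_H_def)
qed

text \<open>Green's lemma in both directions: translation by \<open>w\<close> stays inside the class
  of x w, and a member z of that class is the image of z t, where t leads back from x w to
  x.\<close>

lemma green_H_coset:
  assumes K: "K \<in> carrier G // green_H G" "x \<in> K"
    and w: "w \<in> carrier G" "(x, x \<otimes> w) \<in> green_R G"
  shows "K #> w = green_H G `` {x \<otimes> w}"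
proof
  have mem: "y \<in> K \<longleftrightarrow> (x, y) \<in> green_H G" for y
    by (rule quotient_mem_iff[OF equiv_green_H K])
  show "K #> w \<subseteq> green_H G `` {x \<otimes> w}"
    using green_H_translate[OF _ w] mem by (auto simp: mem_r_coset)
  have x: "x \<in> carrier G"
    using w by (auto simp: green_R_def)
  from w obtain t where t: "t \<in> carrier G" "x = x \<otimes> w \<otimes> t"
    by (auto simp: green_R_iff)
  show "green_H G `` {x \<otimes> w} \<subseteq> K #> w"
  proof
    fix z assume "z \<in> green_H G `` {x \<otimes> w}"
    then have z: "(x \<otimes> w, z) \<in> green_H G" "z \<in> carrier G"
      by (auto simp: green_H_def green_R_def)
    have "(x \<otimes> w, x \<otimes> w \<otimes> t) \<in> green_R G"
      using w t(2) by (auto simp: green_R_def)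
    from green_H_translate[OF z(1) t(1) this] t(2) have "z \<otimes> t \<in> K"
      by (simp add: mem)
    moreover have "z \<otimes> t \<otimes> w = z"
    proof -
      from z obtain s where s: "s \<in> carrier G" "z = s \<otimes> (x \<otimes> w)"
        by (auto simp: green_H_def green_L_iff)
      then have "z \<otimes> t \<otimes> w = s \<otimes> (x \<otimes> w \<otimes> t \<otimes> w)"
        using t(1) w(1) x by (simp add: m_assoc)
      with t(2) s(2) show ?thesis by metis
    qed
    ultimately show "z \<in> K #> w"
      unfolding mem_r_coset by metis
  qed
qed

end

section \<open>The actions on the index sets\<close>

lemma word_val_closed:
  "monoid M \<Longrightarrow> (\<And>a. a \<in> set w \<Longrightarrow> g a \<in> carrier M) \<Longrightarrow> word_val M g w \<in> carrier M"
  unfolding word_val_def by (induction w) (auto intro: monoid.m_closed monoid.one_closed)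

lemma word_val_append:
  assumes "monoid M" "\<And>a. a \<in> set u \<union> set v \<Longrightarrow> g a \<in> carrier M"
  shows "word_val M g (u @ v) = word_val M g u \<otimes>\<^bsub>M\<^esub> word_val M g v"
  using assms(2)
proof (induction u)
  case Nil
  then show ?case
    using word_val_closed[OF assms(1), of v g] monoid.l_one[OF assms(1)] by (simp add: word_val_def)
next
  case (Cons a u)
  then show ?case
    using word_val_closed[OF assms(1), of v g] word_val_closed[OF assms(1), of u g]
      monoid.m_assoc[OF assms(1)]
    by (simp add: word_val_def)
qed

context schutz_setting
begin

sublocale monoid "mon D"
  using pres by (simp add: defined_by_pres_def)

sublocale P: word_relations "alph D" "rels D"
  using pres by unfold_locales (simp add: defined_by_pres_def)

abbreviation mul (infixl "\<cdot>" 70) where "x \<cdot> y \<equiv> x \<otimes>\<^bsub>mon D\<^esub> y"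
abbreviation S where "S \<equiv> carrier (mon D)"
abbreviation V where "V \<equiv> val D"
abbreviation words where "words \<equiv> lists (alph D)"
abbreviation Bwords where "Bwords \<equiv> lists (Bgens D)"
abbreviation L where "L \<equiv> Lam D"
abbreviation I where "I \<equiv> Idx D"
abbreviation h where "h \<equiv> hword D"

lemma gen_closed: "a \<in> alph D \<Longrightarrow> gen D a \<in> S"
  using pres by (auto simp: defined_by_pres_def)

lemma V_closed [simp]: "w \<in> words \<Longrightarrow> V w \<in> S"
  unfolding val_def by (intro word_val_closed monoid_axioms gen_closed) (auto simp: in_lists_conv_set)

lemma V_append [simp]: "u \<in> words \<Longrightarrow> v \<in> words \<Longrightarrow> V (u @ v) = V u \<cdot> V v"
  unfolding val_def
  by (intro word_val_append monoid_axioms gen_closed) (auto simp: in_lists_conv_set)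

lemma V_Nil [simp]: "V [] = \<one>\<^bsub>mon D\<^esub>"
  by (simp add: val_def word_val_def)

lemma V_surj: "s \<in> S \<Longrightarrow> \<exists>w\<in>words. V w = s"
proof -
  assume "s \<in> S"
  then have "s \<in> word_val (mon D) (gen D) ` words"
    using pres by (simp add: defined_by_pres_def)
  then show ?thesis
    by (auto simp: val_def)
qed

lemma V_eq_iff: "u \<in> words \<Longrightarrow> v \<in> words \<Longrightarrow> V u = V v \<longleftrightarrow> (u, v) \<in> pres_cong (alph D) (rels D)"
  using pres by (auto simp: defined_by_pres_def val_def)

lemma hword_words [simp]: "h \<in> words"
  using hword by simp

section \<open>The H-classes in R and the right action on their indices\<close>

lemma hcls_class: "l \<in> L \<Longrightarrow> hcls D l \<in> S // green_H (mon D)" "l \<in> L \<Longrightarrow> hcls D l \<subseteq> rcl D"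
  using bij_betwE[OF hcls_bij] by auto

lemma class_S: "K \<in> S // green_H (mon D) \<Longrightarrow> x \<in> K \<Longrightarrow> x \<in> S"
  using equiv_green_H by (metis Union_quotient UnionI)

lemma hcls_S: "l \<in> L \<Longrightarrow> x \<in> hcls D l \<Longrightarrow> x \<in> S"
  using hcls_class class_S by blast

lemma hcl_S: "x \<in> hcl D \<Longrightarrow> x \<in> S"
  using hcl_class class_S by blast

lemma class_mem: "K \<in> S // green_H (mon D) \<Longrightarrow> x \<in> K \<Longrightarrow> y \<in> K \<longleftrightarrow> (x, y) \<in> green_H (mon D)"
  by (rule quotient_mem_iff[OF equiv_green_H])

lemma class_nonempty: "K \<in> S // green_H (mon D) \<Longrightarrow> \<exists>x. x \<in> K"
  using equiv_green_H in_quotient_imp_non_empty by fastforce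

lemma hcls_elem: "l \<in> L \<Longrightarrow> \<exists>x. x \<in> hcls D l"
  using hcls_class class_nonempty by blast

lemma rcl_iff: "x \<in> hcl D \<Longrightarrow> y \<in> rcl D \<longleftrightarrow> (x, y) \<in> green_R (mon D)"
proof -
  assume x: "x \<in> hcl D"
  have "(x, z) \<in> green_R (mon D)" if "z \<in> hcl D" for z
    using class_mem[OF hcl_class x] that by (auto simp: green_H_def)
  with x show ?thesis
    using equiv_green_R unfolding rcl_def equiv_def by (blast dest: symD transD)
qed

lemma rcl_S: "y \<in> rcl D \<Longrightarrow> y \<in> S"
  by (auto simp: rcl_def green_R_def)

lemma rcl_rel: "x \<in> rcl D \<Longrightarrow> y \<in> rcl D \<longleftrightarrow> (x, y) \<in> green_R (mon D)"
  using rcl_iff[OF hword(2)] by (auto simp: green_R_def)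

lemma hcl_rcl: "x \<in> hcl D \<Longrightarrow> x \<in> rcl D"
  using hcls_class lone by auto

lemma hcls_unique: "l \<in> L \<Longrightarrow> m \<in> L \<Longrightarrow> x \<in> hcls D l \<Longrightarrow> x \<in> hcls D m \<Longrightarrow> l = m"
  using quotient_disj[OF equiv_green_H hcls_class(1) hcls_class(1), of l m] hcls_bij
  by (auto simp: bij_betw_def inj_on_def)

lemma hcls_cover: "x \<in> rcl D \<Longrightarrow> \<exists>l\<in>L. x \<in> hcls D l"
proof -
  assume x: "x \<in> rcl D"
  let ?K = "green_H (mon D) `` {x}"
  have "?K \<in> S // green_H (mon D)"
    using x rcl_S by (simp add: quotientI)
  moreover have "?K \<subseteq> rcl D"
    using rcl_rel[OF x] unfolding green_H_def by blast
  ultimately have "?K \<in> hcls D ` L"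
    unfolding bij_betw_imp_surj_on[OF hcls_bij] by simp
  then obtain l where "?K = hcls D l" "l \<in> L"
    by (rule imageE)
  moreover have "x \<in> ?K"
    using equiv_class_self[OF equiv_green_H] x rcl_S by blast
  ultimately show ?thesis by blast
qed

text \<open>The action is defined through images of whole classes, but by Green's lemma a single
  element \<open>x\<close> decides: if x w lies in some H_m, then it lies in R, and H_l w is the
  full H-class of x w.\<close>

lemma ract_iff:
  assumes "l \<in> L" "w \<in> words" "x \<in> hcls D l"
  shows "ract D l w = Some m \<longleftrightarrow> m \<in> L \<and> x \<cdot> V w \<in> hcls D m"
proof -
  have coset: "hcls D l #>\<^bsub>mon D\<^esub> V w = hcls D n \<longleftrightarrow> x \<cdot> V w \<in> hcls D n" if "n \<in> L" for n
  proof
    assume "hcls D l #>\<^bsub>mon D\<^esub> V w = hcls D n"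
    then show "x \<cdot> V w \<in> hcls D n"
      using assms mem_r_coset[of "x \<cdot> V w" "hcls D l" "V w"] by auto
  next
    assume n: "x \<cdot> V w \<in> hcls D n"
    have "(x, x \<cdot> V w) \<in> green_R (mon D)"
      using n that assms hcls_class(2) rcl_rel by blast
    then have "hcls D l #>\<^bsub>mon D\<^esub> V w = green_H (mon D) `` {x \<cdot> V w}"
      using green_H_coset[OF hcls_class(1)] assms by auto
    then show "hcls D l #>\<^bsub>mon D\<^esub> V w = hcls D n"
      using class_mem[OF hcls_class(1) n] that by auto
  qed
  have the: "(THE n. n \<in> L \<and> hcls D l #>\<^bsub>mon D\<^esub> V w = hcls D n) = n"
    if "n \<in> L" "x \<cdot> V w \<in> hcls D n" for n
  proof (rule the_equality)
    show "n \<in> L \<and> hcls D l #>\<^bsub>mon D\<^esub> V w = hcls D n"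
      using coset that by simp
    fix n' assume "n' \<in> L \<and> hcls D l #>\<^bsub>mon D\<^esub> V w = hcls D n'"
    then show "n' = n"
      using coset[of n'] that hcls_unique by blast
  qed
  show ?thesis
    unfolding ract_def using coset the by auto
qed

lemma ract_defined:
  assumes "l \<in> L" "w \<in> words" "x \<in> hcls D l"
  shows "ract D l w \<noteq> None \<longleftrightarrow> x \<cdot> V w \<in> rcl D"
proof -
  have "ract D l w \<noteq> None \<longleftrightarrow> (\<exists>m\<in>L. x \<cdot> V w \<in> hcls D m)"
    using ract_iff[OF assms] by auto
  also have "\<dots> \<longleftrightarrow> x \<cdot> V w \<in> rcl D"
    using hcls_cover hcls_class(2) by blast
  finally show ?thesis .
qed

lemma ract_SomeD: "ract D l w = Some m \<Longrightarrow> l \<in> L \<Longrightarrow> w \<in> words \<Longrightarrow> m \<in> L"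
  using ract_iff[of l w] hcls_elem[of l] by blast

lemma ract_Nil [simp]: "l \<in> L \<Longrightarrow> ract D l [] = Some l"
  using hcls_elem[of l] ract_iff[of l "[]"] hcls_S by auto

lemma ract_append:
  assumes "l \<in> L" "u \<in> words" "v \<in> words" "ract D l u = Some m"
  shows "ract D l (u @ v) = ract D m v"
proof -
  obtain x where x: "x \<in> hcls D l"
    using hcls_elem assms by blast
  have m: "m \<in> L" "x \<cdot> V u \<in> hcls D m"
    using ract_iff[OF assms(1,2) x] assms by auto
  have "ract D l (u @ v) = Some n \<longleftrightarrow> ract D m v = Some n" for n
    using ract_iff[OF assms(1) _ x, of "u @ v" n] ract_iff[OF m(1) assms(3) m(2), of n]
      assms hcls_S[OF _ x] by (simp add: m_assoc)
  then show ?thesis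
    by (metis not_None_eq)
qed

text \<open>If x = x u v t, then x = x u (v t), so x u has not left R either.\<close>

lemma ract_prefix:
  assumes "l \<in> L" "u \<in> words" "v \<in> words" "ract D l (u @ v) \<noteq> None"
  shows "ract D l u \<noteq> None"
proof -
  obtain x where x: "x \<in> hcls D l"
    using hcls_elem assms by blast
  have xS: "x \<in> S"
    using hcls_S x assms by blast
  have "x \<cdot> (V u \<cdot> V v) \<in> rcl D" "x \<in> rcl D"
    using ract_defined[OF assms(1) _ x, of "u @ v"] assms hcls_class(2) x by auto
  then obtain t where t: "t \<in> S" "x = x \<cdot> (V u \<cdot> V v) \<cdot> t"
    using rcl_rel green_R_iff by blast
  have "x \<cdot> V u \<cdot> (V v \<cdot> t) = x \<cdot> (V u \<cdot> V v) \<cdot> t"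
    using assms xS t(1) by (simp add: m_assoc)
  then have "x = x \<cdot> V u \<cdot> (V v \<cdot> t)" "V v \<cdot> t \<in> S" "V u \<in> S" "x \<cdot> V u \<in> S"
    using t assms xS by auto
  then have "(x, x \<cdot> V u) \<in> green_R (mon D)"
    unfolding green_R_iff using xS by blast
  then show ?thesis
    using ract_defined[OF assms(1,2) x] rcl_rel \<open>x \<in> rcl D\<close> by blast
qed

section \<open>The left action on the indices of R-classes and the words \<kappa>\<close>

lemma rcls_class:
  "i \<in> I \<Longrightarrow> rcls D i \<in> S // green_R (mon D)"
  "i \<in> I \<Longrightarrow> \<exists>s\<in>S. s <#\<^bsub>mon D\<^esub> rcls D i \<subseteq> rcl D"
  using bij_betwE[OF rcls_bij] by auto

lemma rclass_mem: "K \<in> S // green_R (mon D) \<Longrightarrow> x \<in> K \<Longrightarrow> y \<in> K \<longleftrightarrow> (x, y) \<in> green_R (mon D)"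
  by (rule quotient_mem_iff[OF equiv_green_R])

lemma rcls_S: "i \<in> I \<Longrightarrow> y \<in> rcls D i \<Longrightarrow> y \<in> S"
  using rcls_class(1) equiv_green_R by (metis Union_quotient UnionI)

lemma rcls_unique: "i \<in> I \<Longrightarrow> j \<in> I \<Longrightarrow> x \<in> rcls D i \<Longrightarrow> x \<in> rcls D j \<Longrightarrow> i = j"
  using quotient_disj[OF equiv_green_R rcls_class(1) rcls_class(1), of i j] rcls_bij
  by (auto simp: bij_betw_def inj_on_def)

lemma coset_subset_rclass:
  assumes "K \<in> S // green_R (mon D)" "K' \<in> S // green_R (mon D)" "s \<in> S" "y \<in> K"
  shows "s <#\<^bsub>mon D\<^esub> K \<subseteq> K' \<longleftrightarrow> s \<cdot> y \<in> K'"
proof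
  show "s <#\<^bsub>mon D\<^esub> K \<subseteq> K' \<Longrightarrow> s \<cdot> y \<in> K'"
    using assms unfolding mem_l_coset subset_iff by blast
next
  assume *: "s \<cdot> y \<in> K'"
  have "s \<cdot> z \<in> K'" if "z \<in> K" for z
    using green_R_left[of y z s] assms that rclass_mem[OF assms(1,4)] rclass_mem[OF assms(2) *]
    by blast
  then show "s <#\<^bsub>mon D\<^esub> K \<subseteq> K'"
    unfolding mem_l_coset subset_iff by blast
qed

lemma rcl_class: "rcl D \<in> S // green_R (mon D)"
  using rcls_class(1)[OF om(1)] om(2) by simp

lemma rcls_cover:
  assumes "y \<in> S" "s \<in> S" "s \<cdot> y \<in> rcl D"
  shows "\<exists>i\<in>I. y \<in> rcls D i"
proof -
  let ?K = "green_R (mon D) `` {y}"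
  have K: "?K \<in> S // green_R (mon D)" "y \<in> ?K"
    using assms equiv_green_R quotientI equiv_class_self by fast+
  then have "s <#\<^bsub>mon D\<^esub> ?K \<subseteq> rcl D"
    using coset_subset_rclass[OF K(1) rcl_class assms(2) K(2)] assms by blast
  then have "?K \<in> rcls D ` I"
    unfolding bij_betw_imp_surj_on[OF rcls_bij] using K(1) assms(2) by blast
  then obtain i where "?K = rcls D i" "i \<in> I"
    by (rule imageE)
  with K show ?thesis by blast
qed

lemma rcls_to_rcl: "i \<in> I \<Longrightarrow> y \<in> rcls D i \<Longrightarrow> \<exists>s\<in>S. s \<cdot> y \<in> rcl D"
  using rcls_class coset_subset_rclass rcl_class by blast

lemma lact_iff:
  assumes "i \<in> I" "w \<in> words" "y \<in> rcls D i"
  shows "lact D w i = Some j \<longleftrightarrow> j \<in> I \<and> V w \<cdot> y \<in> rcls D j"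
proof -
  have coset: "V w <#\<^bsub>mon D\<^esub> rcls D i \<subseteq> rcls D k \<longleftrightarrow> V w \<cdot> y \<in> rcls D k" if "k \<in> I" for k
    using coset_subset_rclass rcls_class(1) assms that by simp
  have the: "(THE k. k \<in> I \<and> V w <#\<^bsub>mon D\<^esub> rcls D i \<subseteq> rcls D k) = k"
    if "k \<in> I" "V w \<cdot> y \<in> rcls D k" for k
    using that coset rcls_unique by (intro the_equality) auto
  show ?thesis
    unfolding lact_def using coset the by auto
qed

lemma rcls_elem: "i \<in> I \<Longrightarrow> V (rword D i) \<in> rcls D i"
  using rword by simp

lemma lact_SomeD: "lact D w i = Some j \<Longrightarrow> i \<in> I \<Longrightarrow> w \<in> words \<Longrightarrow> j \<in> I"
  using lact_iff rcls_elem by blast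

lemma lact_Nil [simp]: "i \<in> I \<Longrightarrow> lact D [] i = Some i"
  using rcls_elem[of i] lact_iff[of i "[]"] rcls_S by auto

lemma lact_append:
  assumes "i \<in> I" "u \<in> words" "v \<in> words" "lact D v i = Some j"
  shows "lact D (u @ v) i = lact D u j"
proof -
  note y = rcls_elem[OF assms(1)]
  have j: "j \<in> I" "V v \<cdot> V (rword D i) \<in> rcls D j"
    using lact_iff[OF assms(1,3) y] assms by auto
  have "lact D (u @ v) i = Some n \<longleftrightarrow> lact D u j = Some n" for n
    using lact_iff[OF assms(1) _ y, of "u @ v" n] lact_iff[OF j(1) assms(2) j(2), of n]
      assms rcls_S[OF _ y] by (simp add: m_assoc)
  then show ?thesis
    by (metis not_None_eq)
qed

text \<open>If s carries u v y into R, then s u carries v y into R; so the class of v y belongs to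
  the inverse orbit of R and has an index.\<close>

lemma lact_suffix:
  assumes "i \<in> I" "u \<in> words" "v \<in> words" "lact D (u @ v) i \<noteq> None"
  shows "lact D v i \<noteq> None"
proof -
  note y = rcls_elem[OF assms(1)]
  have yS: "V (rword D i) \<in> S"
    using rcls_S y assms by blast
  from assms obtain j where j: "j \<in> I" "V u \<cdot> V v \<cdot> V (rword D i) \<in> rcls D j"
    using lact_iff[OF assms(1) _ y, of "u @ v"] by auto
  then obtain s where "s \<in> S" "s \<cdot> (V u \<cdot> V v \<cdot> V (rword D i)) \<in> rcl D"
    using rcls_to_rcl by blast
  then have "\<exists>k\<in>I. V v \<cdot> V (rword D i) \<in> rcls D k"
    using assms yS by (intro rcls_cover[of _ "s \<cdot> V u"]) (auto simp: m_assoc)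
  then show ?thesis
    using lact_iff[OF assms(1,3) y] by auto
qed

lemma kappa_Nil [simp]: "kappa D [] i = []"
  by (simp add: kappa_def)

lemma kappa_snoc: "kappa D (w @ [a]) i = kappa D w (the (lact D [a] i)) @ kap D a i"
  by (simp add: kappa_def)

lemma lact_snoc:
  assumes "i \<in> I" "u \<in> words" "a \<in> alph D" "lact D (u @ [a]) i = Some j"
  obtains k where "k \<in> I" "lact D [a] i = Some k" "lact D u k = Some j"
proof -
  obtain k where k: "lact D [a] i = Some k"
    using lact_suffix[OF assms(1,2), of "[a]"] assms by auto
  then have "k \<in> I" "lact D u k = Some j"
    using lact_SomeD[OF k] lact_append[OF assms(1,2) _ k] assms by auto
  with k that show ?thesis by blast
qed

lemma kappa_append:
  assumes "u \<in> words" "i \<in> I" "v \<in> words" "lact D v i = Some j"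
  shows "kappa D (u @ v) i = kappa D u j @ kappa D v i"
  using assms(2-)
proof (induction v arbitrary: i rule: rev_induct)
  case Nil
  then show ?case by simp
next
  case (snoc a v)
  then have av: "v \<in> words" "a \<in> alph D"
    by auto
  obtain k where k: "k \<in> I" "lact D [a] i = Some k" "lact D v k = Some j"
    using lact_snoc[OF snoc.prems(1) av snoc.prems(3)] .
  show ?case
    using snoc.IH[OF k(1) av(1) k(3)] kappa_snoc[of "u @ v" a i] k by (simp add: kappa_snoc)
qed

text \<open>The rule a r_i = r_j \<kappa>(a, i), where j = a * i, applied from the right end of the
  word: \<kappa> records which right factor a left multiplication leaves behind.\<close>

lemma kappa_words_val:
  assumes "i \<in> I" "w \<in> words" "lact D w i = Some j"
  shows "kappa D w i \<in> words \<and> V w \<cdot> V (rword D i) = V (rword D j) \<cdot> V (kappa D w i)"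
  using assms
proof (induction w arbitrary: i rule: rev_induct)
  case Nil
  then show ?case using rword by simp
next
  case (snoc a w)
  then have av: "w \<in> words" "a \<in> alph D"
    by auto
  obtain k where k: "k \<in> I" "lact D [a] i = Some k" "lact D w k = Some j"
    using lact_snoc[OF snoc.prems(1) av snoc.prems(3)] .
  have j: "j \<in> I"
    using lact_SomeD k av by blast
  have IH: "kappa D w k \<in> words" "V w \<cdot> V (rword D k) = V (rword D j) \<cdot> V (kappa D w k)"
    using snoc.IH[OF k(1) av(1) k(3)] by auto
  have ka: "kap D a i \<in> words"
    using kap_word av snoc.prems(1) k(2) by auto
  have "V [a] \<cdot> V (rword D i) = V (rword D k) \<cdot> V (kap D a i)"
    using kap_val[OF av(2) snoc.prems(1) k(2)] V_append[of "[a]" "rword D i"] ka rword k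
      snoc.prems av by auto
  then have "V (w @ [a]) \<cdot> V (rword D i) = V w \<cdot> V (rword D k) \<cdot> V (kap D a i)"
    using av rword snoc.prems(1) k(1) ka by (simp add: m_assoc)
  also have "\<dots> = V (rword D j) \<cdot> V (kappa D w k @ kap D a i)"
    using IH ka rword(1)[OF j] by (simp add: m_assoc)
  finally show ?case
    using IH ka k by (simp add: kappa_snoc)
qed

lemma kappa_words: "i \<in> I \<Longrightarrow> w \<in> words \<Longrightarrow> lact D w i = Some j \<Longrightarrow> kappa D w i \<in> words"
  using kappa_words_val by blast

lemma kappa_val:
  "i \<in> I \<Longrightarrow> w \<in> words \<Longrightarrow> lact D w i = Some j \<Longrightarrow>
    V w \<cdot> V (rword D i) = V (rword D j) \<cdot> V (kappa D w i)"
  using kappa_words_val by blast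

text \<open>All elements of an H-class generate the same left ideal, so one of them decides the
  inclusion.\<close>

lemma under_iff:
  assumes "l \<in> L" "x \<in> hcls D l" "i \<in> I"
  shows "under D l i \<longleftrightarrow> (\<exists>s\<in>S. x = s \<cdot> V (rword D i))"
proof
  assume "under D l i"
  then show "\<exists>s\<in>S. x = s \<cdot> V (rword D i)"
    using assms unfolding under_def mem_r_coset subset_iff by blast
next
  assume "\<exists>s\<in>S. x = s \<cdot> V (rword D i)"
  then obtain s where s: "s \<in> S" "x = s \<cdot> V (rword D i)"
    by blast
  have "\<exists>t\<in>S. y = t \<cdot> V (rword D i)" if "y \<in> hcls D l" for y
  proof -
    have "(x, y) \<in> green_L (mon D)"
      using class_mem[OF hcls_class(1)] assms that by (auto simp: green_H_def)
    then obtain t where "t \<in> S" "y = t \<cdot> x"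
      using green_L_iff by blast
    then show ?thesis
      using s rword(1)[OF assms(3)] by (intro bexI[of _ "t \<cdot> s"]) (auto simp: m_assoc)
  qed
  then show "under D l i"
    unfolding under_def mem_r_coset subset_iff by blast
qed

text \<open>The form in which \<kappa> is used on elements of H_l: if x = s r_i, then right
  multiplication of x by \<kappa>(w, j) amounts to inserting w between s and r_j.\<close>

lemma kappa_translate:
  assumes "j \<in> I" "w \<in> words" "lact D w j = Some i" "s \<in> S"
  shows "s \<cdot> V (rword D i) \<cdot> V (kappa D w j) = s \<cdot> V w \<cdot> V (rword D j)"
  using kappa_val[OF assms(1-3)] kappa_words[OF assms(1-3)] lact_SomeD[OF assms(3,1,2)] assms
    rword(1)
  by (simp add: m_assoc)

text \<open>Write x = s r_i with x in H_l. Both r_i and w r_j lie in R_i, hence x and s w r_j are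
  R-related, and the latter is x \<kappa>(w, j). So the right action does not vanish, and its result
  is a left multiple of r_j.\<close>

lemma under_step:
  assumes "l \<in> L" "j \<in> I" "w \<in> words" "lact D w j = Some i" "under D l i"
  obtains m where "m \<in> L" "ract D l (kappa D w j) = Some m" "under D m j"
proof -
  obtain x where x: "x \<in> hcls D l"
    using hcls_elem assms by blast
  have i: "i \<in> I" "V w \<cdot> V (rword D j) \<in> rcls D i"
    using lact_iff[OF assms(2,3) rcls_elem] assms by auto
  obtain s where s: "s \<in> S" "x = s \<cdot> V (rword D i)"
    using under_iff[OF assms(1) x i(1)] assms by auto
  note k = kappa_words[OF assms(2-4)]
  have eq: "x \<cdot> V (kappa D w j) = s \<cdot> V w \<cdot> V (rword D j)"
    using kappa_translate[OF assms(2-4) s(1)] s(2) by simp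
  have "(V (rword D i), V w \<cdot> V (rword D j)) \<in> green_R (mon D)"
    using rclass_mem[OF rcls_class(1) rcls_elem] i by blast
  then have "(x, x \<cdot> V (kappa D w j)) \<in> green_R (mon D)"
    using green_R_left[OF _ s(1)] s eq assms rword(1)[OF assms(2)] by (fastforce simp: m_assoc)
  then have "x \<cdot> V (kappa D w j) \<in> rcl D"
    using rcl_rel hcls_class(2) x assms by blast
  then obtain m where m: "ract D l (kappa D w j) = Some m"
    using ract_defined[OF assms(1) k x] by blast
  then have m': "m \<in> L" "x \<cdot> V (kappa D w j) \<in> hcls D m"
    using ract_iff[OF assms(1) k x] by auto
  then have "under D m j"
    using under_iff[OF m' assms(2)] eq s assms by auto
  with m m' that show ?thesis by blast
qed

section \<open>The words over the generators of the Schuetzenberger group\<close>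

lemma phi_append:
  "l \<in> L \<Longrightarrow> u \<in> words \<Longrightarrow> v \<in> words \<Longrightarrow> ract D l u = Some m \<Longrightarrow>
    phi D l (u @ v) = phi D l u @ phi D m v"
proof (induction u arbitrary: l)
  case Nil
  then show ?case by simp
next
  case (Cons a u)
  have w: "[a] \<in> words" "u \<in> words"
    using Cons.prems by auto
  then obtain k where k: "ract D l [a] = Some k"
    using ract_prefix[of l "[a]" u] Cons.prems by auto
  then have "k \<in> L" "ract D k u = Some m"
    using ract_SomeD[OF k] ract_append[OF Cons.prems(1) w k] Cons.prems w by auto
  then show ?case
    using Cons k by simp
qed

lemma phi_words: "l \<in> L \<Longrightarrow> w \<in> words \<Longrightarrow> ract D l w = Some m \<Longrightarrow> phi D l w \<in> Bwords"
proof (induction w arbitrary: l)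
  case Nil
  then show ?case by simp
next
  case (Cons a u)
  have w: "[a] \<in> words" "u \<in> words"
    using Cons.prems by auto
  then obtain k where k: "ract D l [a] = Some k"
    using ract_prefix[of l "[a]" u] Cons.prems by auto
  then have "k \<in> L" "ract D k u = Some m"
    using ract_SomeD[OF k] ract_append[OF Cons.prems(1) w k] Cons.prems w by auto
  then show ?case
    using Cons k by (simp add: Bgens_def)
qed

lemma psi_simps [simp]:
  "psi D [] = []"
  "psi D ((l, a) # w) = pw D l @ [a] @ pw' D (the (ract D l [a])) @ psi D w"
  "psi D (u @ v) = psi D u @ psi D v"
  by (simp_all add: psi_def)

lemma Bgens_cases:
  assumes "b \<in> Bgens D"
  obtains l a m where "b = (l, a)" "l \<in> L" "a \<in> alph D" "ract D l [a] = Some m" "m \<in> L"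
  using assms ract_SomeD unfolding Bgens_def by fastforce

lemma psi_words [simp]: "w \<in> Bwords \<Longrightarrow> psi D w \<in> words"
proof (induction w)
  case (Cons b w)
  then have "b \<in> Bgens D"
    by simp
  then obtain l a m where "b = (l, a)" "l \<in> L" "a \<in> alph D" "ract D l [a] = Some m" "m \<in> L"
    by (rule Bgens_cases)
  then show ?case using Cons pw_words by simp
qed simp

lemma pw_hcls: "l \<in> L \<Longrightarrow> x \<in> hcl D \<Longrightarrow> x \<cdot> V (pw D l) \<in> hcls D l"
  using pw_image[of l] mem_r_coset[of "x \<cdot> V (pw D l)" "hcl D" "V (pw D l)"] by auto

lemma pw'_hcl:
  assumes "l \<in> L" "x \<in> hcls D l"
  shows "x \<cdot> V (pw' D l) \<in> hcl D"
proof -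
  obtain y where "y \<in> hcl D" "x = y \<cdot> V (pw D l)"
    using pw_image[OF assms(1)] assms(2) mem_r_coset[of x "hcl D" "V (pw D l)"] by auto
  then show ?thesis
    using pw_pw'[OF assms(1)] by simp
qed

text \<open>A letter is a round trip: p_l leads from H to H_l, a on to H_m, and p'_m back to
  H.\<close>

lemma psi_letter_hcl:
  assumes "l \<in> L" "a \<in> alph D" "ract D l [a] = Some m" "m \<in> L" "x \<in> hcl D"
  shows "x \<cdot> V (psi D [(l, a)]) \<in> hcl D"
    and "x \<cdot> V (psi D [(l, a)]) = x \<cdot> V (pw D l) \<cdot> V [a] \<cdot> V (pw' D m)"
proof -
  show eq: "x \<cdot> V (psi D [(l, a)]) = x \<cdot> V (pw D l) \<cdot> V [a] \<cdot> V (pw' D m)"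
    using assms pw_words hcl_S[of x] V_append[of "[a]" "pw' D m"] by (simp add: m_assoc)
  have "x \<cdot> V (pw D l) \<cdot> V [a] \<in> hcls D m"
    using ract_iff[OF assms(1) _ pw_hcls] assms by auto
  then show "x \<cdot> V (psi D [(l, a)]) \<in> hcl D"
    using eq pw'_hcl assms by simp
qed

lemma psi_hcl: "w \<in> Bwords \<Longrightarrow> x \<in> hcl D \<Longrightarrow> x \<cdot> V (psi D w) \<in> hcl D"
proof (induction w arbitrary: x)
  case Nil
  then show ?case using hcl_S by simp
next
  case (Cons b w)
  then have b: "b \<in> Bgens D" "[b] \<in> Bwords" "w \<in> Bwords"
    by auto
  have "x \<cdot> V (psi D [b]) \<in> hcl D"
    using b(1) by (rule Bgens_cases) (use Cons.prems psi_letter_hcl in blast)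
  then have "x \<cdot> V (psi D [b]) \<cdot> V (psi D w) \<in> hcl D"
    using Cons.IH b by blast
  moreover have "psi D (b # w) = psi D [b] @ psi D w"
    by (simp add: psi_def)
  ultimately show ?case
    using b psi_words hcl_S[OF Cons.prems(2)] by (simp add: m_assoc)
qed

text \<open>The product telescopes: between consecutive letters stands p'_k p_k, which acts
  trivially on H_k.\<close>

lemma psi_phi:
  "l \<in> L \<Longrightarrow> w \<in> words \<Longrightarrow> ract D l w = Some m \<Longrightarrow> x \<in> hcl D \<Longrightarrow>
    x \<cdot> V (psi D (phi D l w)) = x \<cdot> V (pw D l) \<cdot> V w \<cdot> V (pw' D m)"
proof (induction w arbitrary: l x)
  case Nil
  then show ?case
    using pw_words hcl_S pw_pw' by (auto simp: m_assoc)
next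
  case (Cons a u)
  have w: "[a] \<in> words" "u \<in> words"
    using Cons.prems by auto
  then obtain k where k: "ract D l [a] = Some k"
    using ract_prefix[of l "[a]" u] Cons.prems by auto
  then have k': "k \<in> L" "ract D k u = Some m"
    using ract_SomeD[OF k] ract_append[OF Cons.prems(1) w k] Cons.prems w by auto
  have m: "m \<in> L"
    using ract_SomeD k' w by blast
  have pu: "phi D k u \<in> Bwords"
    using phi_words k' w by blast
  have b: "[(l, a)] \<in> Bwords"
    using Cons.prems k w by (auto simp: Bgens_def)
  have x: "x \<in> S"
    using hcl_S Cons.prems by blast
  have a: "a \<in> alph D"
    using w by auto
  let ?y = "x \<cdot> V (psi D [(l, a)])"
  have y: "?y \<in> hcl D" "?y = x \<cdot> V (pw D l) \<cdot> V [a] \<cdot> V (pw' D k)"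
    using psi_letter_hcl[OF Cons.prems(1) a k k'(1) Cons.prems(4)] by auto
  have "psi D (phi D l (a # u)) = psi D [(l, a)] @ psi D (phi D k u)"
    using k by (simp add: psi_def)
  then have "V (psi D (phi D l (a # u))) = V (psi D [(l, a)]) \<cdot> V (psi D (phi D k u))"
    using V_append[OF psi_words[OF b] psi_words[OF pu]] by metis
  then have "x \<cdot> V (psi D (phi D l (a # u))) = ?y \<cdot> V (psi D (phi D k u))"
    using m_assoc[OF x V_closed[OF psi_words[OF b]] V_closed[OF psi_words[OF pu]]] by metis
  also have "\<dots> = ?y \<cdot> V (pw D k) \<cdot> V u \<cdot> V (pw' D m)"
    using Cons.IH[OF k'(1) w(2) k'(2) y(1)] .
  \<comment> \<open>The cancellation of p'_k p_k, available because the element in front of it lies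
    in H_k.\<close>
  also have "?y \<cdot> V (pw D k) = x \<cdot> V (pw D l) \<cdot> V [a]"
    unfolding y(2) using ract_iff[OF Cons.prems(1) w(1) pw_hcls[OF Cons.prems(1,4)], of k] k
    by (intro pw'_pw) simp_all
  also have "x \<cdot> V (pw D l) \<cdot> V [a] \<cdot> V u \<cdot> V (pw' D m) =
      x \<cdot> V (pw D l) \<cdot> V (a # u) \<cdot> V (pw' D m)"
    using V_append[OF w] w x pw_words Cons.prems m by (simp add: m_assoc)
  finally show ?case .
qed

lemma pihom_simps [simp]:
  "pihom D [] = []" "pihom D (b # w) = pigen D b @ pihom D w"
  "pihom D (u @ v) = pihom D u @ pihom D v"
  by (simp_all add: pihom_def)

lemma pihom_words [simp]: "w \<in> Bwords \<Longrightarrow> pihom D w \<in> words"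
  by (induction w) (auto intro: pigen_word)

lemma pigen_psi:
  assumes "b \<in> Bgens D"
  shows "V (pigen D b) \<cdot> V h = V h \<cdot> V (psi D [b])"
proof -
  obtain l a m where b: "b = (l, a)"
    by (cases b)
  have "psi D [b] \<in> words"
    using assms by (intro psi_words) auto
  moreover have "psi D [b] = pw D l @ [a] @ pw' D (the (ract D l [a]))"
    using b by simp
  moreover have "pigen D b \<in> words"
    using pigen_word assms by blast
  ultimately show ?thesis
    using pigen_val[of l a] assms hword_words b by (metis V_append)
qed

text \<open>No reversal of the word occurs: \<pi>(b) meets h only after \<pi>(w) has already crossed
  it and become \<psi>(w) on the right.\<close>

lemma pihom_psi: "w \<in> Bwords \<Longrightarrow> V (pihom D w) \<cdot> V h = V h \<cdot> V (psi D w)"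
proof (induction w)
  case Nil
  then show ?case by simp
next
  case (Cons b w)
  then have b: "b \<in> Bgens D" "w \<in> Bwords" "psi D [b] \<in> words" "pigen D b \<in> words"
    using psi_words[of "[b]"] pigen_word by auto
  have "V (pihom D (b # w)) \<cdot> V h = V (pigen D b) \<cdot> (V (pihom D w) \<cdot> V h)"
    using b by (simp add: m_assoc)
  also have "\<dots> = V (pigen D b) \<cdot> V h \<cdot> V (psi D w)"
    using b Cons.IH by (simp add: m_assoc)
  also have "\<dots> = V h \<cdot> V (psi D [b] @ psi D w)"
    using pigen_psi[OF b(1)] b by (simp add: m_assoc)
  also have "psi D [b] @ psi D w = psi D (b # w)"
    by (simp add: psi_def)
  finally show ?case .
qed

section \<open>The Schuetzenberger group\<close>

abbreviation G where "G \<equiv> schutz_group (mon D) (hcl D)"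
abbreviation Stab where "Stab \<equiv> schutz_stab (mon D) (hcl D)"
abbreviation sig where "sig \<equiv> schutz_sigma (mon D) (hcl D)"

text \<open>If x and x s both lie in H, they are R-related, and by Green's lemma H s is the H-class
  of x s, which is H.\<close>

lemma stab_iff:
  assumes "x \<in> hcl D"
  shows "s \<in> Stab \<longleftrightarrow> s \<in> S \<and> x \<cdot> s \<in> hcl D"
proof (cases "s \<in> S")
  case True
  have "hcl D #>\<^bsub>mon D\<^esub> s = hcl D" if "x \<cdot> s \<in> hcl D"
  proof -
    have "(x, x \<cdot> s) \<in> green_R (mon D)"
      using rcl_iff[OF assms] hcl_rcl[OF that] by blast
    from green_H_coset[OF hcl_class assms True this] show ?thesis
      using class_mem[OF hcl_class that] by auto
  qed
  moreover have "x \<cdot> s \<in> hcl D" if "hcl D #>\<^bsub>mon D\<^esub> s = hcl D"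
    using that assms mem_r_coset[of "x \<cdot> s" "hcl D" s] by auto
  ultimately show ?thesis
    using True by (auto simp: schutz_stab_def)
qed (simp add: schutz_stab_def)

lemma hcl_L: "x \<in> hcl D \<Longrightarrow> y \<in> hcl D \<Longrightarrow> \<exists>t\<in>S. y = t \<cdot> x"
  using class_mem[OF hcl_class] green_L_iff unfolding green_H_def by blast

text \<open>The elements of H are left multiples of one another, so agreement of two right
  translations spreads from one element to all. Consequently h alone decides equality in the
  Schuetzenberger group.\<close>

lemma translate_eq:
  assumes "x \<in> hcl D" "x \<cdot> s = x \<cdot> t" "s \<in> S" "t \<in> S" "y \<in> hcl D"
  shows "y \<cdot> s = y \<cdot> t"
proof -
  obtain c where "c \<in> S" "y = c \<cdot> x"
    using hcl_L assms by blast
  then show ?thesis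
    using assms hcl_S by (simp add: m_assoc)
qed

lemma sig_iff:
  assumes "x \<in> hcl D"
  shows "(s, t) \<in> sig \<longleftrightarrow> s \<in> Stab \<and> t \<in> Stab \<and> x \<cdot> s = x \<cdot> t"
  using translate_eq[OF assms] assms unfolding schutz_sigma_def schutz_stab_def by blast

lemma equiv_sig: "equiv Stab sig"
  by (rule equivI) (auto simp: schutz_sigma_def refl_on_def sym_def trans_def)

lemma stab_S: "s \<in> Stab \<Longrightarrow> s \<in> S"
  by (simp add: schutz_stab_def)

lemma stab_hcl: "s \<in> Stab \<Longrightarrow> x \<in> hcl D \<Longrightarrow> x \<cdot> s \<in> hcl D"
  using stab_iff by blast

lemma stab_mult: "s \<in> Stab \<Longrightarrow> t \<in> Stab \<Longrightarrow> s \<cdot> t \<in> Stab"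
proof -
  assume st: "s \<in> Stab" "t \<in> Stab"
  have "V h \<cdot> s \<cdot> t \<in> hcl D"
    using st stab_hcl hword(2) by blast
  then show ?thesis
    using stab_iff[OF hword(2)] st stab_S by (simp add: m_assoc)
qed

lemma stab_one: "\<one>\<^bsub>mon D\<^esub> \<in> Stab"
  using stab_iff[OF hword(2)] hword(2) hcl_S by simp

lemma sig_mult:
  assumes "(s, s') \<in> sig" "(t, t') \<in> sig"
  shows "(s \<cdot> t, s' \<cdot> t') \<in> sig"
proof -
  have st: "s \<in> Stab" "s' \<in> Stab" "t \<in> Stab" "t' \<in> Stab"
    using assms by (auto simp: schutz_sigma_def)
  have "V h \<cdot> s \<cdot> t = V h \<cdot> s' \<cdot> t'"
    using assms stab_hcl[OF st(1) hword(2)] hword(2) by (auto simp: schutz_sigma_def)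
  then show ?thesis
    using st stab_mult stab_S by (simp add: sig_iff[OF hword(2)] m_assoc)
qed

lemma G_mult:
  assumes "s \<in> Stab" "t \<in> Stab"
  shows "sig `` {s} \<otimes>\<^bsub>G\<^esub> sig `` {t} = sig `` {s \<cdot> t}"
proof -
  have "sig `` {s' \<cdot> t'} = sig `` {s \<cdot> t}" if "(s, s') \<in> sig" "(t, t') \<in> sig" for s' t'
    using equiv_class_eq[OF equiv_sig sig_mult[OF that]] by simp
  then have "(\<Union>s'\<in>sig `` {s}. \<Union>t'\<in>sig `` {t}. sig `` {s' \<cdot> t'}) =
      (\<Union>s'\<in>sig `` {s}. \<Union>t'\<in>sig `` {t}. sig `` {s \<cdot> t})"
    by simp
  moreover have "s \<in> sig `` {s}" "t \<in> sig `` {t}"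
    using assms by (auto simp: schutz_sigma_def)
  then have "(\<Union>s'\<in>sig `` {s}. \<Union>t'\<in>sig `` {t}. sig `` {s \<cdot> t}) = sig `` {s \<cdot> t}"
    by blast
  ultimately show ?thesis
    unfolding schutz_group_def by simp
qed

lemma monoid_G: "monoid G"
proof
  have carr: "carrier G = Stab // sig" "\<one>\<^bsub>G\<^esub> = sig `` {\<one>\<^bsub>mon D\<^esub>}"
    by (simp_all add: schutz_group_def)
  show "\<one>\<^bsub>G\<^esub> \<in> carrier G"
    unfolding carr using stab_one by (rule quotientI)
  fix x y z assume "x \<in> carrier G"
  then obtain s where s: "s \<in> Stab" "x = sig `` {s}"
    unfolding carr by (rule quotientE)
  show "\<one>\<^bsub>G\<^esub> \<otimes>\<^bsub>G\<^esub> x = x" "x \<otimes>\<^bsub>G\<^esub> \<one>\<^bsub>G\<^esub> = x"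
    unfolding carr s(2) using G_mult s(1) stab_one stab_S by auto
  assume "y \<in> carrier G"
  then obtain t where t: "t \<in> Stab" "y = sig `` {t}"
    unfolding carr by (rule quotientE)
  show "x \<otimes>\<^bsub>G\<^esub> y \<in> carrier G"
    unfolding carr s(2) t(2) using G_mult s(1) t(1) stab_mult by (auto intro: quotientI)
  assume "z \<in> carrier G"
  then obtain u where u: "u \<in> Stab" "z = sig `` {u}"
    unfolding carr by (rule quotientE)
  show "x \<otimes>\<^bsub>G\<^esub> y \<otimes>\<^bsub>G\<^esub> z = x \<otimes>\<^bsub>G\<^esub> (y \<otimes>\<^bsub>G\<^esub> z)"
    unfolding s(2) t(2) u(2) using G_mult s(1) t(1) u(1) stab_mult stab_S by (auto simp: m_assoc)
qed

lemma psi_stab: "w \<in> Bwords \<Longrightarrow> V (psi D w) \<in> Stab"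
  using stab_iff[OF hword(2)] psi_hcl[OF _ hword(2)] by simp

lemma G_word_val: "w \<in> Bwords \<Longrightarrow> word_val G (Bval D) w = sig `` {V (psi D w)}"
proof (induction w)
  case Nil
  then show ?case by (simp add: word_val_def schutz_group_def)
next
  case (Cons b w)
  then have b: "[b] \<in> Bwords" "w \<in> Bwords"
    by auto
  have "psi D (b # w) = psi D [b] @ psi D w"
    by (simp add: psi_def)
  moreover have "word_val G (Bval D) (b # w) = Bval D b \<otimes>\<^bsub>G\<^esub> word_val G (Bval D) w"
    by (simp add: word_val_def)
  ultimately show ?case
    using Cons.IH b psi_words[OF b(1)] Bval_def[of D b] by (simp add: G_mult psi_stab)
qed

lemma G_word_val_eq_iff:
  assumes "u \<in> Bwords" "v \<in> Bwords"
  shows "word_val G (Bval D) u = word_val G (Bval D) v \<longleftrightarrow>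
    V h \<cdot> V (psi D u) = V h \<cdot> V (psi D v)"
proof -
  have "word_val G (Bval D) u = word_val G (Bval D) v \<longleftrightarrow> (V (psi D u), V (psi D v)) \<in> sig"
    unfolding G_word_val[OF assms(1)] G_word_val[OF assms(2)]
    using eq_equiv_class_iff[OF equiv_sig] psi_stab assms by blast
  then show ?thesis
    using sig_iff[OF hword(2)] psi_stab assms by blast
qed

lemma G_word_val_image: "word_val G (Bval D) ` Bwords = carrier G"
proof
  show "word_val G (Bval D) ` Bwords \<subseteq> carrier G"
    using G_word_val psi_stab by (auto simp: schutz_group_def intro: quotientI)
  show "carrier G \<subseteq> word_val G (Bval D) ` Bwords"
  proof
    fix X assume "X \<in> carrier G"
    then obtain s where s: "s \<in> Stab" "X = sig `` {s}"
      by (auto simp: schutz_group_def elim: quotientE)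
    obtain w where w: "w \<in> words" "V w = s"
      using V_surj stab_S s by blast
    have r: "ract D (lone D) w = Some (lone D)"
      using ract_iff[OF lone(1) w(1), of "V h"] lone hword(2) stab_hcl s w by simp
    \<comment> \<open>Cutting w into letters along its action, starting at the index 1, gives a word
      over B; as p_1 and p'_1 are empty, \<open>psi_phi\<close> shows that it moves h exactly as s
      does.\<close>
    let ?u = "phi D (lone D) w"
    have u: "?u \<in> Bwords"
      using phi_words lone(1) w(1) r by blast
    have "V h \<cdot> V (psi D ?u) = V h \<cdot> s"
      using psi_phi[OF lone(1) w(1) r hword(2)] w pw_lone hword_words stab_S[OF s(1)] by simp
    then have "sig `` {V (psi D ?u)} = X"
      using equiv_class_eq[OF equiv_sig, of "V (psi D ?u)" s] sig_iff[OF hword(2)] psi_stab u s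
      by blast
    then show "X \<in> word_val G (Bval D) ` Bwords"
      using u G_word_val by blast
  qed
qed

end

section \<open>The map on derivation graphs\<close>

context schutz_setting
begin

lemma Jset_I: "j \<in> Jset D \<Longrightarrow> j \<in> I"
  by (simp add: Jset_def)

lemma eword_words [simp]: "eword D \<in> words"
  using eword by simp

lemma Jset_iff: "j \<in> I \<Longrightarrow> j \<in> Jset D \<longleftrightarrow> (\<exists>s\<in>S. s \<cdot> V (eword D) \<in> rcls D j)"
  unfolding Jset_def using coset_subset_rclass[OF rcls_class(1)[OF et(1)] rcls_class(1) _ et(2)]
  by blast

text \<open>J is the forward orbit of \<eta>. Its closure keeps (R2) applicable at all indices that
  arise from suffixes of words.\<close>

lemma lact_Jset:
  assumes "j \<in> Jset D" "w \<in> words" "lact D w j = Some k"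
  shows "k \<in> Jset D"
proof -
  note j = Jset_I[OF assms(1)]
  obtain s where s: "s \<in> S" "s \<cdot> V (eword D) \<in> rcls D j"
    using Jset_iff[OF j] assms by blast
  have "k \<in> I" "V w \<cdot> (s \<cdot> V (eword D)) \<in> rcls D k"
    using lact_iff[OF j assms(2) s(2)] assms by auto
  moreover have "V w \<cdot> (s \<cdot> V (eword D)) = V w \<cdot> s \<cdot> V (eword D)" "V w \<cdot> s \<in> S"
    using s assms by (simp_all add: m_assoc)
  ultimately show ?thesis
    using Jset_iff by metis
qed

lemma et_Jset: "et D \<in> Jset D"
  using Jset_iff[OF et(1)] et(2) by (auto intro!: bexI[of _ "\<one>\<^bsub>mon D\<^esub>"])

lemma rels_words: "r \<in> rels D \<Longrightarrow> rel_side r e \<in> words"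
  by (rule P.rel_side_words)

lemma V_rel: "r \<in> rels D \<Longrightarrow> V (rel_side r e) = V (rel_side r e')"
proof -
  assume r: "r \<in> rels D"
  have "V (fst r) = V (snd r)"
    using r P.R_words V_eq_iff[of "fst r" "snd r"] pres_cong.base[of "fst r" "snd r"] by auto
  then show ?thesis
    by (simp add: rel_side_def)
qed

lemma lact_cong: "V u = V v \<Longrightarrow> lact D u j = lact D v j"
  by (simp add: lact_def)

lemma ract_cong: "V u = V v \<Longrightarrow> ract D l u = ract D l v"
  by (simp add: ract_def)

text \<open>The words \<kappa>(u, j) and \<kappa>(v, j) are only known to agree after left
  multiplication by r_i. This suffices on H_l, which lies in S r_i.\<close>

lemma kappa_ract_cong:
  assumes "V u = V v" "u \<in> words" "v \<in> words" "l \<in> L" "j \<in> I" "lact D u j = Some i" "under D l i"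
    "x \<in> hcls D l"
  shows "x \<cdot> V (kappa D u j) = x \<cdot> V (kappa D v j)" "ract D l (kappa D u j) = ract D l (kappa D v j)"
proof -
  have v: "lact D v j = Some i"
    using assms lact_cong by metis
  have i: "i \<in> I"
    using lact_SomeD assms by blast
  obtain s where "s \<in> S" "x = s \<cdot> V (rword D i)"
    using under_iff[OF assms(4,8) i] assms by blast
  then show eq: "x \<cdot> V (kappa D u j) = x \<cdot> V (kappa D v j)"
    using kappa_translate[OF assms(5,2,6)] kappa_translate[OF assms(5,3) v] assms(1) by metis
  have "ract D l (kappa D u j) = Some n \<longleftrightarrow> ract D l (kappa D v j) = Some n" for n
    using ract_iff[OF assms(4) kappa_words[OF assms(5,2,6)] assms(8)]
      ract_iff[OF assms(4) kappa_words[OF assms(5,3) v] assms(8)] eq by simp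
  then show "ract D l (kappa D u j) = ract D l (kappa D v j)"
    by (metis not_None_eq)
qed

text \<open>The conditions under which \<phi>(l, \<kappa>(., j)) is defined at the vertex w. That
  \<kappa>(w, j) acts on l with nonzero result follows from these by
  \<open>under_step\<close>.\<close>

definition adm :: "'l \<Rightarrow> 'i \<Rightarrow> 'a list \<Rightarrow> bool" where
  "adm l j w \<longleftrightarrow> (\<exists>i. lact D w j = Some i \<and> under D l i)"

text \<open>The bookkeeping for a product u v: the left action consumes v first and reaches k, the
  right action consumes \<kappa>(u, k) first and reaches m. So u is treated at the pair (l, k) and v
  at the pair (m, j).\<close>

lemma adm_append:
  assumes "l \<in> L" "j \<in> I" "u \<in> words" "v \<in> words" "adm l j (u @ v)"
  obtains k m where "k \<in> I" "m \<in> L" "lact D v j = Some k" "adm l k u"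
    "lact D u k = lact D (u @ v) j" "ract D l (kappa D u k) = Some m" "adm m j v" "under D m k"
    "phi D l (kappa D (u @ v) j) = phi D l (kappa D u k) @ phi D m (kappa D v j)"
    "ract D l (kappa D (u @ v) j) = ract D m (kappa D v j)"
    "phi D l (kappa D u k) \<in> Bwords"
proof -
  from assms obtain i where i: "lact D (u @ v) j = Some i" "under D l i"
    by (auto simp: adm_def)
  obtain k where k: "lact D v j = Some k"
    using lact_suffix[OF assms(2-4)] i by auto
  have kI: "k \<in> I"
    using lact_SomeD k assms by blast
  have u: "lact D u k = Some i"
    using lact_append[OF assms(2-4) k] i by simp
  obtain m where m: "m \<in> L" "ract D l (kappa D u k) = Some m" "under D m k"
    using under_step[OF assms(1) kI assms(3) u i(2)] .
  note kw = kappa_words[OF kI assms(3) u] kappa_words[OF assms(2,4) k]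
  have "kappa D (u @ v) j = kappa D u k @ kappa D v j"
    by (rule kappa_append[OF assms(3,2,4) k])
  then have "phi D l (kappa D (u @ v) j) = phi D l (kappa D u k) @ phi D m (kappa D v j)"
    "ract D l (kappa D (u @ v) j) = ract D m (kappa D v j)"
    using phi_append[OF assms(1) kw m(2)] ract_append[OF assms(1) kw m(2)] by simp_all
  moreover have "phi D l (kappa D u k) \<in> Bwords"
    using phi_words[OF assms(1) kw(1) m(2)] .
  ultimately show ?thesis
    using that[OF kI m(1) k] i k u m by (simp add: adm_def)
qed

text \<open>The same splitting at indices that are already named; they are determined by the two
  actions.\<close>

lemma adm_append_at:
  assumes "l \<in> L" "j \<in> I" "u \<in> words" "v \<in> words" "adm l j (u @ v)"
    "lact D v j = Some k" "ract D l (kappa D u k) = Some m"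
  shows "m \<in> L" "adm l k u" "adm m j v" "under D m k"
    "phi D l (kappa D (u @ v) j) = phi D l (kappa D u k) @ phi D m (kappa D v j)"
    "ract D l (kappa D (u @ v) j) = ract D m (kappa D v j)"
proof -
  obtain k' m' where *: "m' \<in> L" "adm l k' u" "adm m' j v" "under D m' k'"
    "phi D l (kappa D (u @ v) j) = phi D l (kappa D u k') @ phi D m' (kappa D v j)"
    "ract D l (kappa D (u @ v) j) = ract D m' (kappa D v j)"
    "lact D v j = Some k'" "ract D l (kappa D u k') = Some m'"
    using adm_append[OF assms(1-5)] by blast
  then have "k' = k" "m' = m"
    using assms(6,7) by auto
  with * show "m \<in> L" "adm l k u" "adm m j v" "under D m k"
    "phi D l (kappa D (u @ v) j) = phi D l (kappa D u k) @ phi D m (kappa D v j)"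
    "ract D l (kappa D (u @ v) j) = ract D m (kappa D v j)"
    by auto
qed

lemma adm_words: "l \<in> L \<Longrightarrow> j \<in> I \<Longrightarrow> w \<in> words \<Longrightarrow> adm l j w \<Longrightarrow> phi D l (kappa D w j) \<in> Bwords"
  using adm_append[of l j w "[]"] lact_Nil[of j] by (metis append_Nil2 lists.Nil option.inject)

lemma adm_cong: "V u = V v \<Longrightarrow> adm l j u \<longleftrightarrow> adm l j v"
  using lact_cong unfolding adm_def by metis

lemma adm_ract:
  assumes "l \<in> L" "j \<in> I" "w \<in> words" "adm l j w"
  obtains m where "m \<in> L" "ract D l (kappa D w j) = Some m" "under D m j"
  using assms under_step unfolding adm_def by metis

text \<open>In the first case of the definition the translating words are empty, so the general
  formula covers it.\<close>

lemma phi_edge_eq: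
  assumes "r \<in> rels D" "\<alpha> \<in> words" "\<beta> \<in> words" "l \<in> L" "j \<in> I"
    and "lact D \<beta> j = Some k" "lact D (rel_side r e @ \<beta>) j = Some n"
    and "ract D l (kappa D \<alpha> n) = Some m" "ract D l (kappa D (\<alpha> @ rel_side r e) k) = Some m'"
  shows "phi_edge D l (Edge \<alpha> r e \<beta>) j =
    edge_act (phi D l (kappa D \<alpha> n)) (phi_elem D m r e k) (phi D m' (kappa D \<beta> j))"
  using assms by (cases "\<alpha> = [] \<and> \<beta> = []") (auto simp: Let_def)

text \<open>Both endpoints of an edge, hence both signs, give the same intermediate indices.\<close>

lemma phi_edge_data:
  assumes r: "r \<in> rels D" and w: "\<alpha> \<in> words" "\<beta> \<in> words" and l: "l \<in> L" and j: "j \<in> Jset D"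
    and a: "adm l j (\<alpha> @ rel_side r e0 @ \<beta>)"
  obtains k n m m' where "k \<in> Jset D" "n \<in> Jset D" "m \<in> L" "m' \<in> L" "lact D \<beta> j = Some k"
    "\<And>e. lact D (rel_side r e) k = Some n" "adm l n \<alpha>" "ract D l (kappa D \<alpha> n) = Some m"
    "\<And>e. adm m k (rel_side r e)" "\<And>e. ract D m (kappa D (rel_side r e) k) = Some m'"
    "\<And>e. adm l j (\<alpha> @ rel_side r e @ \<beta>)"
    "\<And>e. phi D l (kappa D (\<alpha> @ rel_side r e @ \<beta>) j) =
      phi D l (kappa D \<alpha> n) @ phi D m (kappa D (rel_side r e) k) @ phi D m' (kappa D \<beta> j)"
    "\<And>e. phi_edge D l (Edge \<alpha> r e \<beta>) j =
      edge_act (phi D l (kappa D \<alpha> n)) (phi_elem D m r e k) (phi D m' (kappa D \<beta> j))"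
    "(phi D m (kappa D (fst r) k), phi D m (kappa D (snd r) k)) \<in> U2 D"
    "phi D l (kappa D \<alpha> n) \<in> Bwords" "phi D m' (kappa D \<beta> j) \<in> Bwords"
proof -
  note jI = Jset_I[OF j]
  note rw = rels_words[OF r]
  have rbw: "rel_side r e @ \<beta> \<in> words" for e
    using rw w by simp
  obtain n m where n: "n \<in> I" "m \<in> L" "lact D (rel_side r e0 @ \<beta>) j = Some n" "adm l n \<alpha>"
    "ract D l (kappa D \<alpha> n) = Some m" "adm m j (rel_side r e0 @ \<beta>)" "under D m n"
    "phi D l (kappa D \<alpha> n) \<in> Bwords"
    using adm_append[OF l jI w(1) rbw a] by blast
  obtain k m' where k: "k \<in> I" "m' \<in> L" "lact D \<beta> j = Some k" "adm m k (rel_side r e0)"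
    "lact D (rel_side r e0) k = lact D (rel_side r e0 @ \<beta>) j"
    "ract D m (kappa D (rel_side r e0) k) = Some m'" "adm m' j \<beta>"
    using adm_append[OF n(2) jI rw w(2) n(6)] by blast
  have nJ: "n \<in> Jset D" and kJ: "k \<in> Jset D"
    using lact_Jset[OF j _ n(3)] lact_Jset[OF j w(2) k(3)] rw w by auto
  have ln: "lact D (rel_side r e) k = Some n" for e
    using k(5) n(3) lact_cong[OF V_rel[OF r]] by metis
  have lb: "lact D (rel_side r e @ \<beta>) j = Some n" for e
    using lact_append[OF jI rw w(2) k(3)] ln by simp
  obtain x where x: "x \<in> hcls D m"
    using hcls_elem n by blast
  have rm: "ract D m (kappa D (rel_side r e) k) = Some m'" for e
    using kappa_ract_cong(2)[OF V_rel[OF r] rw rw n(2) k(1) ln n(7) x] k(6) by metis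
  have adr: "adm m k (rel_side r e)" for e
    using adm_cong[OF V_rel[OF r]] k(4) by metis
  have ade: "adm l j (\<alpha> @ rel_side r e @ \<beta>)" for e
    using adm_cong[of "\<alpha> @ rel_side r e @ \<beta>" "\<alpha> @ rel_side r e0 @ \<beta>"] a V_rel[OF r, of e e0] rw w
    by simp
  have ph: "phi D l (kappa D (\<alpha> @ rel_side r e @ \<beta>) j) =
      phi D l (kappa D \<alpha> n) @ phi D m (kappa D (rel_side r e) k) @ phi D m' (kappa D \<beta> j)" for e
  proof -
    have "phi D l (kappa D (\<alpha> @ rel_side r e @ \<beta>) j) =
      phi D l (kappa D \<alpha> n) @ phi D m (kappa D (rel_side r e @ \<beta>) j)"
      by (rule adm_append_at(5)[OF l jI w(1) rbw ade lb n(5)])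
    moreover have "adm m j (rel_side r e @ \<beta>)"
      using lb n(7) by (simp add: adm_def)
    then have "phi D m (kappa D (rel_side r e @ \<beta>) j) =
      phi D m (kappa D (rel_side r e) k) @ phi D m' (kappa D \<beta> j)"
      by (rule adm_append_at(5)[OF n(2) jI rw w(2) _ k(3) rm])
    ultimately show ?thesis by simp
  qed
  have ed: "phi_edge D l (Edge \<alpha> r e \<beta>) j =
      edge_act (phi D l (kappa D \<alpha> n)) (phi_elem D m r e k) (phi D m' (kappa D \<beta> j))" for e
  proof -
    have "adm l k (\<alpha> @ rel_side r e)"
      using lact_append[OF k(1) w(1) rw ln] n(4) by (simp add: adm_def)
    then have "ract D l (kappa D (\<alpha> @ rel_side r e) k) = Some m'"
      using adm_append_at(6)[OF l k(1) w(1) rw _ ln n(5)] rm by simp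
    then show ?thesis
      using phi_edge_eq[OF r w l jI k(3) lb n(5)] by blast
  qed
  \<comment> \<open>This is where (R2) provides the edge: k lies in J, both sides of r carry k to n,
    and H_m is contained in S r_n.\<close>
  have "(phi D m (kappa D (fst r) k), phi D m (kappa D (snd r) k)) \<in> U2 D"
    unfolding U2_def mem_Collect_eq
    by (rule exI[of _ m], rule exI[of _ "fst r"], rule exI[of _ "snd r"], rule exI[of _ k])
      (use n(2,7) kJ r ln[of True] in \<open>simp add: rel_side_def\<close>)
  moreover have "phi D m' (kappa D \<beta> j) \<in> Bwords"
    using adm_words[OF k(2) jI w(2) k(7)] .
  ultimately show ?thesis
    using that[OF kJ nJ n(2) k(2,3) ln n(4,5) adr rm ade ph ed] n(8) by blast
qed

lemma graph_edgeE:
  assumes "E \<in> graph_edges (alph D) (rels D)"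
  obtains \<alpha> r e \<beta> where "E = Edge \<alpha> r e \<beta>" "\<alpha> \<in> words" "\<beta> \<in> words" "r \<in> rels D"
  using assms by (auto simp: graph_edges_def)

text \<open>Since e fixes H from the right, h \<psi>(w) e is again an element of H, and H lies in R
  = R_\<omega>.\<close>

lemma lact_h: "w \<in> Bwords \<Longrightarrow> lact D (h @ psi D w) (et D) = Some (om D)"
proof -
  assume w: "w \<in> Bwords"
  have "V h \<cdot> V (psi D w) \<in> hcl D"
    using psi_hcl w hword(2) by blast
  then have "V (h @ psi D w) \<cdot> V (eword D) \<in> rcls D (om D)"
    using eword(2) hcl_rcl om w by simp
  then show ?thesis
    using lact_iff[OF et(1) _ et(2)] w om by simp
qed

lemma under_om: "under D (lone D) (om D)"
  using under_iff[OF lone(1) _ om(1)] lone hword rword_om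
  by (metis l_one one_closed V_closed)

lemma adm_h: "w \<in> Bwords \<Longrightarrow> adm (lone D) (et D) (h @ psi D w)"
  using lact_h under_om by (auto simp: adm_def)

lemma lact_pihom: "w \<in> Bwords \<Longrightarrow> lact D (pihom D w) (om D) = Some (om D)"
proof -
  assume w: "w \<in> Bwords"
  have "V (pihom D w) \<cdot> V h \<in> hcl D"
    using psi_hcl[OF w hword(2)] pihom_psi[OF w] by simp
  then show ?thesis
    using lact_iff[OF om(1) _ rcls_elem[OF om(1)]] rword_om om hcl_rcl w by simp
qed

lemma adm_pihom: "w \<in> Bwords \<Longrightarrow> adm (lone D) (om D) (pihom D w)"
  using lact_pihom under_om by (auto simp: adm_def)

lemma h_kappa_om:
  assumes "w \<in> words" "lact D w (om D) = Some (om D)"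
  shows "V h \<cdot> V (kappa D w (om D)) = V w \<cdot> V h"
  using kappa_val[OF om(1) assms] rword_om by simp

lemma ract_pihom:
  assumes "w \<in> Bwords"
  shows "ract D (lone D) (kappa D (pihom D w) (om D)) = Some (lone D)"
proof -
  have "V h \<cdot> V (kappa D (pihom D w) (om D)) \<in> hcl D"
    using h_kappa_om[OF _ lact_pihom[OF assms]] psi_hcl[OF assms hword(2)] pihom_psi[OF assms] assms
    by simp
  then show ?thesis
    using ract_iff[OF lone(1) kappa_words[OF om(1) _ lact_pihom[OF assms]], of "V h"] lone hword(2)
      assms by simp
qed

lemma phi_om_words: "w \<in> Bwords \<Longrightarrow> phi_om D (pihom D w) \<in> Bwords"
  unfolding phi_om_def using adm_words[OF lone(1) om(1) _ adm_pihom] by simp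

text \<open>Soundness of (R3): as r_\<omega> is h, the word \<kappa>(\<pi>(w), \<omega>) satisfies h
  \<kappa>(\<pi>(w), \<omega>) = \<pi>(w) h = h \<psi>(w).\<close>

lemma phi_om_val: "w \<in> Bwords \<Longrightarrow> V h \<cdot> V (psi D (phi_om D (pihom D w))) = V h \<cdot> V (psi D w)"
proof -
  assume w: "w \<in> Bwords"
  let ?k = "kappa D (pihom D w) (om D)"
  have k: "?k \<in> words"
    using kappa_words[OF om(1) _ lact_pihom[OF w]] w by simp
  have "V h \<cdot> V (psi D (phi_om D (pihom D w))) = V h \<cdot> V ?k"
    unfolding phi_om_def using psi_phi[OF lone(1) k ract_pihom[OF w] hword(2)] pw_lone k by simp
  then show ?thesis
    using h_kappa_om[OF _ lact_pihom[OF w]] pihom_psi w by simp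
qed

lemma phi_h_et_words: "phi D (lone D) (kappa D h (et D)) \<in> Bwords"
  using adm_words[OF lone(1) et(1) _ adm_h[of "[]"]] by simp

text \<open>Soundness of (R4): with r_\<omega> = h and r_\<eta> = e one gets h \<kappa>(h, \<eta>) =
  h e = h.\<close>

lemma phi_h_et_val: "V h \<cdot> V (psi D (phi D (lone D) (kappa D h (et D)))) = V h"
proof -
  have l: "lact D h (et D) = Some (om D)"
    using lact_h[of "[]"] by simp
  let ?k = "kappa D h (et D)"
  have k: "?k \<in> words"
    using kappa_words[OF et(1) _ l] by simp
  have val: "V h \<cdot> V ?k = V h"
    using kappa_val[OF et(1) _ l] rword_om rword_et eword(2)[OF hword(2)] by simp
  then have "ract D (lone D) ?k = Some (lone D)"
    using ract_iff[OF lone(1) k, of "V h"] lone hword(2) by simp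
  then show ?thesis
    using psi_phi[OF lone(1) k _ hword(2)] pw_lone k val by simp
qed

lemma Urels_sound:
  assumes "(u, v) \<in> Urels D"
  shows "u \<in> Bwords \<and> v \<in> Bwords \<and> V h \<cdot> V (psi D u) = V h \<cdot> V (psi D v)"
  using assms unfolding Urels_def
proof (elim UnE)
  assume "(u, v) \<in> U1 D"
  then obtain l p q where *: "u = phi D l p" "v = phi D l q" "l \<in> L" "(p, q) \<in> rels D"
    "ract D l p \<noteq> None"
    by (auto simp: U1_def)
  then obtain m where m: "ract D l p = Some m"
    by auto
  have w: "p \<in> words" "q \<in> words" "V p = V q"
    using V_rel[OF *(4), of True False] rels_words[OF *(4)]
    by (auto simp: rel_side_def split: if_splits) (metis fst_conv snd_conv)+
  then have "ract D l q = Some m"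
    using m ract_cong by metis
  then show ?thesis
    using psi_phi[OF *(3) w(1) m hword(2)] psi_phi[OF *(3) w(2) _ hword(2)] w
      phi_words[OF *(3)] m by (auto simp: *(1,2))
next
  assume "(u, v) \<in> U2 D"
  then obtain l j p q where *: "u = phi D l (kappa D p j)" "v = phi D l (kappa D q j)" "l \<in> L"
    "j \<in> Jset D" "(p, q) \<in> rels D" "lact D p j \<noteq> None" "under D l (the (lact D p j))"
    by (auto simp: U2_def)
  then obtain i where i: "lact D p j = Some i" "under D l i"
    by auto
  note jI = Jset_I[OF *(4)]
  have w: "p \<in> words" "q \<in> words" "V p = V q"
    using V_rel[OF *(5), of True False] rels_words[OF *(5)]
    by (auto simp: rel_side_def split: if_splits) (metis fst_conv snd_conv)+
  have q: "lact D q j = Some i"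
    using i w lact_cong by metis
  \<comment> \<open>By \<open>psi_phi\<close> both sides move h to this element of H_l, followed by
    one of the two \<kappa>-words and a common p'_m; on H_l the \<kappa>-words act alike.\<close>
  let ?x = "V h \<cdot> V (pw D l)"
  have x: "?x \<in> hcls D l"
    using pw_hcls[OF *(3) hword(2)] .
  note cong = kappa_ract_cong[OF w(3,1,2) *(3) jI i x]
  have k: "kappa D p j \<in> words" "kappa D q j \<in> words"
    using kappa_words[OF jI w(1) i(1)] kappa_words[OF jI w(2) q] by auto
  obtain m where m: "ract D l (kappa D p j) = Some m"
    using under_step[OF *(3) jI w(1) i] .
  then show ?thesis
    using psi_phi[OF *(3) k(1) m hword(2)] psi_phi[OF *(3) k(2) _ hword(2)] cong
      phi_words[OF *(3) k(1) m] phi_words[OF *(3) k(2)] by (auto simp: *(1,2))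
next
  assume "(u, v) \<in> U3 D"
  then obtain b where b: "u = [b]" "v = phi_om D (pihom D [b])" "b \<in> Bgens D"
    by (auto simp: U3_def)
  then have "[b] \<in> Bwords"
    by simp
  then show ?thesis
    unfolding b using phi_om_words phi_om_val by metis
next
  assume "(u, v) \<in> U4 D"
  then show ?thesis
    using phi_h_et_words phi_h_et_val hcl_S[OF hword(2)] by (simp add: U4_def)
qed

sublocale Q: word_relations "Bgens D" "Urels D"
  using Urels_sound by unfold_locales auto

section \<open>\<phi> as a map of derivation graphs and its behaviour under translation\<close>

lemma phi_edge_graph:
  assumes "E \<in> graph_edges (alph D) (rels D)" "l \<in> L" "j \<in> Jset D" "adm l j (edge_init E)"
  shows "adm l j (edge_term E) \<and> phi_edge D l E j \<in> graph_edges (Bgens D) (Urels D) \<and>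
    edge_init (phi_edge D l E j) = phi D l (kappa D (edge_init E) j) \<and>
    edge_term (phi_edge D l E j) = phi D l (kappa D (edge_term E) j) \<and>
    phi_edge D l (edge_inv E) j = edge_inv (phi_edge D l E j)"
proof -
  from assms(1) obtain \<alpha> r e \<beta> where E: "E = Edge \<alpha> r e \<beta>" "\<alpha> \<in> words" "\<beta> \<in> words" "r \<in> rels D"
    by (rule graph_edgeE)
  then have a: "adm l j (\<alpha> @ rel_side r e @ \<beta>)"
    using assms by simp
  obtain k n m m' where d:
    "\<And>e. adm l j (\<alpha> @ rel_side r e @ \<beta>)"
    "\<And>e. phi D l (kappa D (\<alpha> @ rel_side r e @ \<beta>) j) =
      phi D l (kappa D \<alpha> n) @ phi D m (kappa D (rel_side r e) k) @ phi D m' (kappa D \<beta> j)"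
    "\<And>e. phi_edge D l (Edge \<alpha> r e \<beta>) j =
      edge_act (phi D l (kappa D \<alpha> n)) (phi_elem D m r e k) (phi D m' (kappa D \<beta> j))"
    "(phi D m (kappa D (fst r) k), phi D m (kappa D (snd r) k)) \<in> U2 D"
    "phi D l (kappa D \<alpha> n) \<in> Bwords" "phi D m' (kappa D \<beta> j) \<in> Bwords"
    using phi_edge_data[OF E(4,2,3) assms(2,3) a] by metis
  have side: "rel_side (phi D m (kappa D (fst r) k), phi D m (kappa D (snd r) k)) e' =
      phi D m (kappa D (rel_side r e') k)" for e'
    by (simp add: rel_side_def)
  show ?thesis
    unfolding E(1) using d by (simp add: phi_elem_def side Urels_def)
qed

text \<open>Whether the context of the relation is removed at once or in two stages, the same
  elementary edge remains, because the inner indices reached are the same; the outer words then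
  concatenate.\<close>

lemma phi_edge_act:
  assumes E: "E \<in> graph_edges (alph D) (rels D)" and ab: "a \<in> words" "b \<in> words"
    and l: "l \<in> L" and j: "j \<in> Jset D" and adm: "adm l j (a @ edge_init E @ b)"
    and k: "lact D b j = Some k" and n: "lact D (edge_init E) k = Some n"
    and m: "ract D l (kappa D a n) = Some m" and m': "ract D m (kappa D (edge_init E) k) = Some m'"
  shows "phi_edge D l (edge_act a E b) j =
    edge_act (phi D l (kappa D a n)) (phi_edge D m E k) (phi D m' (kappa D b j))"
proof -
  from E obtain \<alpha> r e \<beta> where E': "E = Edge \<alpha> r e \<beta>" "\<alpha> \<in> words" "\<beta> \<in> words" "r \<in> rels D"
    by (rule graph_edgeE)
  note jI = Jset_I[OF j]
  have kJ: "k \<in> Jset D"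
    using lact_Jset j ab k by blast
  note kI = Jset_I[OF kJ]
  have Ew: "edge_init E \<in> words"
    using P.edge_words E by blast
  have lEb: "lact D (edge_init E @ b) j = Some n"
    using lact_append[OF jI Ew ab(2) k] n by simp
  have nI: "n \<in> I"
    using lact_SomeD[OF n kI Ew] .
  have Ebw: "edge_init E @ b \<in> words"
    using Ew ab by simp
  note mL = adm_append_at(1,4,2)[OF l jI ab(1) Ebw adm lEb m]
  have admE: "adm m k (edge_init E)"
    using n mL by (simp add: adm_def)
  have 1: "adm l j ((a @ \<alpha>) @ rel_side r e @ (\<beta> @ b))"
    using adm E' by simp
  obtain k1 n1 m1 m1' where d1: "k1 \<in> Jset D" "n1 \<in> Jset D" "lact D (\<beta> @ b) j = Some k1"
    "lact D (rel_side r e) k1 = Some n1" "adm l n1 (a @ \<alpha>)"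
    "ract D l (kappa D (a @ \<alpha>) n1) = Some m1" "m1 \<in> L" "m1' \<in> L"
    "ract D m1 (kappa D (rel_side r e) k1) = Some m1'"
    "phi_edge D l (Edge (a @ \<alpha>) r e (\<beta> @ b)) j =
      edge_act (phi D l (kappa D (a @ \<alpha>) n1)) (phi_elem D m1 r e k1) (phi D m1' (kappa D (\<beta> @ b) j))"
    using phi_edge_data[OF E'(4) _ _ l j 1] E' ab by (metis append_in_lists_conv)
  have 2: "adm m k (\<alpha> @ rel_side r e @ \<beta>)"
    using admE E' by simp
  obtain k2 n2 m2 m2' where d2: "k2 \<in> Jset D" "n2 \<in> Jset D" "lact D \<beta> k = Some k2"
    "lact D (rel_side r e) k2 = Some n2" "adm m n2 \<alpha>"
    "ract D m (kappa D \<alpha> n2) = Some m2" "m2 \<in> L" "m2' \<in> L"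
    "ract D m2 (kappa D (rel_side r e) k2) = Some m2'"
    "phi_edge D m (Edge \<alpha> r e \<beta>) k =
      edge_act (phi D m (kappa D \<alpha> n2)) (phi_elem D m2 r e k2) (phi D m2' (kappa D \<beta> k))"
    using phi_edge_data[OF E'(4,2,3) mL(1) kJ 2] by metis
  have rw: "rel_side r e \<in> words"
    using rels_words E' by blast
  have k12: "k1 = k2"
    using lact_append[OF jI E'(3) ab(2) k] d1(3) d2(3) by simp
  have n12: "n1 = n2"
    using d1(4) d2(4) k12 by simp
  note n2I = Jset_I[OF d2(2)]
  have lan: "lact D \<alpha> n2 = Some n"
  proof -
    have "lact D (rel_side r e @ \<beta>) k = Some n2"
      using lact_append[OF kI rw E'(3) d2(3)] d2(4) by simp
    from lact_append[OF kI E'(2) _ this] show ?thesis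
      using n E' rw by simp
  qed
  have "adm l n2 (a @ \<alpha>)"
    using d1(5) n12 by simp
  note pa = adm_append_at(5,6)[OF l n2I ab(1) E'(2) this lan m]
  have m12: "m1 = m2"
    using pa(2) d1(6) d2(6) n12 by simp
  have m12': "m1' = m2'"
    using d1(9) d2(9) k12 m12 by simp
  have rbw: "rel_side r e @ \<beta> \<in> words"
    using rw E' by simp
  have lrb: "lact D (rel_side r e @ \<beta>) k = Some n2"
    using lact_append[OF kI rw E'(3) d2(3)] d2(4) by simp
  note mid = adm_append_at[OF mL(1) kI E'(2) rbw 2 lrb d2(6)]
  note mid(6)
  also have "ract D m2 (kappa D (rel_side r e @ \<beta>) k) = ract D m2' (kappa D \<beta> k)"
    by (rule adm_append_at(6)[OF d2(7) kI rw E'(3) mid(3) d2(3,9)])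
  finally have rb: "ract D m2' (kappa D \<beta> k) = Some m'"
    using m' E' by simp
  have pb: "phi D m2' (kappa D (\<beta> @ b) j) = phi D m2' (kappa D \<beta> k) @ phi D m' (kappa D b j)"
    using phi_append[OF d2(8) kappa_words[OF kI E'(3) d2(3)] kappa_words[OF jI ab(2) k] rb]
      kappa_append[OF E'(3) jI ab(2) k] by simp
  show ?thesis
    using d1(10) d2(10) pa(1) pb by (simp add: E'(1) k12 n12 m12 m12')
qed

lemma phi_map:
  assumes "l \<in> L" "j \<in> Jset D"
  shows "derivation_graph_map (alph D) (rels D) (Bgens D) (Urels D) (adm l j)
    (\<lambda>w. phi D l (kappa D w j)) (\<lambda>E. phi_edge D l E j)"
  using adm_words[OF assms(1) Jset_I[OF assms(2)]] phi_edge_graph[OF _ assms]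
  by unfold_locales blast+

lemma phi_path_fp:
  assumes "l \<in> L" "j \<in> Jset D"
  shows "phi_path D l P j =
    derivation_graph_map.fp (\<lambda>w. phi D l (kappa D w j)) (\<lambda>E. phi_edge D l E j) P"
  unfolding derivation_graph_map.fp_def[OF phi_map[OF assms]] phi_path_def ..

lemma phi_path_from_to:
  assumes "l \<in> L" "j \<in> Jset D" "path_from_to (alph D) (rels D) P u v" "adm l j u"
  shows "path_from_to (Bgens D) (Urels D) (phi_path D l P j)
    (phi D l (kappa D u j)) (phi D l (kappa D v j))" "adm l j v"
proof -
  have P: "is_dpath (alph D) (rels D) P" "fst P = u" "path_term P = v"
    using assms(3) by (auto simp: path_from_to_def)
  then show "path_from_to (Bgens D) (Urels D) (phi_path D l P j)
    (phi D l (kappa D u j)) (phi D l (kappa D v j))" "adm l j v"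
    using derivation_graph_map.fp_path[OF phi_map[OF assms(1,2)] P(1)] assms(4)
    by (simp_all add: path_from_to_def phi_path_fp[OF assms(1,2), symmetric])
      (simp add: phi_path_def)
qed

lemma phi_path_inv:
  assumes "l \<in> L" "j \<in> Jset D" "is_dpath (alph D) (rels D) P" "adm l j (fst P)"
  shows "phi_path D l (path_inv P) j = path_inv (phi_path D l P j)"
  using derivation_graph_map.fp_inv[OF phi_map[OF assms(1,2)] assms(3,4)]
  by (simp add: phi_path_fp assms)

lemma phi_path_comp: "phi_path D l (P \<circ>\<^sub>p Q) j = phi_path D l P j \<circ>\<^sub>p phi_path D l Q j"
  by (simp add: phi_path_def path_comp_def)

text \<open>All vertices of \<open>P\<close> represent one element of S, so the indices k, n, m, m'
  found at the first vertex serve every edge.\<close>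

lemma phi_path_act:
  assumes P: "is_dpath (alph D) (rels D) P" and ab: "a \<in> words" "b \<in> words"
    and l: "l \<in> L" and j: "j \<in> Jset D" and adm: "adm l j (a @ fst P @ b)"
    and k: "lact D b j = Some k" and n: "lact D (fst P) k = Some n"
    and m: "ract D l (kappa D a n) = Some m" and m': "ract D m (kappa D (fst P) k) = Some m'"
  shows "phi_path D l (path_act a P b) j =
    path_act (phi D l (kappa D a n)) (phi_path D m P k) (phi D m' (kappa D b j))"
proof -
  note jI = Jset_I[OF j]
  have kJ: "k \<in> Jset D"
    using lact_Jset j ab k by blast
  note kI = Jset_I[OF kJ]
  have edges: "map (\<lambda>F. phi_edge D l F j) (map (\<lambda>E. edge_act a E b) es) =
    map (\<lambda>F. edge_act (phi D l (kappa D a n)) F (phi D m' (kappa D b j)))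
      (map (\<lambda>F. phi_edge D m F k) es)"
    if "is_dpath (alph D) (rels D) (w, es)" "adm l j (a @ w @ b)" "lact D w k = Some n"
      "ract D m (kappa D w k) = Some m'" for w es
    using that
  proof (induction es arbitrary: w)
    case (Cons E es)
    then have E: "E \<in> graph_edges (alph D) (rels D)" "w = edge_init E"
      "is_dpath (alph D) (rels D) (edge_term E, es)"
      by auto
    have w: "edge_init E \<in> words" "edge_term E \<in> words"
      using P.edge_words E by auto
    have V: "V (edge_init E) = V (edge_term E)"
      using V_eq_iff[OF w] P.edge_pres_cong[OF E(1)] by blast
    have "lact D (edge_init E @ b) j = Some n"
      using lact_append[OF jI w(1) ab(2) k] Cons.prems E by simp
    then have mL: "m \<in> L" "under D m n"
      using adm_append_at(1,4)[OF l jI ab(1) _ _ _ m] w ab E Cons.prems(2) by auto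
    obtain x where x: "x \<in> hcls D m"
      using hcls_elem mL by blast
    have "adm l j (a @ edge_term E @ b)"
      using adm_cong[of "a @ edge_init E @ b" "a @ edge_term E @ b"] V w ab Cons.prems E by simp
    moreover have "lact D (edge_term E) k = Some n"
      using lact_cong[OF V] Cons.prems E by simp
    moreover have "ract D m (kappa D (edge_term E) k) = Some m'"
      using kappa_ract_cong(2)[OF V w mL(1) kI _ mL(2) x] Cons.prems E by simp
    ultimately have "map (\<lambda>F. phi_edge D l F j) (map (\<lambda>E. edge_act a E b) es) =
      map (\<lambda>F. edge_act (phi D l (kappa D a n)) F (phi D m' (kappa D b j)))
        (map (\<lambda>F. phi_edge D m F k) es)"
      using Cons.IH E by blast
    then show ?case
      using phi_edge_act[OF E(1) ab l j _ k _ m] Cons.prems E by simp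
  qed simp
  have w: "fst P \<in> words"
    using P P.is_dpath_init by blast
  have lb: "lact D (fst P @ b) j = Some n"
    using lact_append[OF jI w ab(2) k] n by simp
  have "fst P @ b \<in> words"
    using w ab by simp
  note mL = adm_append_at(1,3,5)[OF l jI ab(1) this adm lb m]
  have "phi D m (kappa D (fst P @ b) j) = phi D m (kappa D (fst P) k) @ phi D m' (kappa D b j)"
    by (rule adm_append_at(5)[OF mL(1) jI w ab(2) mL(2) k m'])
  then show ?thesis
    using edges[of "fst P" "snd P"] P adm n m' mL(3) by (simp add: phi_path_def path_act_def)
qed

section \<open>The presentation\<close>

lemma path_V: "path_from_to (alph D) (rels D) P u v \<Longrightarrow> V u = V v"
  using V_eq_iff[of u v] P.pres_cong_iff_path[of u v] P.path_from_to_words[of P u v] by blast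

lemma V_path: "V u = V v \<Longrightarrow> u \<in> words \<Longrightarrow> v \<in> words \<Longrightarrow> \<exists>P. path_from_to (alph D) (rels D) P u v"
  using V_eq_iff P.pres_cong_iff_path by blast

lemma lact_pihom_append:
  "u \<in> Bwords \<Longrightarrow> w \<in> words \<Longrightarrow> lact D w j = Some (om D) \<Longrightarrow> j \<in> I \<Longrightarrow>
    lact D (pihom D u @ w) j = Some (om D)"
  using lact_append[of j "pihom D u" w "om D"] lact_pihom by simp

lemma adm_om: "lact D w j = Some (om D) \<Longrightarrow> adm (lone D) j w"
  using under_om by (simp add: adm_def)

text \<open>Left multiplication by \<pi>(u) fixes \<omega>, and right multiplication by
  \<kappa>(\<pi>(u), \<omega>) fixes the index 1. A prefix \<pi>(u) therefore splits off without
  influencing what follows.\<close>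

lemma phi_pihom_append:
  assumes "u \<in> Bwords" "w \<in> words" "lact D w j = Some (om D)" "j \<in> I"
  shows "phi D (lone D) (kappa D (pihom D u @ w) j) =
    phi_om D (pihom D u) @ phi D (lone D) (kappa D w j)"
  unfolding phi_om_def
  using adm_append_at(5)[OF lone(1) assms(4) _ assms(2) _ assms(3) ract_pihom]
    adm_om lact_pihom_append assms by simp

lemma phi_om_append:
  "u \<in> Bwords \<Longrightarrow> v \<in> Bwords \<Longrightarrow>
    phi_om D (pihom D u @ pihom D v) = phi_om D (pihom D u) @ phi_om D (pihom D v)"
  using phi_pihom_append[of u "pihom D v" "om D"] lact_pihom om by (simp add: phi_om_def)

lemma phi_path_pihom:
  assumes "u \<in> Bwords" "is_dpath (alph D) (rels D) P" "lact D (fst P) (et D) = Some (om D)"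
  shows "phi_path D (lone D) (path_act (pihom D u) P []) (et D) =
    path_act (phi_om D (pihom D u)) (phi_path D (lone D) P (et D)) []"
proof -
  have w: "fst P \<in> words"
    using P.is_dpath_init assms by blast
  obtain m where "ract D (lone D) (kappa D (fst P) (et D)) = Some m"
    using adm_ract[OF lone(1) et(1) w adm_om[OF assms(3)]] .
  then show ?thesis
    using phi_path_act[OF assms(2) _ _ lone(1) et_Jset _ _ assms(3) ract_pihom[OF assms(1)],
        of "[]" m] assms et(1) adm_om[OF lact_pihom_append[OF assms(1) w assms(3)]]
    by (simp add: phi_om_def)
qed

text \<open>Any path with these ends serves; one is chosen per letter so that \<open>theta\<close>
  becomes a function.\<close>

definition connector :: "'l \<times> 'a \<Rightarrow> 'a dpath" where
  "connector b = (SOME P. path_from_to (alph D) (rels D) P (pihom D [b] @ h) (h @ psi D [b]))"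

lemma connector:
  assumes "b \<in> Bgens D"
  shows "path_from_to (alph D) (rels D) (connector b) (pihom D [b] @ h) (h @ psi D [b])"
proof -
  have b: "[b] \<in> Bwords"
    using assms by simp
  have w: "pihom D [b] \<in> words" "psi D [b] \<in> words"
    using pihom_words[OF b] psi_words[OF b] .
  have "V (pihom D [b] @ h) = V (h @ psi D [b])"
    using pihom_psi[OF b] V_append[OF w(1) hword_words] V_append[OF hword_words w(2)] by metis
  then have "\<exists>P. path_from_to (alph D) (rels D) P (pihom D [b] @ h) (h @ psi D [b])"
    using w hword_words by (intro V_path) (auto simp del: psi_simps pihom_simps)
  then show ?thesis
    unfolding connector_def by (rule someI_ex)
qed

text \<open>\<open>target w\<close> and \<open>theta w\<close> are the word \<open>T(w)\<close> and the path \<open>\<Theta>\<^sub>w\<close> of the introduction.\<close>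

definition target :: "('l \<times> 'a) list \<Rightarrow> ('l \<times> 'a) list" where
  "target w = phi D (lone D) (kappa D (h @ psi D w) (et D))"

definition lift :: "'a dpath \<Rightarrow> ('l \<times> 'a) dpath" where
  "lift P = phi_path D (lone D) P (et D)"

primrec theta :: "('l \<times> 'a) list \<Rightarrow> ('l \<times> 'a) dpath" where
  "theta [] = edge_path (elem_edge ([], phi D (lone D) (kappa D h (et D))) True)"
| "theta (b # w) = path_act [] (edge_path (B_edge D b)) w \<circ>\<^sub>p
    path_act (phi_om D (pihom D [b])) (theta w) [] \<circ>\<^sub>p lift (path_act [] (connector b) (psi D w))"

lemma psi_Cons: "psi D (b # w) = psi D [b] @ psi D w"
  by (simp add: psi_def)

lemma lift_from_to:
  assumes "path_from_to (alph D) (rels D) P u v" "lact D u (et D) = Some (om D)"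
  shows "path_from_to (Bgens D) (Urels D) (lift P)
    (phi D (lone D) (kappa D u (et D))) (phi D (lone D) (kappa D v (et D)))"
  unfolding lift_def by (rule phi_path_from_to[OF lone(1) et_Jset assms(1) adm_om[OF assms(2)]])

lemma lift_target:
  assumes "path_from_to (alph D) (rels D) P (h @ psi D u) (h @ psi D v)" "u \<in> Bwords"
  shows "path_from_to (Bgens D) (Urels D) (lift P) (target u) (target v)"
  unfolding target_def by (rule lift_from_to[OF assms(1) lact_h[OF assms(2)]])

lemma lift_comp: "lift (P \<circ>\<^sub>p Q) = lift P \<circ>\<^sub>p lift Q"
  by (simp add: lift_def phi_path_comp)

lemma lift_inv:
  assumes "is_dpath (alph D) (rels D) P" "lact D (fst P) (et D) = Some (om D)"
  shows "lift (path_inv P) = path_inv (lift P)"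
  unfolding lift_def by (rule phi_path_inv[OF lone(1) et_Jset assms(1) adm_om[OF assms(2)]])

lemma lift_pihom:
  assumes "u \<in> Bwords" "path_from_to (alph D) (rels D) P v v'" "lact D v (et D) = Some (om D)"
  shows "lift (path_act (pihom D u) P []) = path_act (phi_om D (pihom D u)) (lift P) []"
  unfolding lift_def using phi_path_pihom[OF assms(1)] assms(2,3) by (simp add: path_from_to_def)

lemma phi_pihom_h:
  "u \<in> Bwords \<Longrightarrow> w \<in> Bwords \<Longrightarrow> phi D (lone D) (kappa D (pihom D u @ h @ psi D w) (et D)) =
    phi_om D (pihom D u) @ target w"
  unfolding target_def using phi_pihom_append[OF _ _ lact_h et(1)] by simp

lemma B_edge_path:
  "b \<in> Bgens D \<Longrightarrow>
    path_from_to (Bgens D) (Urels D) (edge_path (B_edge D b)) [b] (phi_om D (pihom D [b]))"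
proof -
  assume "b \<in> Bgens D"
  then have "([b], phi_om D (pihom D [b])) \<in> Urels D"
    unfolding Urels_def U3_def by blast
  then show ?thesis
    unfolding B_edge_def by (simp add: path_from_to_def rel_side_def del: pihom_simps)
qed

lemma connector_psi:
  assumes "b \<in> Bgens D" "w \<in> Bwords"
  shows "path_from_to (alph D) (rels D) (path_act [] (connector b) (psi D w))
    (pihom D [b] @ h @ psi D w) (h @ psi D (b # w))"
  using path_from_to_act[OF connector[OF assms(1)], of "[]" "psi D w"] assms(2)
  by (simp add: psi_Cons[of b w] del: psi_simps pihom_simps)

lemma lift_connector:
  assumes "b \<in> Bgens D" "w \<in> Bwords"
  shows "path_from_to (Bgens D) (Urels D) (lift (path_act [] (connector b) (psi D w)))
    (phi_om D (pihom D [b]) @ target w) (target (b # w))"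
proof -
  have b: "[b] \<in> Bwords"
    using assms by simp
  show ?thesis
    using lift_from_to[OF connector_psi[OF assms] lact_pihom_append[OF b _ lact_h[OF assms(2)] et(1)]]
      phi_pihom_h[OF b assms(2)] assms(2) by (simp add: target_def del: psi_simps pihom_simps)
qed

lemma theta_path: "w \<in> Bwords \<Longrightarrow> path_from_to (Bgens D) (Urels D) (theta w) w (target w)"
proof (induction w)
  case Nil
  have "([], phi D (lone D) (kappa D h (et D))) \<in> Urels D"
    unfolding Urels_def U4_def by blast
  then show ?case
    by (simp add: path_from_to_def rel_side_def target_def)
next
  case (Cons b w)
  then have b: "b \<in> Bgens D" "[b] \<in> Bwords" "w \<in> Bwords"
    by auto
  have "path_from_to (Bgens D) (Urels D) (path_act [] (edge_path (B_edge D b)) w)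
      (b # w) (phi_om D (pihom D [b]) @ w)"
    using path_from_to_act[OF B_edge_path[OF b(1)], of "[]" w] b by simp
  moreover have "path_from_to (Bgens D) (Urels D) (path_act (phi_om D (pihom D [b])) (theta w) [])
      (phi_om D (pihom D [b]) @ w) (phi_om D (pihom D [b]) @ target w)"
    using path_from_to_act[OF Cons.IH[OF b(3)], of "phi_om D (pihom D [b])" "[]"]
      phi_om_words[OF b(2)] by simp
  ultimately show ?case
    unfolding theta.simps by (rule Q.path_from_to_comp[OF _ Q.path_from_to_comp[OF _ lift_connector[OF b(1,3)]]])
qed

lemma G_presentation: "defined_by_pres G (Bval D) (Bgens D) (Urels D)"
  unfolding defined_by_pres_def
proof (intro conjI ballI)
  show "monoid G"
    by (rule monoid_G)
  show "Urels D \<subseteq> Bwords \<times> Bwords"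
    by (rule Q.R_words)
  show "Bval D \<in> Bgens D \<rightarrow> carrier G"
  proof
    fix b assume "b \<in> Bgens D"
    then show "Bval D b \<in> carrier G"
      using psi_stab[of "[b]"] by (simp add: Bval_def schutz_group_def quotientI)
  qed
  show "word_val G (Bval D) ` Bwords = carrier G"
    by (rule G_word_val_image)
  fix u v assume uv: "u \<in> Bwords" "v \<in> Bwords"
  have "V h \<cdot> V (psi D u) = V h \<cdot> V (psi D v)" if "(u, v) \<in> pres_cong (Bgens D) (Urels D)"
    using that
  proof (induction rule: pres_cong.induct)
    case (base u v)
    then show ?case using Urels_sound by blast
  next
    case (mult u v x y)
    have w: "u \<in> Bwords" "v \<in> Bwords" "x \<in> Bwords" "y \<in> Bwords"
      using Q.pres_cong_words mult.hyps by blast+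
    \<comment> \<open>The left factor is exchanged at h itself; the right factor is exchanged at h
      \<psi>(v), where the agreement known at h is available by \<open>translate_eq\<close>.\<close>
    have "V h \<cdot> V (psi D u) \<cdot> V (psi D x) = V h \<cdot> V (psi D v) \<cdot> V (psi D y)"
      using translate_eq[OF hword(2) mult.IH(2) _ _ psi_hcl[OF w(2) hword(2)]] mult.IH(1) w by simp
    then show ?case
      using w hcl_S[OF hword(2)] by (simp add: m_assoc)
  qed auto
  moreover have "(u, v) \<in> pres_cong (Bgens D) (Urels D)"
    if eq: "V h \<cdot> V (psi D u) = V h \<cdot> V (psi D v)"
  proof -
    have "V (h @ psi D u) = V (h @ psi D v)"
      using eq uv by simp
    then obtain P where "path_from_to (alph D) (rels D) P (h @ psi D u) (h @ psi D v)"
      using V_path uv by (metis append_in_lists_conv hword_words psi_words)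
    then have "path_from_to (Bgens D) (Urels D) (lift P) (target u) (target v)"
      using lift_target uv by blast
    then have "path_from_to (Bgens D) (Urels D) (theta u \<circ>\<^sub>p lift P \<circ>\<^sub>p path_inv (theta v)) u v"
      using Q.path_from_to_comp Q.path_from_to_inv theta_path uv by metis
    then show ?thesis
      using Q.pres_cong_iff_path by blast
  qed
  ultimately show "(word_val G (Bval D) u = word_val G (Bval D) v) =
    ((u, v) \<in> pres_cong (Bgens D) (Urels D))"
    using G_word_val_eq_iff[OF uv] by blast
qed

section \<open>The homotopy base\<close>

lemma Lam_path_simps:
  "Lam_path D [] = ([], [])"
  "Lam_path D (b # u) = path_down (edge_path (B_edge D b)) (Lam_path D u)"
  by (simp_all add: Lam_path_def)

lemma Lam_path_from_to:
  "u \<in> Bwords \<Longrightarrow> path_from_to (Bgens D) (Urels D) (Lam_path D u) u (phi_om D (pihom D u))"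
proof (induction u)
  case Nil
  then show ?case by (simp add: Lam_path_simps path_from_to_def phi_om_def)
next
  case (Cons b u)
  then have b: "b \<in> Bgens D" "[b] \<in> Bwords" "u \<in> Bwords"
    by auto
  note IH = Cons.IH[OF b(3)] and B = B_edge_path[OF b(1)]
  have "path_from_to (Bgens D) (Urels D)
      (path_act [] (edge_path (B_edge D b)) u \<circ>\<^sub>p path_act (phi_om D (pihom D [b])) (Lam_path D u) [])
      ([b] @ u) (phi_om D (pihom D [b]) @ phi_om D (pihom D u))"
    using Q.path_from_to_comp path_from_to_act[OF B, of "[]" u]
      path_from_to_act[OF IH, of "phi_om D (pihom D [b])" "[]"] b phi_om_words[OF b(2)]
    by (metis append_Nil append_Nil2 lists.Nil)
  then show ?case
    using phi_om_append[OF b(2,3)] IH B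
    by (simp add: Lam_path_simps path_down_def path_from_to_def)
qed

lemma Lam_path_Cons:
  assumes "b \<in> Bgens D" "u \<in> Bwords"
  shows "Lam_path D (b # u) = path_act [] (edge_path (B_edge D b)) u \<circ>\<^sub>p
    path_act (phi_om D (pihom D [b])) (Lam_path D u) []"
  using Lam_path_from_to[OF assms(2)] B_edge_path[OF assms(1)]
  by (simp add: Lam_path_simps path_down_def path_from_to_def)

section \<open>Images of Squier squares under \<phi>\<close>

lemma phi_edge_left:
  assumes "E \<in> graph_edges (alph D) (rels D)" "a \<in> words" "l \<in> L" "j \<in> Jset D"
    "adm l j (a @ edge_init E)" "lact D (edge_init E) j = Some n" "ract D l (kappa D a n) = Some m"
  shows "phi_edge D l (edge_act a E []) j = edge_act (phi D l (kappa D a n)) (phi_edge D m E j) []"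
proof -
  note jI = Jset_I[OF assms(4)]
  have w: "edge_init E \<in> words"
    using P.edge_words assms by blast
  note m = adm_append_at[OF assms(3) jI assms(2) w assms(5-7)]
  obtain m' where "ract D m (kappa D (edge_init E) j) = Some m'"
    using adm_ract[OF m(1) jI w m(3)] .
  from phi_edge_act[OF assms(1,2) lists.Nil assms(3,4) _ lact_Nil[OF jI] assms(6,7) this]
  show ?thesis
    using assms(5) by simp
qed

lemma phi_edge_right:
  assumes "E \<in> graph_edges (alph D) (rels D)" "b \<in> words" "l \<in> L" "j \<in> Jset D"
    "adm l j (edge_init E @ b)" "lact D b j = Some k"
    "ract D l (kappa D (edge_init E) k) = Some m"
  shows "phi_edge D l (edge_act [] E b) j = edge_act [] (phi_edge D l E k) (phi D m (kappa D b j))"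
proof -
  note jI = Jset_I[OF assms(4)]
  have w: "edge_init E \<in> words"
    using P.edge_words assms by blast
  note m = adm_append_at[OF assms(3) jI w assms(2,5-7)]
  then obtain n where n: "lact D (edge_init E) k = Some n"
    by (auto simp: adm_def)
  show ?thesis
    using phi_edge_act[OF assms(1) lists.Nil assms(2-4) _ assms(6) n _ assms(7)] assms(3,5)
    by simp
qed

lemma edge_V: "E \<in> graph_edges (alph D) (rels D) \<Longrightarrow> V (edge_term E) = V (edge_init E)"
  using path_V[OF P.path_from_to_edge] by simp

text \<open>Rewriting F does not change the index k at which E is mapped, and rewriting E does not
  change the index m at which F is mapped, since both actions depend only on the elements
  represented. So the four sides are the images of E and F at fixed indices.\<close>

lemma phi_squier_path:
  assumes E: "E \<in> graph_edges (alph D) (rels D)" "F \<in> graph_edges (alph D) (rels D)"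
    and l: "l \<in> L" and j: "j \<in> Jset D" and a: "adm l j (edge_init E @ edge_init F)"
  shows "phi_path D l (squier_path E F) j \<in> squier_paths (Bgens D) (Urels D)"
proof -
  note jI = Jset_I[OF j]
  note Ew = P.edge_words[OF E(1)] and Fw = P.edge_words[OF E(2)]
  note EV = edge_V[OF E(1)] and FV = edge_V[OF E(2)]
  obtain k m where k: "k \<in> I" "m \<in> L" "lact D (edge_init F) j = Some k" "adm l k (edge_init E)"
    "ract D l (kappa D (edge_init E) k) = Some m" "adm m j (edge_init F)" "under D m k"
    "phi D l (kappa D (edge_init E @ edge_init F) j) =
      phi D l (kappa D (edge_init E) k) @ phi D m (kappa D (edge_init F) j)"
    using adm_append[OF l jI Ew(1) Fw(1) a] by blast
  have kJ: "k \<in> Jset D"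
    using lact_Jset[OF j Fw(1) k(3)] .
  obtain i where i: "lact D (edge_init E) k = Some i" "under D l i"
    using k(4) by (auto simp: adm_def)
  obtain x where x: "x \<in> hcls D l"
    using hcls_elem l by blast
  have rt: "ract D l (kappa D (edge_term E) k) = Some m"
    using kappa_ract_cong(2)[OF EV[symmetric] Ew l k(1) i x] k(5) by simp
  have lt: "lact D (edge_term F) j = Some k"
    using lact_cong[OF FV] k(3) by simp
  have adms: "adm l j (edge_term E @ edge_init F)" "adm l j (edge_term E @ edge_term F)"
    "adm l j (edge_init E @ edge_term F)"
    using a adm_cong[of "edge_init E @ edge_init F" "edge_term E @ edge_init F"]
      adm_cong[of "edge_init E @ edge_init F" "edge_term E @ edge_term F"]
      adm_cong[of "edge_init E @ edge_init F" "edge_init E @ edge_term F"] EV FV Ew Fw by simp_all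
  note GE = phi_edge_graph[OF E(1) l kJ k(4)] and GF = phi_edge_graph[OF E(2) k(2) j k(6)]
  have IE: "edge_inv E \<in> graph_edges (alph D) (rels D)" "edge_inv F \<in> graph_edges (alph D) (rels D)"
    using E by simp_all
  let ?E = "phi_edge D l E k" and ?F = "phi_edge D m F j"
  have "phi_edge D l (edge_act [] E (edge_init F)) j = edge_act [] ?E (edge_init ?F)"
    using phi_edge_right[OF E(1) Fw(1) l j a k(3,5)] GF by simp
  moreover have "phi_edge D l (edge_act (edge_term E) F []) j = edge_act (edge_term ?E) ?F []"
    using phi_edge_left[OF E(2) Ew(2) l j adms(1) k(3) rt] GE by simp
  moreover have "phi_edge D l (edge_act [] (edge_inv E) (edge_term F)) j =
      edge_act [] (edge_inv ?E) (edge_term ?F)"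
    using phi_edge_right[OF IE(1) Fw(2) l j _ lt] adms rt GE GF by simp
  moreover have "phi_edge D l (edge_act (edge_init E) (edge_inv F) []) j =
      edge_act (edge_init ?E) (edge_inv ?F) []"
    using phi_edge_left[OF IE(2) Ew(1) l j _ _ k(5)] adms lt GE GF by simp
  ultimately have "phi_path D l (squier_path E F) j = squier_path ?E ?F"
    using k(8) GE GF
    by (simp add: phi_path_def squier_path_def path_comp_def path_act_def edge_path_def)
  then show ?thesis
    using GE GF by (auto simp: squier_paths_def)
qed

text \<open>The factorisation T(w) = y z, with y in W determined by the index k = \<psi>(w) *
  \<eta>.\<close>

lemma lact_psi_et:
  assumes "w \<in> Bwords"
  obtains k m where "lact D (psi D w) (et D) = Some k" "k \<in> Jset D" "lact D h k = Some (om D)"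
    "m \<in> L" "ract D (lone D) (kappa D h k) = Some m" "phi D (lone D) (kappa D h k) \<in> Wset D"
    "target w = phi D (lone D) (kappa D h k) @ phi D m (kappa D (psi D w) (et D))"
    "phi D m (kappa D (psi D w) (et D)) \<in> Bwords"
proof -
  have p: "psi D w \<in> words"
    using assms by simp
  obtain k m where k: "k \<in> I" "m \<in> L" "lact D (psi D w) (et D) = Some k"
    "lact D h k = lact D (h @ psi D w) (et D)" "ract D (lone D) (kappa D h k) = Some m"
    "adm m (et D) (psi D w)"
    "phi D (lone D) (kappa D (h @ psi D w) (et D)) =
      phi D (lone D) (kappa D h k) @ phi D m (kappa D (psi D w) (et D))"
    using adm_append[OF lone(1) et(1) hword_words p adm_h[OF assms]] by blast
  have kJ: "k \<in> Jset D"
    using lact_Jset[OF et_Jset p k(3)] .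
  moreover have "phi D (lone D) (kappa D h k) \<in> Wset D"
    using kJ k(4) lact_h[OF assms] by (auto simp: Wset_def)
  ultimately show ?thesis
    using that[of k m] k lact_h[OF assms] adm_words[OF k(2) et(1) p k(6)] by (simp add: target_def)
qed

end

section \<open>The closed paths of Y_1, Y_2, Y_3 and the complex they generate\<close>

locale schutz_homotopy = schutz_setting D
  for D :: "('s, 'a, 'l, 'i) schutz_data" +
  fixes C :: "('a, 'l) schutz_choice" and X :: "'a dpath set"
  assumes choice: "valid_choice D C" and X_base: "homotopy_base (alph D) (rels D) X"
begin

sublocale PX: homotopy_complex "alph D" "rels D" X
  using X_base by unfold_locales (auto simp: homotopy_base_def)

lemma Ppath:
  "(u, v) \<in> Urels D \<Longrightarrow>
    path_from_to (alph D) (rels D) (Ppath C u v) (pihom D u @ h) (pihom D v @ h)"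
  using choice by (auto simp: valid_choice_def)

lemma Ppath_pow:
  assumes "r \<in> Urels D"
  shows "path_from_to (alph D) (rels D) (path_pow (Ppath C (fst r) (snd r)) e)
    (pihom D (rel_side r e) @ h) (pihom D (rel_side r (\<not> e)) @ h)"
  using Ppath[of "fst r" "snd r"] P.path_from_to_inv assms
  by (auto simp: path_pow_def rel_side_def)

lemma Dpath:
  assumes "y \<in> Wset D"
  shows "path_from_to (Bgens D) (Urels D) (Dpath C y) (y @ hat C y) []"
    "path_from_to (Bgens D) (Urels D) (Dpath' C y) (hat C y @ y) []"
    "y \<in> Bwords" "hat C y \<in> Bwords"
proof -
  show 1: "path_from_to (Bgens D) (Urels D) (Dpath C y) (y @ hat C y) []"
    "path_from_to (Bgens D) (Urels D) (Dpath' C y) (hat C y @ y) []"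
    using assms choice by (auto simp: valid_choice_def)
  show "y \<in> Bwords" "hat C y \<in> Bwords"
    using Q.path_from_to_words[OF 1(1)] by auto
qed

text \<open>The middle part of a path in \<open>Y3\<close>, traversed backwards.\<close>

definition detour :: "('l \<times> 'a) list \<times> ('l \<times> 'a) list \<Rightarrow> bool \<Rightarrow> ('l \<times> 'a) list \<Rightarrow> ('l \<times> 'a) dpath"
  where "detour r e w =
    (let y = phi D (lone D) (kappa D h (the (lact D (psi D w) (et D)))) in
      path_act (phi_om D (pihom D (rel_side r e))) (path_inv (Dpath C y)) [] \<circ>\<^sub>p
      Q_path D C (fst r) (snd r) e w \<circ>\<^sub>p
      path_act (phi_om D (pihom D (rel_side r (\<not> e)))) (Dpath C y) [])"

text \<open>The \<phi>-image of a path P[u,v] with suffix \<psi>(w), taken at \<eta>, is its image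
  \<open>Q0\<close> at k with suffix z. Thus the same \<open>Q0\<close> occurs in Y_3, with suffix
  \<open>hat y\<close>, and in the lift of the translated path.\<close>

lemma detour_data:
  assumes r: "r \<in> Urels D" and w: "w \<in> Bwords"
  obtains y z Q0 where "y \<in> Wset D" "target w = y @ z" "z \<in> Bwords"
    "y = phi D (lone D) (kappa D h (the (lact D (psi D w) (et D))))"
    "Q_path D C (fst r) (snd r) e w = path_act [] Q0 (hat C y)"
    "path_from_to (Bgens D) (Urels D) Q0 (phi_om D (pihom D (rel_side r e)) @ y)
      (phi_om D (pihom D (rel_side r (\<not> e))) @ y)"
    "lift (path_act [] (path_pow (Ppath C (fst r) (snd r)) e) (psi D w)) = path_act [] Q0 z"
    "detour r e w = path_act (phi_om D (pihom D (rel_side r e))) (path_inv (Dpath C y)) [] \<circ>\<^sub>p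
      path_act [] Q0 (hat C y) \<circ>\<^sub>p
      path_act (phi_om D (pihom D (rel_side r (\<not> e)))) (Dpath C y) []"
proof -
  obtain k m where k: "lact D (psi D w) (et D) = Some k" "k \<in> Jset D" "lact D h k = Some (om D)"
    "m \<in> L" "ract D (lone D) (kappa D h k) = Some m" "phi D (lone D) (kappa D h k) \<in> Wset D"
    "target w = phi D (lone D) (kappa D h k) @ phi D m (kappa D (psi D w) (et D))"
    "phi D m (kappa D (psi D w) (et D)) \<in> Bwords"
    using lact_psi_et[OF w] by blast
  note kI = Jset_I[OF k(2)]
  have u: "rel_side r e' \<in> Bwords" for e'
    using Q.rel_side_words[OF r] .
  let ?y = "phi D (lone D) (kappa D h k)" and ?z = "phi D m (kappa D (psi D w) (et D))"
  let ?P = "path_pow (Ppath C (fst r) (snd r)) e"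
  let ?Q0 = "phi_path D (lone D) ?P k"
  note P = Ppath_pow[OF r, of e]
  have ph: "phi D (lone D) (kappa D (pihom D (rel_side r e') @ h) k) =
      phi_om D (pihom D (rel_side r e')) @ ?y" for e'
    by (rule phi_pihom_append[OF u hword_words k(3) kI])
  have lu: "lact D (pihom D (rel_side r e') @ h) k = Some (om D)" for e'
    by (rule lact_pihom_append[OF u hword_words k(3) kI])
  have Q0: "path_from_to (Bgens D) (Urels D) ?Q0 (phi_om D (pihom D (rel_side r e)) @ ?y)
      (phi_om D (pihom D (rel_side r (\<not> e))) @ ?y)"
    using phi_path_from_to(1)[OF lone(1) k(2) P adm_om[OF lu]] by (simp add: ph)
  have fP: "is_dpath (alph D) (rels D) ?P" "fst ?P = pihom D (rel_side r e) @ h"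
    using P by (simp_all add: path_from_to_def)
  have 1: "ract D (lone D) (kappa D (fst ?P) k) = Some m"
    unfolding fP(2)
    using adm_append_at(6)[OF lone(1) kI _ hword_words adm_om[OF lu] k(3) ract_pihom[OF u]] u k(5)
    by simp
  have 2: "adm (lone D) (et D) ([] @ fst ?P @ psi D w)"
    unfolding fP(2)
    using adm_om[OF lact_pihom_append[OF u _ lact_h[OF w] et(1)]] w by simp
  have 3: "lact D (fst ?P) k = Some (om D)"
    unfolding fP(2) by (rule lu)
  have 4: "ract D (lone D) (kappa D [] (om D)) = Some (lone D)"
    using lone(1) by simp
  have "lift (path_act [] ?P (psi D w)) = path_act [] ?Q0 ?z"
    unfolding lift_def
    using phi_path_act[OF fP(1) lists.Nil psi_words[OF w] lone(1) et_Jset 2 k(1) 3 4 1] by simp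
  moreover have Q: "Q_path D C (fst r) (snd r) e w = path_act [] ?Q0 (hat C ?y)"
    by (simp add: Q_path_def Let_def k(1))
  moreover have y: "?y = phi D (lone D) (kappa D h (the (lact D (psi D w) (et D))))"
    by (simp add: k(1))
  moreover have "detour r e w = path_act (phi_om D (pihom D (rel_side r e))) (path_inv (Dpath C ?y)) [] \<circ>\<^sub>p
      path_act [] ?Q0 (hat C ?y) \<circ>\<^sub>p
      path_act (phi_om D (pihom D (rel_side r (\<not> e)))) (Dpath C ?y) []"
    unfolding detour_def Let_def y[symmetric] Q ..
  ultimately show ?thesis
    using that[OF k(6-8) _ _ Q0] by blast
qed

lemma detour_path:
  assumes "r \<in> Urels D" "w \<in> Bwords"
  shows "path_from_to (Bgens D) (Urels D) (detour r e w)
    (phi_om D (pihom D (rel_side r e))) (phi_om D (pihom D (rel_side r (\<not> e))))"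
proof -
  have u: "phi_om D (pihom D (rel_side r e')) \<in> Bwords" for e'
    using phi_om_words Q.rel_side_words assms by blast
  obtain y Q0 where y: "y \<in> Wset D"
    "path_from_to (Bgens D) (Urels D) Q0 (phi_om D (pihom D (rel_side r e)) @ y)
      (phi_om D (pihom D (rel_side r (\<not> e))) @ y)"
    "detour r e w = path_act (phi_om D (pihom D (rel_side r e))) (path_inv (Dpath C y)) [] \<circ>\<^sub>p
      path_act [] Q0 (hat C y) \<circ>\<^sub>p
      path_act (phi_om D (pihom D (rel_side r (\<not> e)))) (Dpath C y) []"
    by (rule detour_data[OF assms, of e]) blast
  note D = Dpath[OF y(1)]
  show ?thesis
    unfolding y(3)
    using path_from_to_act[OF Q.path_from_to_inv[OF D(1)] u lists.Nil, of e]
      path_from_to_act[OF y(2) lists.Nil D(4)] path_from_to_act[OF D(1) u lists.Nil, of "\<not> e"]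
    by (auto intro!: Q.path_from_to_comp)
qed

text \<open>The last three factors of a path in Y_3 form the inverse of \<open>detour\<close>; hence
  Y_3 compares the relation, conjugated by the (R3)-paths, with its detour.\<close>

lemma Y3_path_eq:
  assumes "r \<in> Urels D" "w \<in> Bwords"
  shows "Y3_path D C (fst r) (snd r) e w = (path_inv (Lam_path D (rel_side r e)) \<circ>\<^sub>p
      edge_path (elem_edge r e) \<circ>\<^sub>p Lam_path D (rel_side r (\<not> e))) \<circ>\<^sub>p path_inv (detour r e w)"
proof -
  obtain y z Q0 where y: "y \<in> Wset D"
    "y = phi D (lone D) (kappa D h (the (lact D (psi D w) (et D))))"
    "Q_path D C (fst r) (snd r) e w = path_act [] Q0 (hat C y)"
    "path_from_to (Bgens D) (Urels D) Q0 (phi_om D (pihom D (rel_side r e)) @ y)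
      (phi_om D (pihom D (rel_side r (\<not> e))) @ y)"
    "detour r e w = path_act (phi_om D (pihom D (rel_side r e))) (path_inv (Dpath C y)) [] \<circ>\<^sub>p
      path_act [] Q0 (hat C y) \<circ>\<^sub>p
      path_act (phi_om D (pihom D (rel_side r (\<not> e)))) (Dpath C y) []"
    by (rule detour_data[OF assms, of e]) blast
  note D = Dpath(1)[OF y(1)]
  show ?thesis
    unfolding y(5) Y3_path_def Let_def y(2)[symmetric] y(3) using y(4) D
    by (simp add: path_inv_comp path_comp_assoc path_from_to_def path_act_inv[symmetric])
qed

abbreviation Y where "Y \<equiv> Y1 D X \<union> Y2 D C \<union> Y3 D C"

lemma Lam_edge_paths:
  assumes "r \<in> Urels D"
  shows "path_from_to (Bgens D) (Urels D) (edge_path (elem_edge r e))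
      (rel_side r e) (rel_side r (\<not> e))"
    "path_from_to (Bgens D) (Urels D) (Lam_path D (rel_side r e))
      (rel_side r e) (phi_om D (pihom D (rel_side r e)))"
    "rel_side r e \<in> Bwords" "phi_om D (pihom D (rel_side r e)) \<in> Bwords"
  using assms Lam_path_from_to[OF Q.rel_side_words[OF assms]] Q.rel_side_words[OF assms]
    phi_om_words[OF Q.rel_side_words[OF assms]]
  by (simp_all add: path_from_to_def)

lemma Y3_closed:
  assumes "r \<in> Urels D" "w \<in> Bwords"
  shows "closed_path (Bgens D) (Urels D) (Y3_path D C (fst r) (snd r) e w)"
proof -
  note L = Lam_edge_paths[OF assms(1)]
  have "path_from_to (Bgens D) (Urels D) (Y3_path D C (fst r) (snd r) e w)
      (phi_om D (pihom D (rel_side r e))) (phi_om D (pihom D (rel_side r e)))"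
    unfolding Y3_path_eq[OF assms]
    by (rule Q.path_from_to_comp[OF Q.path_from_to_comp[OF Q.path_from_to_inv[OF L(2)]
        Q.path_from_to_comp[OF L(1) L(2)]] Q.path_from_to_inv[OF detour_path[OF assms]]])
  then show ?thesis
    by (simp add: path_from_to_def closed_path_def)
qed

lemma Y1_data:
  assumes P: "P \<in> X" and w: "\<alpha> \<in> words" "\<beta> \<in> words" and l: "l \<in> L" and j: "j \<in> Jset D"
    and a: "adm l j (\<alpha> @ fst P @ \<beta>)"
  obtains k n m m' where "k \<in> Jset D" "m \<in> L" "lact D \<beta> j = Some k" "lact D (fst P) k = Some n"
    "lact D (fst P @ \<beta>) j = Some n" "ract D l (kappa D \<alpha> n) = Some m" "adm m k (fst P)"
    "ract D m (kappa D (fst P) k) = Some m'"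
    "phi D l (kappa D \<alpha> n) \<in> Bwords" "phi D m' (kappa D \<beta> j) \<in> Bwords"
proof -
  note jI = Jset_I[OF j]
  have Pw: "fst P \<in> words" "fst P @ \<beta> \<in> words"
    using PX.X_closed[OF P] P.is_dpath_init w by (auto simp: closed_path_def)
  obtain n m where n: "m \<in> L" "lact D (fst P @ \<beta>) j = Some n" "ract D l (kappa D \<alpha> n) = Some m"
    "adm m j (fst P @ \<beta>)" "phi D l (kappa D \<alpha> n) \<in> Bwords"
    using adm_append[OF l jI w(1) Pw(2) a] by blast
  obtain k m' where k: "lact D \<beta> j = Some k" "lact D (fst P) k = lact D (fst P @ \<beta>) j"
    "ract D m (kappa D (fst P) k) = Some m'" "adm m k (fst P)" "m' \<in> L" "adm m' j \<beta>"
    using adm_append[OF n(1) jI Pw(1) w(2) n(4)] by blast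
  show ?thesis
    using that[OF _ n(1) k(1) _ n(2,3) k(4,3) n(5)] k lact_Jset[OF j w(2) k(1)] n(2)
      adm_words[OF k(5) jI w(2) k(6)] by simp
qed

lemma Y_closed: "K \<in> Y \<Longrightarrow> closed_path (Bgens D) (Urels D) K"
proof (elim UnE)
  assume "K \<in> Y1 D X"
  then obtain P \<alpha> \<beta> l j where K: "K = phi_path D
        (the (ract D l (kappa D \<alpha> (the (lact D (fst P @ \<beta>) j))))) P (the (lact D \<beta> j))"
    "P \<in> X" "\<alpha> \<in> words" "\<beta> \<in> words" "l \<in> L" "j \<in> Jset D" "adm l j (\<alpha> @ fst P @ \<beta>)"
    unfolding Y1_def adm_def by auto
  obtain k n m where k: "k \<in> Jset D" "m \<in> L" "lact D \<beta> j = Some k" "lact D (fst P @ \<beta>) j = Some n"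
    "ract D l (kappa D \<alpha> n) = Some m" "adm m k (fst P)"
    using Y1_data[OF K(2-)] by blast
  have "path_from_to (alph D) (rels D) P (fst P) (fst P)"
    using PX.X_closed[OF K(2)] by (simp add: path_from_to_def closed_path_def)
  then show ?thesis
    using phi_path_from_to(1)[OF k(2,1) _ k(6)] k
    by (simp add: K(1) path_from_to_def closed_path_def)
next
  assume "K \<in> Y2 D C"
  then obtain y where y: "K = path_act [] (path_inv (Dpath C y)) y \<circ>\<^sub>p path_act y (Dpath' C y) []"
    "y \<in> Wset D"
    by (auto simp: Y2_def)
  note D = Dpath[OF y(2)]
  have "path_from_to (Bgens D) (Urels D) K ([] @ [] @ y) (y @ [] @ [])"
    unfolding y(1)
    using path_from_to_act[OF Q.path_from_to_inv[OF D(1)] lists.Nil D(3)]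
      path_from_to_act[OF D(2,3) lists.Nil] by (auto intro!: Q.path_from_to_comp)
  then show ?thesis
    by (simp add: path_from_to_def closed_path_def)
next
  assume "K \<in> Y3 D C"
  then show ?thesis
    using Y3_closed by (fastforce simp: Y3_def)
qed

sublocale QY: homotopy_complex "Bgens D" "Urels D" Y
  using Y_closed by unfold_locales

lemma phi_path_cell_null:
  assumes K: "K \<in> base_cells (alph D) (rels D) X" and l: "l \<in> L" and j: "j \<in> Jset D"
    and a: "adm l j (fst K)"
  shows "QY.hom (phi_path D l K j) (phi D l (kappa D (fst K) j), [])"
proof (cases "K \<in> squier_paths (alph D) (rels D)")
  case True
  then obtain E F where K: "K = squier_path E F" "E \<in> graph_edges (alph D) (rels D)"
    "F \<in> graph_edges (alph D) (rels D)"
    by (auto simp: squier_paths_def)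
  have "adm l j (edge_init E @ edge_init F)"
    using a by (simp add: K(1) squier_path_def)
  then have "phi_path D l K j \<in> base_cells (Bgens D) (Urels D) Y"
    using phi_squier_path[OF K(2,3) l j] by (simp add: K(1) base_cells_def)
  from QY.C_null[OF this] show ?thesis
    by (simp add: phi_path_def)
next
  case False
  with K obtain \<alpha> P \<beta> where K: "K = path_act \<alpha> P \<beta>" "\<alpha> \<in> words" "\<beta> \<in> words" "P \<in> X"
    unfolding base_cells_def by blast
  have a': "adm l j (\<alpha> @ fst P @ \<beta>)"
    using a K(1) by simp
  obtain k n m m' where "k \<in> Jset D" "m \<in> L" and k: "lact D \<beta> j = Some k"
    "lact D (fst P) k = Some n" "lact D (fst P @ \<beta>) j = Some n" "ract D l (kappa D \<alpha> n) = Some m"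
    and "adm m k (fst P)" and k': "ract D m (kappa D (fst P) k) = Some m'"
    "phi D l (kappa D \<alpha> n) \<in> Bwords" "phi D m' (kappa D \<beta> j) \<in> Bwords"
    by (rule Y1_data[OF K(4,2,3) l j a'])
  have P: "is_dpath (alph D) (rels D) P"
    using PX.X_closed[OF K(4)] by (simp add: closed_path_def)
  note eq = phi_path_act[OF P K(2,3) l j a' k(1,2,4) k'(1)]
  \<comment> \<open>The context and the indices of the translated base path are precisely the
    parameters that put this image into Y_1.\<close>
  have "phi_path D m P k \<in> Y1 D X"
    unfolding Y1_def mem_Collect_eq
    by (rule exI[of _ P], rule exI[of _ \<alpha>], rule exI[of _ \<beta>], rule exI[of _ j], rule exI[of _ l])
      (use K l j a' k in \<open>auto simp: adm_def\<close>)
  then have "QY.hom (phi_path D l K j) (fst (phi_path D l K j), [])"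
    unfolding K(1) eq using QY.X_null[OF _ k'(2,3)] by simp
  then show ?thesis
    by (simp add: phi_path_def)
qed

lemma phi_path_hom:
  assumes "PX.hom P Q" "l \<in> L" "j \<in> Jset D" "adm l j (fst P)"
  shows "QY.hom (phi_path D l P j) (phi_path D l Q j)"
proof -
  interpret map: derivation_graph_map "alph D" "rels D" "Bgens D" "Urels D" "adm l j"
    "\<lambda>w. phi D l (kappa D w j)" "\<lambda>E. phi_edge D l E j"
    by (rule phi_map[OF assms(2,3)])
  interpret map: squier_complex_map "alph D" "rels D" "base_cells (alph D) (rels D) X" "Bgens D" "Urels D"
    "base_cells (Bgens D) (Urels D) Y" "adm l j"
    "\<lambda>w. phi D l (kappa D w j)" "\<lambda>E. phi_edge D l E j"
    using phi_path_cell_null[OF _ assms(2,3)] by unfold_locales (simp add: phi_path_def)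
  show ?thesis
    using map.fp_hom[OF assms(1,4)] by (simp add: map.fp_def phi_path_def)
qed

lemma lift_closed_null:
  assumes "path_from_to (alph D) (rels D) P u u" "lact D u (et D) = Some (om D)"
  shows "QY.hom (lift P) (fst (lift P), [])"
proof -
  have "closed_path (alph D) (rels D) P" "fst P = u"
    using assms(1) by (simp_all add: path_from_to_def closed_path_def)
  then have "PX.hom P (fst P, [])"
    using X_base PX.base_iff by blast
  from phi_path_hom[OF this lone(1) et_Jset] show ?thesis
    using adm_om[OF assms(2)] \<open>fst P = u\<close> by (simp add: lift_def phi_path_def)
qed

section \<open>Lifting paths over B to paths between the words h \<psi>(w)\<close>

lemma cancel_left:
  assumes "is_dpath (Bgens D) (Urels D) F" "is_dpath (Bgens D) (Urels D) Z" "fst F = fst Z"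
  shows "QY.hom Z (F \<circ>\<^sub>p path_inv F \<circ>\<^sub>p Z)"
proof -
  have "QY.hom ((fst F, []) \<circ>\<^sub>p Z) ((F \<circ>\<^sub>p path_inv F) \<circ>\<^sub>p Z)"
    using QY.hom_inv_right[OF assms(1)] assms
    by (intro QY.hom_comp_right) (auto intro: QY.hom_sym)
  then show ?thesis
    using assms(3) by (simp add: path_comp_empty_left path_comp_assoc)
qed

text \<open>The letters of u are all replaced first, before w is touched, and their connectors are
  collected at the end in one path \<open>T\<close>. Only the ends of \<open>T\<close> matter later
  on.\<close>

lemma theta_append:
  assumes "u \<in> Bwords" "w \<in> Bwords"
  shows "\<exists>T. path_from_to (alph D) (rels D) T (pihom D u @ h @ psi D w) (h @ psi D (u @ w)) \<and>
    QY.hom (theta (u @ w)) (path_act [] (Lam_path D u) w \<circ>\<^sub>p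
      path_act (phi_om D (pihom D u)) (theta w) [] \<circ>\<^sub>p lift T)"
  using assms(1)
proof (induction u)
  case Nil
  have "path_from_to (alph D) (rels D) (h @ psi D w, []) (pihom D [] @ h @ psi D w) (h @ psi D ([] @ w))"
    using assms(2) by (simp add: path_from_to_def)
  moreover have "QY.hom (theta w) (theta w)"
    using theta_path[OF assms(2)] by (auto intro: QY.hom_refl simp: path_from_to_def)
  then have "QY.hom (theta ([] @ w)) (path_act [] (Lam_path D []) w \<circ>\<^sub>p
      path_act (phi_om D (pihom D [])) (theta w) [] \<circ>\<^sub>p lift (h @ psi D w, []))"
    using theta_path[OF assms(2)]
    by (simp add: Lam_path_simps phi_om_def path_comp_empty_left path_from_to_def lift_def phi_path_def)
  ultimately show ?case by blast
next
  case (Cons b u)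
  then have b: "b \<in> Bgens D" "[b] \<in> Bwords" "u \<in> Bwords" "u @ w \<in> Bwords"
    using assms by auto
  from Cons.IH obtain T where
    T: "path_from_to (alph D) (rels D) T (pihom D u @ h @ psi D w) (h @ psi D (u @ w))" and
    eq: "QY.hom (theta (u @ w)) (path_act [] (Lam_path D u) w \<circ>\<^sub>p
      path_act (phi_om D (pihom D u)) (theta w) [] \<circ>\<^sub>p lift T)"
    by blast
  let ?B = "edge_path (B_edge D b)" and ?c = "phi_om D (pihom D [b])"
    and ?K = "path_act [] (connector b) (psi D (u @ w))"
  let ?T = "path_act (pihom D [b]) T [] \<circ>\<^sub>p ?K"
  have c: "?c \<in> Bwords"
    using phi_om_words[OF b(2)] .
  have lT: "lact D (pihom D u @ h @ psi D w) (et D) = Some (om D)"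
    using lact_pihom_append[OF b(3) _ lact_h[OF assms(2)] et(1)] assms(2) by simp
  have K: "path_from_to (alph D) (rels D) ?K (pihom D [b] @ h @ psi D (u @ w)) (h @ psi D (b # u @ w))"
    by (rule connector_psi[OF b(1,4)])
  have "path_from_to (alph D) (rels D) (path_act (pihom D [b]) T [])
      (pihom D [b] @ pihom D u @ h @ psi D w) (pihom D [b] @ h @ psi D (u @ w))"
    using path_from_to_act[OF T pihom_words[OF b(2)] lists.Nil] by simp
  from P.path_from_to_comp[OF this K]
  have T': "path_from_to (alph D) (rels D) ?T (pihom D (b # u) @ h @ psi D w) (h @ psi D ((b # u) @ w))"
    by simp
  have "QY.hom (path_act ?c (theta (u @ w)) []) (path_act ?c (path_act [] (Lam_path D u) w \<circ>\<^sub>p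
      path_act (phi_om D (pihom D u)) (theta w) [] \<circ>\<^sub>p lift T) [])"
    by (rule QY.hom_act[OF eq c lists.Nil])
  from QY.hom_comp_right[OF this, of "lift ?K"]
  have "QY.hom (path_act ?c (theta (u @ w)) [] \<circ>\<^sub>p lift ?K) (path_act ?c (path_act [] (Lam_path D u) w \<circ>\<^sub>p
      path_act (phi_om D (pihom D u)) (theta w) [] \<circ>\<^sub>p lift T) [] \<circ>\<^sub>p lift ?K)"
    using lift_connector[OF b(1,4)] theta_path[OF b(4)] by (simp add: path_from_to_def)
  from QY.hom_comp_left[OF this, of "path_act [] ?B (u @ w)"]
  have "QY.hom (theta ((b # u) @ w)) (path_act [] ?B (u @ w) \<circ>\<^sub>p path_act ?c (path_act [] (Lam_path D u) w \<circ>\<^sub>p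
      path_act (phi_om D (pihom D u)) (theta w) [] \<circ>\<^sub>p lift T) [] \<circ>\<^sub>p lift ?K)"
    using path_from_to_act[OF B_edge_path[OF b(1)] lists.Nil b(4)] theta_path[OF b(4)]
    by (simp add: path_from_to_def del: pihom_simps)
  \<comment> \<open>Translating the lift of \<open>T\<close> by \<phi>_\<omega>(\<pi>(b)) gives the
    lift of \<pi>(b) T, which can be joined with the connector of b.\<close>
  also have "path_act [] ?B (u @ w) \<circ>\<^sub>p path_act ?c (path_act [] (Lam_path D u) w \<circ>\<^sub>p
      path_act (phi_om D (pihom D u)) (theta w) [] \<circ>\<^sub>p lift T) [] \<circ>\<^sub>p lift ?K =
    path_act [] (Lam_path D (b # u)) w \<circ>\<^sub>p
      path_act (phi_om D (pihom D (b # u))) (theta w) [] \<circ>\<^sub>p lift ?T"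
    using phi_om_append[OF b(2,3)] lift_pihom[OF b(2) T lT]
    by (simp add: Lam_path_Cons[OF b(1,3)] path_act_comp path_comp_assoc lift_comp)
  finally show ?case
    using T' by blast
qed

text \<open>The conjugation by \<open>theta\<close> is written without an inverse, as a square with
  \<open>theta\<close> on two sides, so that squares can be pasted along
  \<open>theta\<close>.\<close>

definition liftable :: "('l \<times> 'a) dpath \<Rightarrow> ('l \<times> 'a) list \<Rightarrow> ('l \<times> 'a) list \<Rightarrow> bool" where
  "liftable Z w w' \<longleftrightarrow> path_from_to (Bgens D) (Urels D) Z w w' \<and>
    (\<exists>P. path_from_to (alph D) (rels D) P (h @ psi D w) (h @ psi D w') \<and>
      QY.hom (Z \<circ>\<^sub>p theta w') (theta w \<circ>\<^sub>p lift P))"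

lemma liftable_empty:
  assumes "w \<in> Bwords"
  shows "liftable (w, []) w w"
proof -
  have "path_from_to (alph D) (rels D) (h @ psi D w, []) (h @ psi D w) (h @ psi D w)"
    using assms by (simp add: path_from_to_def)
  moreover have "QY.hom ((w, []) \<circ>\<^sub>p theta w) (theta w \<circ>\<^sub>p lift (h @ psi D w, []))"
    using theta_path[OF assms] QY.hom_refl
    by (simp add: path_from_to_def lift_def phi_path_def path_comp_empty_left)
  moreover have "path_from_to (Bgens D) (Urels D) (w, []) w w"
    using assms by (simp add: path_from_to_def)
  ultimately show ?thesis
    unfolding liftable_def by blast
qed

lemma hom_left:
  "QY.hom Z Z' \<Longrightarrow> path_from_to (Bgens D) (Urels D) F u v \<Longrightarrow> fst Z = v \<Longrightarrow>
    QY.hom (F \<circ>\<^sub>p Z) (F \<circ>\<^sub>p Z')"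
  by (simp add: path_from_to_def QY.hom_comp_left)

lemma hom_right:
  "QY.hom Z Z' \<Longrightarrow> path_from_to (Bgens D) (Urels D) F u v \<Longrightarrow> path_term Z = u \<Longrightarrow>
    QY.hom (Z \<circ>\<^sub>p F) (Z' \<circ>\<^sub>p F)"
  by (simp add: path_from_to_def QY.hom_comp_right)

lemma path_ends:
  "path_from_to (Bgens D) (Urels D) F u v \<Longrightarrow> fst F = u"
  "path_from_to (Bgens D) (Urels D) F u v \<Longrightarrow> path_term F = v"
  "path_from_to (Bgens D) (Urels D) F u v \<Longrightarrow> is_dpath (Bgens D) (Urels D) F"
  by (simp_all add: path_from_to_def)

lemma liftable_comp:
  assumes "liftable Z u v" "liftable Z' v w"
  shows "liftable (Z \<circ>\<^sub>p Z') u w"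
proof -
  obtain P P' where Z: "path_from_to (Bgens D) (Urels D) Z u v"
      "path_from_to (Bgens D) (Urels D) Z' v w"
    and P: "path_from_to (alph D) (rels D) P (h @ psi D u) (h @ psi D v)"
      "path_from_to (alph D) (rels D) P' (h @ psi D v) (h @ psi D w)"
    and eq: "QY.hom (Z \<circ>\<^sub>p theta v) (theta u \<circ>\<^sub>p lift P)" "QY.hom (Z' \<circ>\<^sub>p theta w) (theta v \<circ>\<^sub>p lift P')"
    using assms unfolding liftable_def by blast
  have w: "u \<in> Bwords" "v \<in> Bwords" "w \<in> Bwords"
    using Z Q.path_from_to_words by blast+
  note th = theta_path[OF w(1)] theta_path[OF w(2)] theta_path[OF w(3)]
    lift_target[OF P(1) w(1)] lift_target[OF P(2) w(2)]
  have "QY.hom (Z \<circ>\<^sub>p (Z' \<circ>\<^sub>p theta w)) (Z \<circ>\<^sub>p (theta v \<circ>\<^sub>p lift P'))"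
    using eq Z th by (intro QY.hom_comp_left) (auto simp: path_from_to_def)
  also have "Z \<circ>\<^sub>p (theta v \<circ>\<^sub>p lift P') = (Z \<circ>\<^sub>p theta v) \<circ>\<^sub>p lift P'"
    by (simp add: path_comp_assoc)
  also have "QY.hom ((Z \<circ>\<^sub>p theta v) \<circ>\<^sub>p lift P') ((theta u \<circ>\<^sub>p lift P) \<circ>\<^sub>p lift P')"
    using eq Z th by (intro QY.hom_comp_right) (auto simp: path_from_to_def)
  finally have "QY.hom ((Z \<circ>\<^sub>p Z') \<circ>\<^sub>p theta w) (theta u \<circ>\<^sub>p lift (P \<circ>\<^sub>p P'))"
    by (simp add: path_comp_assoc lift_comp)
  then show ?thesis
    unfolding liftable_def using Q.path_from_to_comp[OF Z] P.path_from_to_comp[OF P] by blast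
qed

text \<open>\<open>Z\<close> commutes with the replacement of the letter b in front of it, and the
  new prefix \<phi>_\<omega>(\<pi>(b)) lifts to the prefix \<pi>(b). The lifted path is \<pi>(b) P,
  conjugated by the connectors that turn \<pi>(b) h into h \<psi>(b).\<close>

lemma liftable_Cons:
  assumes "liftable Z w w'" and b: "b \<in> Bgens D"
  shows "liftable (path_act [b] Z []) (b # w) (b # w')"
proof -
  obtain P where Z: "path_from_to (Bgens D) (Urels D) Z w w'"
    and P: "path_from_to (alph D) (rels D) P (h @ psi D w) (h @ psi D w')"
    and eq: "QY.hom (Z \<circ>\<^sub>p theta w') (theta w \<circ>\<^sub>p lift P)"
    using assms unfolding liftable_def by blast
  have w: "w \<in> Bwords" "w' \<in> Bwords" "[b] \<in> Bwords"
    using Z Q.path_from_to_words b by auto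
  let ?B = "edge_path (B_edge D b)" and ?c = "phi_om D (pihom D [b])"
    and ?K = "path_act [] (connector b) (psi D w)" and ?K' = "path_act [] (connector b) (psi D w')"
    and ?P = "path_act (pihom D [b]) P []"
  have c: "?c \<in> Bwords"
    using phi_om_words[OF w(3)] .
  note K = connector_psi[OF b w(1)] and K' = connector_psi[OF b w(2)]
  note LK = lift_connector[OF b w(1)] and LK' = lift_connector[OF b w(2)]
  note th = theta_path[OF w(1)] theta_path[OF w(2)]
  note LP = lift_target[OF P w(1)]
  note B = B_edge_path[OF b]
  have P': "path_from_to (alph D) (rels D) ?P (pihom D [b] @ h @ psi D w) (pihom D [b] @ h @ psi D w')"
    using path_from_to_act[OF P pihom_words[OF w(3)] lists.Nil] by simp
  let ?T = "path_inv ?K \<circ>\<^sub>p ?P \<circ>\<^sub>p ?K'"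
  have T: "path_from_to (alph D) (rels D) ?T (h @ psi D (b # w)) (h @ psi D (b # w'))"
    by (rule P.path_from_to_comp[OF P.path_from_to_inv[OF K] P.path_from_to_comp[OF P' K']])
  have lK: "lact D (fst ?K) (et D) = Some (om D)"
    using lact_pihom_append[OF w(3) _ lact_h[OF w(1)] et(1)] K w(1) by (simp add: path_from_to_def)
  have lP: "lift ?P = path_act ?c (lift P) []"
    by (rule lift_pihom[OF w(3) P lact_h[OF w(1)]])
  have liftT: "lift ?T = path_inv (lift ?K) \<circ>\<^sub>p path_act ?c (lift P) [] \<circ>\<^sub>p lift ?K'"
    using K lK lP by (simp add: lift_comp lift_inv path_from_to_def)
  have fB: "path_from_to (Bgens D) (Urels D) (path_act [] ?B w) (b # w) (?c @ w)"
    using path_from_to_act[OF B lists.Nil w(1)] by simp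
  have fth: "path_from_to (Bgens D) (Urels D) (path_act ?c (theta w) []) (?c @ w) (?c @ target w)"
    using path_from_to_act[OF th(1) c lists.Nil] by simp
  have fth': "path_from_to (Bgens D) (Urels D) (path_act ?c (theta w') []) (?c @ w') (?c @ target w')"
    using path_from_to_act[OF th(2) c lists.Nil] by simp
  have fP: "path_from_to (Bgens D) (Urels D) (path_act ?c (lift P) []) (?c @ target w) (?c @ target w')"
    using path_from_to_act[OF LP c lists.Nil] by simp
  have "path_act [b] Z [] \<circ>\<^sub>p theta (b # w') =
      (path_act (fst ?B) Z [] \<circ>\<^sub>p path_act [] ?B (path_term Z)) \<circ>\<^sub>p path_act ?c (theta w') [] \<circ>\<^sub>p lift ?K'"
    unfolding theta.simps path_ends(1)[OF B] path_ends(2)[OF Z] path_comp_assoc ..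
  also have "QY.hom \<dots> ((path_act [] ?B (fst Z) \<circ>\<^sub>p path_act (path_term ?B) Z []) \<circ>\<^sub>p
      path_act ?c (theta w') [] \<circ>\<^sub>p lift ?K')"
    by (rule hom_right[OF QY.hom_sym[OF QY.interchange] Q.path_from_to_comp[OF fth' LK']])
      (use path_ends[OF B] path_ends[OF Z] in simp_all)
  also have "\<dots> = path_act [] ?B w \<circ>\<^sub>p path_act ?c (Z \<circ>\<^sub>p theta w') [] \<circ>\<^sub>p lift ?K'"
    unfolding path_ends(2)[OF B] path_ends(1)[OF Z] path_comp_assoc path_act_comp ..
  also have "QY.hom \<dots> (path_act [] ?B w \<circ>\<^sub>p path_act ?c (theta w \<circ>\<^sub>p lift P) [] \<circ>\<^sub>p lift ?K')"
    by (rule hom_left[OF hom_right[OF QY.hom_act[OF eq c lists.Nil] LK'] fB])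
      (use path_ends[OF Z] path_ends[OF th(2)] in simp_all)
  also have "\<dots> = (path_act [] ?B w \<circ>\<^sub>p path_act ?c (theta w) []) \<circ>\<^sub>p
      (path_act ?c (lift P) [] \<circ>\<^sub>p lift ?K')"
    unfolding path_comp_assoc path_act_comp ..
  \<comment> \<open>A cancelling pair is inserted: its first half completes
    \<open>theta (b # w)\<close>, its second half opens the lift of \<open>?T\<close>.\<close>
  also have "QY.hom \<dots> ((path_act [] ?B w \<circ>\<^sub>p path_act ?c (theta w) []) \<circ>\<^sub>p
      (lift ?K \<circ>\<^sub>p path_inv (lift ?K) \<circ>\<^sub>p path_act ?c (lift P) [] \<circ>\<^sub>p lift ?K'))"
    by (rule hom_left[OF cancel_left[OF path_ends(3)[OF LK] path_ends(3)[OF Q.path_from_to_comp[OF fP LK']]]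
          Q.path_from_to_comp[OF fB fth]])
      (use path_ends[OF LK] path_ends[OF fP] in simp_all)
  also have "\<dots> = theta (b # w) \<circ>\<^sub>p lift ?T"
    unfolding theta.simps liftT path_comp_assoc ..
  finally have hom: "QY.hom (path_act [b] Z [] \<circ>\<^sub>p theta (b # w')) (theta (b # w) \<circ>\<^sub>p lift ?T)" .
  have "path_from_to (Bgens D) (Urels D) (path_act [b] Z []) (b # w) (b # w')"
    using path_from_to_act[OF Z w(3) lists.Nil] by simp
  then show ?thesis
    unfolding liftable_def using T hom by blast
qed

text \<open>The contractibility of a path in Y_3, solved for the edge of the relation.\<close>

lemma detour_relation:
  assumes r: "r \<in> Urels D" and w: "w \<in> Bwords"
  shows "QY.hom (edge_path (elem_edge r e) \<circ>\<^sub>p Lam_path D (rel_side r (\<not> e)))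
    (Lam_path D (rel_side r e) \<circ>\<^sub>p detour r e w)"
proof -
  note A = Lam_edge_paths(1)[OF r, of e]
  note L = Lam_edge_paths(2)[OF r]
  note M = detour_path[OF assms, of e]
  let ?A = "edge_path (elem_edge r e)" and ?L = "Lam_path D (rel_side r e)"
    and ?L' = "Lam_path D (rel_side r (\<not> e))"
  note AL = Q.path_from_to_comp[OF A L]
  note LAL = Q.path_from_to_comp[OF Q.path_from_to_inv[OF L] AL]
  note M' = Q.path_from_to_inv[OF M]
  have "Y3_path D C (fst r) (snd r) e w \<in> Y3 D C"
    using assms unfolding Y3_def by (metis (mono_tags, lifting) mem_Collect_eq prod.collapse)
  then have "QY.hom (Y3_path D C (fst r) (snd r) e w) (fst (Y3_path D C (fst r) (snd r) e w), [])"
    using QY.X_null[OF _ lists.Nil lists.Nil] by (metis UnI2 append.right_neutral append_Nil path_act_Nil)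
  then have "QY.hom ((path_inv ?L \<circ>\<^sub>p ?A \<circ>\<^sub>p ?L') \<circ>\<^sub>p path_inv (detour r e w))
      (phi_om D (pihom D (rel_side r e)), [])"
    unfolding Y3_path_eq[OF assms] using path_ends(2)[OF L] by simp
  from QY.hom_move_right[OF this]
  have "QY.hom (path_inv ?L \<circ>\<^sub>p ?A \<circ>\<^sub>p ?L') (detour r e w)"
    using path_ends[OF LAL] path_ends[OF M'] path_ends[OF M] by (simp add: path_comp_empty_left)
  from QY.hom_move_left[OF this]
  have "QY.hom (?A \<circ>\<^sub>p ?L') (path_inv (path_inv ?L) \<circ>\<^sub>p detour r e w)"
    using path_ends[OF AL] path_ends[OF Q.path_from_to_inv[OF L]] by simp
  then show ?thesis
    using path_ends(3)[OF L] by simp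
qed

lemma Y2_null:
  assumes "y \<in> Wset D"
  shows "QY.hom (path_act [] (path_inv (Dpath C y)) y \<circ>\<^sub>p path_act y (Dpath' C y) []) (y, [])"
proof -
  let ?K = "path_act [] (path_inv (Dpath C y)) y \<circ>\<^sub>p path_act y (Dpath' C y) []"
  have "?K \<in> Y"
    using assms unfolding Y2_def by blast
  from QY.X_null[OF this lists.Nil lists.Nil] show ?thesis
    using path_ends[OF Dpath(1)[OF assms]] by simp
qed

text \<open>The step that uses Y_2 and Y_3. By Y_3 the edge, followed by the (R3)-paths, becomes the
  detour; the detour acts on the prefix and so passes the path \<open>theta w\<close> on the suffix.
  In front of T(w) = y z it is, by Y_2, homotopic to the lift of P[u,v] with suffix
  \<psi>(w).\<close>

lemma liftable_elem_edge:
  assumes r: "r \<in> Urels D" and w: "w \<in> Bwords"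
  shows "liftable (path_act [] (edge_path (elem_edge r e)) w) (rel_side r e @ w) (rel_side r (\<not> e) @ w)"
proof -
  define u0 u1 where u: "u0 = rel_side r e" "u1 = rel_side r (\<not> e)"
  define U0 U1 where U: "U0 = phi_om D (pihom D u0)" "U1 = phi_om D (pihom D u1)"
  let ?A = "edge_path (elem_edge r e)" and ?M = "detour r e w"
    and ?P = "path_act [] (path_pow (Ppath C (fst r) (snd r)) e) (psi D w)"
  note A = Lam_edge_paths(1)[OF r, of e, folded u]
  have L: "path_from_to (Bgens D) (Urels D) (Lam_path D u0) u0 U0"
    "path_from_to (Bgens D) (Urels D) (Lam_path D u1) u1 U1"
    and uw: "u0 \<in> Bwords" "u1 \<in> Bwords" and Uw: "U0 \<in> Bwords" "U1 \<in> Bwords"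
    unfolding U u using Lam_edge_paths(2-4)[OF r] by blast+
  have M: "path_from_to (Bgens D) (Urels D) ?M U0 U1"
    unfolding U u by (rule detour_path[OF assms])
  note th = theta_path[OF w]
  obtain T0 where T0: "path_from_to (alph D) (rels D) T0 (pihom D u0 @ h @ psi D w) (h @ psi D (u0 @ w))"
    and eq0: "QY.hom (theta (u0 @ w)) (path_act [] (Lam_path D u0) w \<circ>\<^sub>p path_act U0 (theta w) [] \<circ>\<^sub>p lift T0)"
    using theta_append[OF uw(1) w] unfolding U by blast
  obtain T1 where T1: "path_from_to (alph D) (rels D) T1 (pihom D u1 @ h @ psi D w) (h @ psi D (u1 @ w))"
    and eq1: "QY.hom (theta (u1 @ w)) (path_act [] (Lam_path D u1) w \<circ>\<^sub>p path_act U1 (theta w) [] \<circ>\<^sub>p lift T1)"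
    using theta_append[OF uw(2) w] unfolding U by blast
  have P: "path_from_to (alph D) (rels D) ?P (pihom D u0 @ h @ psi D w) (pihom D u1 @ h @ psi D w)"
    using path_from_to_act[OF Ppath_pow[OF r, of e] lists.Nil psi_words[OF w]] by (simp add: u)
  have l0: "lact D (pihom D u0 @ h @ psi D w) (et D) = Some (om D)"
    "lact D (pihom D u1 @ h @ psi D w) (et D) = Some (om D)"
    using lact_pihom_append[OF _ _ lact_h[OF w] et(1)] uw w by simp_all
  have LT0: "path_from_to (Bgens D) (Urels D) (lift T0) (U0 @ target w) (target (u0 @ w))"
    and LT1: "path_from_to (Bgens D) (Urels D) (lift T1) (U1 @ target w) (target (u1 @ w))"
    and LP: "path_from_to (Bgens D) (Urels D) (lift ?P) (U0 @ target w) (U1 @ target w)"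
    using lift_from_to[OF T0 l0(1)] lift_from_to[OF T1 l0(2)] lift_from_to[OF P l0(1)]
      phi_pihom_h[OF uw(1) w] phi_pihom_h[OF uw(2) w]
    by (simp_all add: U target_def)
  obtain y z Q0 where y: "y \<in> Wset D" and yz: "target w = y @ z" "z \<in> Bwords"
    and "y = phi D (lone D) (kappa D h (the (lact D (psi D w) (et D))))"
    and "Q_path D C (fst r) (snd r) e w = path_act [] Q0 (hat C y)"
    and Q0: "path_from_to (Bgens D) (Urels D) Q0 (phi_om D (pihom D (rel_side r e)) @ y)
      (phi_om D (pihom D (rel_side r (\<not> e))) @ y)"
    and Q0z: "lift ?P = path_act [] Q0 z"
    and M_eq: "?M = path_act (phi_om D (pihom D (rel_side r e))) (path_inv (Dpath C y)) [] \<circ>\<^sub>p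
      path_act [] Q0 (hat C y) \<circ>\<^sub>p
      path_act (phi_om D (pihom D (rel_side r (\<not> e)))) (Dpath C y) []"
    by (rule detour_data[OF assms, of e])
  note D = Dpath[OF y]
  \<comment> \<open>The detour is \<open>Q0\<close> with suffix \<open>hat y\<close>, conjugated by
    D_y; multiplication by y undoes both.\<close>
  have "QY.hom (path_act [] ?M y) Q0"
    unfolding M_eq u[symmetric] U[symmetric]
    using path_ends[OF D(1)] path_ends[OF D(2)] path_ends[OF Q0] Y2_null[OF y] Uw D(3,4)
    by (intro QY.cancel_inverse_word[where D' = "Dpath' C y"]) (simp_all add: U u)
  from QY.hom_act[OF this lists.Nil yz(2)]
  have Mt: "QY.hom (path_act [] ?M (target w)) (lift ?P)"
    unfolding yz(1) Q0z by simp
  have fL: "path_from_to (Bgens D) (Urels D) (path_act [] (Lam_path D u0) w) (u0 @ w) (U0 @ w)"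
    using path_from_to_act[OF L(1) lists.Nil w] by simp
  have fA: "path_from_to (Bgens D) (Urels D) (path_act [] ?A w) (u0 @ w) (u1 @ w)"
    using path_from_to_act[OF A lists.Nil w] by simp
  have fth0: "path_from_to (Bgens D) (Urels D) (path_act U0 (theta w) []) (U0 @ w) (U0 @ target w)"
    using path_from_to_act[OF th Uw(1) lists.Nil] by simp
  have fth1: "path_from_to (Bgens D) (Urels D) (path_act U1 (theta w) []) (U1 @ w) (U1 @ target w)"
    using path_from_to_act[OF th Uw(2) lists.Nil] by simp
  have rel: "QY.hom (path_act [] (?A \<circ>\<^sub>p Lam_path D u1) w) (path_act [] (Lam_path D u0 \<circ>\<^sub>p ?M) w)"
    using QY.hom_act[OF detour_relation[OF assms, of e] lists.Nil w] unfolding u .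
  have T: "path_from_to (alph D) (rels D) (path_inv T0 \<circ>\<^sub>p ?P \<circ>\<^sub>p T1) (h @ psi D (u0 @ w)) (h @ psi D (u1 @ w))"
    by (rule P.path_from_to_comp[OF P.path_from_to_inv[OF T0] P.path_from_to_comp[OF P T1]])
  have liftT: "lift (path_inv T0 \<circ>\<^sub>p ?P \<circ>\<^sub>p T1) = path_inv (lift T0) \<circ>\<^sub>p lift ?P \<circ>\<^sub>p lift T1"
    using T0 l0(1) by (simp add: lift_comp lift_inv path_from_to_def)
  have "QY.hom (path_act [] ?A w \<circ>\<^sub>p theta (u1 @ w))
      (path_act [] ?A w \<circ>\<^sub>p path_act [] (Lam_path D u1) w \<circ>\<^sub>p path_act U1 (theta w) [] \<circ>\<^sub>p lift T1)"
    by (rule hom_left[OF eq1 fA]) (use path_ends(1)[OF theta_path] uw w in simp)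
  also have "\<dots> = path_act [] (?A \<circ>\<^sub>p Lam_path D u1) w \<circ>\<^sub>p path_act U1 (theta w) [] \<circ>\<^sub>p lift T1"
    unfolding path_comp_assoc path_act_comp ..
  also have "QY.hom \<dots> (path_act [] (Lam_path D u0 \<circ>\<^sub>p ?M) w \<circ>\<^sub>p path_act U1 (theta w) [] \<circ>\<^sub>p lift T1)"
    by (rule hom_right[OF rel Q.path_from_to_comp[OF fth1 LT1]])
      (use path_ends(2)[OF Q.path_from_to_comp[OF A L(2)]] in simp)
  also have "\<dots> = path_act [] (Lam_path D u0) w \<circ>\<^sub>p
      (path_act [] ?M (fst (theta w)) \<circ>\<^sub>p path_act (path_term ?M) (theta w) []) \<circ>\<^sub>p lift T1"
    unfolding path_comp_assoc path_act_comp path_ends(1)[OF th] path_ends(2)[OF M] ..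
  also have "QY.hom \<dots> (path_act [] (Lam_path D u0) w \<circ>\<^sub>p
      (path_act (fst ?M) (theta w) [] \<circ>\<^sub>p path_act [] ?M (path_term (theta w))) \<circ>\<^sub>p lift T1)"
    by (rule hom_left[OF hom_right[OF QY.interchange LT1] fL])
      (use path_ends[OF M] path_ends[OF th] in simp_all)
  also have "\<dots> = path_act [] (Lam_path D u0) w \<circ>\<^sub>p path_act U0 (theta w) [] \<circ>\<^sub>p
      path_act [] ?M (target w) \<circ>\<^sub>p lift T1"
    unfolding path_comp_assoc path_ends(2)[OF th] path_ends(1)[OF M] ..
  also have "QY.hom \<dots> (path_act [] (Lam_path D u0) w \<circ>\<^sub>p path_act U0 (theta w) [] \<circ>\<^sub>p
      lift ?P \<circ>\<^sub>p lift T1)"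
    by (rule hom_left[OF hom_left[OF hom_right[OF Mt LT1] fth0] fL])
      (use path_ends[OF M] path_ends[OF fth0] in simp_all)
  also have "\<dots> = (path_act [] (Lam_path D u0) w \<circ>\<^sub>p path_act U0 (theta w) []) \<circ>\<^sub>p (lift ?P \<circ>\<^sub>p lift T1)"
    unfolding path_comp_assoc ..
  \<comment> \<open>The inserted lift of \<open>T0\<close> completes \<open>theta (u0 @ w)\<close>
    in the form of \<open>theta_append\<close>; its inverse begins the new lift.\<close>
  also have "QY.hom \<dots> ((path_act [] (Lam_path D u0) w \<circ>\<^sub>p path_act U0 (theta w) []) \<circ>\<^sub>p
      (lift T0 \<circ>\<^sub>p path_inv (lift T0) \<circ>\<^sub>p lift ?P \<circ>\<^sub>p lift T1))"
    by (rule hom_left[OF cancel_left[OF path_ends(3)[OF LT0] path_ends(3)[OF Q.path_from_to_comp[OF LP LT1]]]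
          Q.path_from_to_comp[OF fL fth0]])
      (use path_ends[OF LT0] path_ends[OF LP] in simp_all)
  also have "\<dots> = (path_act [] (Lam_path D u0) w \<circ>\<^sub>p path_act U0 (theta w) [] \<circ>\<^sub>p lift T0) \<circ>\<^sub>p
      lift (path_inv T0 \<circ>\<^sub>p ?P \<circ>\<^sub>p T1)"
    unfolding liftT path_comp_assoc ..
  also have "QY.hom \<dots> (theta (u0 @ w) \<circ>\<^sub>p lift (path_inv T0 \<circ>\<^sub>p ?P \<circ>\<^sub>p T1))"
    by (rule hom_right[OF QY.hom_sym[OF eq0] lift_target[OF T]])
      (use path_ends[OF fL] path_ends[OF fth0] path_ends[OF LT0] uw w in simp_all)
  finally show ?thesis
    unfolding liftable_def u[symmetric] using T fA by blast
qed

text \<open>The suffix is already general in \<open>liftable_elem_edge\<close>; the prefix is added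
  letter by letter, in step with the recursion of \<open>theta\<close>.\<close>

lemma liftable_edge:
  assumes "E \<in> graph_edges (Bgens D) (Urels D)"
  shows "liftable (edge_path E) (edge_init E) (edge_term E)"
proof -
  from assms obtain \<alpha> r e \<beta> where E: "E = Edge \<alpha> r e \<beta>" "\<alpha> \<in> Bwords" "\<beta> \<in> Bwords" "r \<in> Urels D"
    by (auto simp: graph_edges_def)
  have "liftable (path_act \<alpha> (edge_path (elem_edge r e)) \<beta>) (\<alpha> @ rel_side r e @ \<beta>)
      (\<alpha> @ rel_side r (\<not> e) @ \<beta>)"
    using E(2)
  proof (induction \<alpha>)
    case Nil
    then show ?case using liftable_elem_edge[OF E(4,3)] by simp
  next
    case (Cons b \<alpha>)
    then show ?case using liftable_Cons[of _ _ _ b] by fastforce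
  qed
  then show ?thesis
    by (simp add: E(1) path_act_edge elem_edge_def)
qed

lemma liftable_path:
  assumes "is_dpath (Bgens D) (Urels D) Z"
  shows "liftable Z (fst Z) (path_term Z)"
proof -
  have "is_dpath (Bgens D) (Urels D) (w, es) \<Longrightarrow> liftable (w, es) w (path_term (w, es))" for w es
  proof (induction es arbitrary: w)
    case Nil
    then show ?case using liftable_empty by simp
  next
    case (Cons E es)
    then have "liftable (edge_path E \<circ>\<^sub>p (edge_term E, es)) (edge_init E) (path_term (edge_term E, es))"
      using liftable_edge by (intro liftable_comp) auto
    then show ?case
      using Cons.prems by (simp add: path_comp_def edge_path_def)
  qed
  from this[of "fst Z" "snd Z"] assms show ?thesis by simp
qed

lemma Y_base: "homotopy_base (Bgens D) (Urels D) Y"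
  unfolding QY.base_iff
proof (intro allI impI)
  fix Z assume "closed_path (Bgens D) (Urels D) Z"
  then have Z: "path_from_to (Bgens D) (Urels D) Z (fst Z) (fst Z)"
    by (simp add: closed_path_def path_from_to_def)
  then have w: "fst Z \<in> Bwords"
    using Q.path_from_to_words by blast
  have "liftable Z (fst Z) (fst Z)"
    using liftable_path path_ends(2,3)[OF Z] by metis
  then obtain P where P: "path_from_to (alph D) (rels D) P (h @ psi D (fst Z)) (h @ psi D (fst Z))"
    and eq: "QY.hom (Z \<circ>\<^sub>p theta (fst Z)) (theta (fst Z) \<circ>\<^sub>p lift P)"
    unfolding liftable_def by blast
  note th = theta_path[OF w]
  note LP = lift_target[OF P w]
  note eq
  also have "QY.hom (theta (fst Z) \<circ>\<^sub>p lift P) (theta (fst Z) \<circ>\<^sub>p (fst (lift P), []))"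
    by (rule hom_left[OF lift_closed_null[OF P lact_h[OF w]] th path_ends(1)[OF LP]])
  finally have "QY.hom (Z \<circ>\<^sub>p theta (fst Z)) (theta (fst Z))"
    by simp
  from QY.hom_move_right[OF this]
  have "QY.hom Z (theta (fst Z) \<circ>\<^sub>p path_inv (theta (fst Z)))"
    using path_ends[OF Z] path_ends[OF th] by simp
  also have "QY.hom \<dots> (fst Z, [])"
    using QY.hom_inv_right[OF path_ends(3)[OF th]] path_ends(1)[OF th] by simp
  finally show "QY.hom Z (fst Z, [])" .
qed

section \<open>Finiteness\<close>

lemma finite_Urels:
  assumes "finite (rels D)" "finite (Jset D)" "finite L" "finite (Bgens D)"
  shows "finite (Urels D)"
proof -
  have "U1 D \<subseteq> (\<lambda>(l, u, v). (phi D l u, phi D l v)) ` (L \<times> rels D)"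
    unfolding U1_def by force
  moreover have "U2 D \<subseteq> (\<lambda>(l, (u, v), j). (phi D l (kappa D u j), phi D l (kappa D v j))) `
      (L \<times> rels D \<times> Jset D)"
  proof
    fix r assume "r \<in> U2 D"
    then obtain l u v j where "r = (phi D l (kappa D u j), phi D l (kappa D v j))"
      "(l, (u, v), j) \<in> L \<times> rels D \<times> Jset D"
      unfolding U2_def by blast
    then show "r \<in> (\<lambda>(l, (u, v), j). (phi D l (kappa D u j), phi D l (kappa D v j))) `
      (L \<times> rels D \<times> Jset D)"
      by (intro image_eqI[of _ _ "(l, (u, v), j)"]) simp_all
  qed
  moreover have "U3 D \<subseteq> (\<lambda>b. ([b], phi_om D (pihom D [b]))) ` Bgens D"
    unfolding U3_def by force
  ultimately show ?thesis
    unfolding Urels_def U4_def using assms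
    by (simp add: finite_subset[OF _ finite_imageI])
qed

lemma finite_Wset: "finite (Jset D) \<Longrightarrow> finite (Wset D)"
proof -
  have "Wset D \<subseteq> (\<lambda>j. phi D (lone D) (kappa D h j)) ` Jset D"
    unfolding Wset_def by blast
  then show "finite (Jset D) \<Longrightarrow> finite (Wset D)"
    using finite_subset by blast
qed

text \<open>The infinitely many contexts \<alpha>, \<beta> enter a member of Y_1 only through one
  index in \<Lambda> and one in J.\<close>

lemma Y1_subset: "Y1 D X \<subseteq> (\<lambda>(l, P, j). phi_path D l P j) ` (L \<times> X \<times> Jset D)"
proof
  fix K assume "K \<in> Y1 D X"
  then obtain P \<alpha> \<beta> l j where K: "K = phi_path D
        (the (ract D l (kappa D \<alpha> (the (lact D (fst P @ \<beta>) j))))) P (the (lact D \<beta> j))"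
    "P \<in> X" "\<alpha> \<in> words" "\<beta> \<in> words" "l \<in> L" "j \<in> Jset D" "adm l j (\<alpha> @ fst P @ \<beta>)"
    unfolding Y1_def adm_def by auto
  obtain k n m where k: "k \<in> Jset D" "m \<in> L" "lact D \<beta> j = Some k" "lact D (fst P @ \<beta>) j = Some n"
    "ract D l (kappa D \<alpha> n) = Some m"
    using Y1_data[OF K(2-)] by blast
  then have "K = (\<lambda>(l, P, j). phi_path D l P j) (m, P, k)"
    by (simp add: K(1))
  then show "K \<in> (\<lambda>(l, P, j). phi_path D l P j) ` (L \<times> X \<times> Jset D)"
    using k K(2) by blast
qed

text \<open>\<open>Y3_path\<close> depends on its last argument only through the index \<open>\<psi>(w) * \<eta> \<in> J\<close>.\<close>

lemma finite_Y3:
  assumes "finite (Urels D)" "finite (Jset D)"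
  shows "finite (Y3 D C)"
proof -
  let ?idx = "\<lambda>w. the (lact D (psi D w) (et D))"
  have "?idx w \<in> Jset D" if "w \<in> Bwords" for w
    by (rule lact_psi_et[OF that]) simp
  then have "?idx ` Bwords \<subseteq> Jset D"
    by blast
  then have "finite (?idx ` Bwords)"
    using assms(2) by (rule finite_subset)
  \<comment> \<open>Finitely many words \<open>B\<close> already realise every index that
    occurs.\<close>
  from finite_subset_image[OF this subset_refl]
  obtain B where B: "B \<subseteq> Bwords" "finite B" "?idx ` Bwords = ?idx ` B"
    by blast
  have "Y3 D C \<subseteq> (\<lambda>((u, v), e, w). Y3_path D C u v e w) ` (Urels D \<times> UNIV \<times> B)"
  proof
    fix K assume "K \<in> Y3 D C"
    then obtain u v e w where K: "K = Y3_path D C u v e w" "(u, v) \<in> Urels D" "w \<in> Bwords"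
      unfolding Y3_def by blast
    then obtain w' where w': "w' \<in> B" "?idx w = ?idx w'"
      using B(3) by blast
    then have "K = Y3_path D C u v e w'"
      by (simp add: K(1) Y3_path_def Q_path_def)
    then have "K = (\<lambda>((u, v), e, w). Y3_path D C u v e w) ((u, v), e, w')"
      by simp
    then show "K \<in> (\<lambda>((u, v), e, w). Y3_path D C u v e w) ` (Urels D \<times> UNIV \<times> B)"
      using K(2) w'(1) by blast
  qed
  moreover have "finite (Urels D \<times> (UNIV :: bool set) \<times> B)"
    using assms(1) B(2) by simp
  ultimately show ?thesis
    using finite_subset finite_imageI by blast
qed

lemma finite_all:
  assumes "finite (alph D)" "finite (rels D)" "finite (Jset D)" "finite L" "finite X"
  shows "finite (Bgens D) \<and> finite (Urels D) \<and> finite Y"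
proof (intro conjI finite_UnI)
  have "Bgens D \<subseteq> L \<times> alph D"
    by (auto simp: Bgens_def)
  then show B: "finite (Bgens D)"
    using assms finite_subset by blast
  show U: "finite (Urels D)"
    by (rule finite_Urels[OF assms(2-4) B])
  show "finite (Y1 D X)"
    using assms by (intro finite_subset[OF Y1_subset]) simp
  have "Y2 D C = (\<lambda>y. path_act [] (path_inv (Dpath C y)) y \<circ>\<^sub>p path_act y (Dpath' C y) []) ` Wset D"
    unfolding Y2_def by blast
  then show "finite (Y2 D C)"
    using finite_Wset assms by simp
  show "finite (Y3 D C)"
    by (rule finite_Y3[OF U assms(3)])
qed

end

theorem theorem3:
  fixes D :: "('s, 'a, 'l, 'i) schutz_data"
  assumes "schutz_setting D"
  shows "defined_by_pres (schutz_group (mon D) (hcl D)) (Bval D) (Bgens D) (Urels D) \<and>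
    (\<forall>(C :: ('a, 'l) schutz_choice) X.
       valid_choice D C \<longrightarrow> homotopy_base (alph D) (rels D) X \<longrightarrow>
         homotopy_base (Bgens D) (Urels D) (Y1 D X \<union> Y2 D C \<union> Y3 D C) \<and>
         (finite (alph D) \<and> finite (rels D) \<and> finite (Jset D) \<and> finite (Lam D) \<and> finite X \<longrightarrow>
            finite (Bgens D) \<and> finite (Urels D) \<and> finite (Y1 D X \<union> Y2 D C \<union> Y3 D C)))"
proof (intro conjI allI impI)
  show "defined_by_pres (schutz_group (mon D) (hcl D)) (Bval D) (Bgens D) (Urels D)"
    by (rule schutz_setting.G_presentation[OF assms])
next
  fix C :: "('a, 'l) schutz_choice" and X
  assume "valid_choice D C" "homotopy_base (alph D) (rels D) X"
  then have sh: "schutz_homotopy D C X"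
    using assms by (simp add: schutz_homotopy_def schutz_homotopy_axioms_def)
  show "homotopy_base (Bgens D) (Urels D) (Y1 D X \<union> Y2 D C \<union> Y3 D C)"
    by (rule schutz_homotopy.Y_base[OF sh])
  assume "finite (alph D) \<and> finite (rels D) \<and> finite (Jset D) \<and> finite (Lam D) \<and> finite X"
  then show "finite (Bgens D)" "finite (Urels D)" "finite (Y1 D X \<union> Y2 D C \<union> Y3 D C)"
    using schutz_homotopy.finite_all[OF sh] by blast+
qed

end
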